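(* Let $J=(\tilde J(\phi))_{\phi\in H_+}$ be a Jacobi field in the Fock space $\mathcal F(H)$ with entries $a_n(\phi), b_n(\phi), a_n^*(\phi)$ and spectral measure $\rho$ on $H_-$, let $K:T_+\to H_+$ be a continuous linear operator with $\operatorname{Ker}(K)=\{0\}$ and with $\operatorname{Ran}(K)$ dense in $H_+$, let $\rho_K$ be the image of $\rho$ under $K^+:H_-\to T_-$, and let $J_K=(\tilde J_K(f))_{f\in T_+}$ be the corresponding family of operators in $\mathcal F(T)$ (all as defined in the context). Assume that for all $f\in T_+$ and $n\in\mathbb Z_+$ the operator $a_n(Kf)$ maps $(\operatorname{Ran}(K))^{\hat\otimes n}$ into $(\operatorname{Ran}(K))^{\hat\otimes (n+1)}$, the operator $b_n(Kf)$ maps $(\operatorname{Ran}(K))^{\hat\otimes n}$ into $(\operatorname{Ran}(K))^{\hat\otimes n}$, and the operator $a_n^*(Kf)$ maps $(\operatorname{Ran}(K))^{\hat\otimes (n+1)}$ into $(\operatorname{Ran}(K))^{\hat\otimes n}$. Then there exists a vector-valued function $T_-\ni\omega\mapsto Q(\omega)\in(\mathcal F_{\mathrm{fin}}(T_+))'$ such that the following statements hold. 1. For $\rho_K$-almost all $\omega\in T_-$, the vector $Q(\omega)=(Q_n(\omega))_{n=0}^\infty\in(\mathcal F_{\mathrm{fin}}(T_+))'$ is a generalized joint eigenvector of the family $J_K$ with the eigenvalue $\omega$, i.e. $$\langle Q(\omega),\tilde J_K(f)F\rangle_T=\langle\omega,f\rangle_T\,\langle Q(\omega),F\rangle_T,\qquad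 f\in T_+,\ F\in\mathcal F_{\mathrm{fin}}(T_+).$$ 2. After being extended by continuity to the whole of the space $\mathcal F(T)$, the Fourier transform $$\mathcal F(T)\supset\mathcal F_{\mathrm{fin}}(T_+)\ni F=(F_n)_{n=0}^\infty\mapsto (I_KF)(\omega)=\langle F,Q(\omega)\rangle_T=\sum_{n=0}^\infty\langle F_n,Q_n(\omega)\rangle_T\in L^2(T_-,d\rho_K)$$ becomes a unitary operator between $\mathcal F(T)$ and $L^2(T_-,d\rho_K)$. 3. The mapping $I_K$ takes every operator $\tilde J_K(f)$, $f\in T_+$, to the operator of multiplication by the function $T_-\ni\omega\mapsto\langle\omega,f\rangle_T\in\mathbb R$ in the space $L^2(T_-,d\rho_K)$.
   Context: **Fock spaces.** For a real Hilbert space $X$ let $X_c$ be its complexification, $\mathcal F_n(X)=X_c^{\hat\otimes n}$ the $n$-th symmetric (Hilbert) tensor power, $\mathcal F_0(X)=\mathbb C$, and $\mathcal F(X)=\bigoplus_{n=0}^\infty\mathcal F_n(X)$ the symmetric Fock space. $\mathcal F_{\mathrm{fin}}(X)\subset\mathcal F(X)$ is the space of finite sequences $(\Phi_0,\dots,\Phi_n,0,0,\dots)$, with convergence meaning uniform finiteness together with coordinatewise convergence. $\Omega=(1,0,0,\dots)$ is the vacuum. $\mathbb Z_+=\{0,1,2,\dots\}$. **Riggings and pairings.** $H$ is a real separable Hilbert space and $H_-\supset H\supset H_+$ is a rigging with real Hilbert spaces: $H_+$ is densely and continuously embedded in $H$, $H_-=(H_+)'$ is the dual of $H_+$ with respect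 to the zero space $H$, $\|\cdot\|_{H_+}\ge\|\cdot\|_H$, and the embedding $H_+\hookrightarrow H$ is quasinuclear (Hilbert–Schmidt). The pairing between $H_-$ and $H_+$ given by the rigging is extended to pairings between $\mathcal F_n(H_-)$ and $\mathcal F_n(H_+)$ and between $(\mathcal F_{\mathrm{fin}}(H_+))'$ and $\mathcal F_{\mathrm{fin}}(H_+)$; all are denoted $\langle\cdot,\cdot\rangle_H$. On complex spaces they extend the scalar product: linear in the first argument, antilinear in the second, and $\langle P,\Phi\rangle_H=\overline{\langle\Phi,P\rangle_H}$. The space $(\mathcal F_{\mathrm{fin}}(H_+))'$ is identified with the direct product of the spaces $\mathcal F_n(H_-)$, $n\in\mathbb Z_+$. Likewise, $T_+$ is a real separable Hilbert space, $T_-\supset T_0\supset T_+$ is a rigging of real Hilbert spaces ($T_-=(T_+)'$ with respect to $T_0$), and $\langle\cdot,\cdot\rangle_T$ denotes the analogous pairings. **Jacobi field.** For each $\phi\in H_+$ and $n\in\mathbb Z_+$ let operators $a_n(\phi):\operatorname{Dom}(a_n(\phi))\subset\mathcal F_n(H)\to\mathcal F_{n+1}(H)$, $b_n(\phi)=(b_n(\phi))^*:\operatorname{Dom}(b_n(\phi))\subset\mathcal F_n(H)\to\mathcal F_n(H)$, and $a_n^*(\phi)=(a_n(\phi))^*:\operatorname{Dom}(a_n^*(\phi))\subset\mathcal F_{n+1}(H)\to\mathcal F_n(H)$ be given, where $\operatorname{Dom}(a_n(\phi))$ and $\operatorname{Dom}(b_n(\phi))$ contain $\mathcal F_n(H_+)$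 and $\operatorname{Dom}(a_n^*(\phi))$ contains $\mathcal F_{n+1}(H_+)$. Define the Hermitian operator $J(\phi)$ in $\mathcal F(H)$ with domain $\mathcal F_{\mathrm{fin}}(H_+)$ by $(J(\phi)\Phi)_n=a_{n-1}(\phi)\Phi_{n-1}+b_n(\phi)\Phi_n+a_n^*(\phi)\Phi_{n+1}$, $n\in\mathbb Z_+$, $a_{-1}(\phi)=0$. Let $\tilde J(\phi)$ be its closure. The family $J=(\tilde J(\phi))_{\phi\in H_+}$ is called a (commutative) Jacobi field if: (a) $a_n(\phi)$ and $b_n(\phi)$ take real spaces into real ones; (b) the restrictions of $a_n(\phi)$ and $b_n(\phi)$ to $\mathcal F_n(H_+)$ act continuously from $\mathcal F_n(H_+)$ to $\mathcal F_{n+1}(H_+)$ and $\mathcal F_n(H_+)$, respectively, and the restriction of $a_n^*(\phi)$ to $\mathcal F_{n+1}(H_+)$ acts continuously from $\mathcal F_{n+1}(H_+)$ to $\mathcal F_n(H_+)$; (c) the operators $J(\phi)$, $\phi\in H_+$, are essentially selfadjoint and their closures $\tilde J(\phi)$ are strongly commuting (their spectral measures commute); (d) for all $n\in\mathbb Z_+$, $\Phi_n\in\mathcal F_n(H_+)$, $\Phi_{n+1}\in\mathcal F_{n+1}(H_+)$, the functions $\phi\mapsto a_n(\phi)\Phi_n\in\mathcal F_{n+1}(H_+)$, $\phi\mapsto b_n(\phi)\Phi_n\in\mathcal F_n(H_+)$, $\phi\mapsto a_n^*(\phi)\Phi_{n+1}\in\mathcal F_n(H_+)$ are linear and continuous on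 $H_+$; (e) the real linear operators $V_n:\mathcal F_n(H_+)\to\bigoplus_{j=0}^n\mathcal F_j(H_+)$ defined by $V_0=\operatorname{Id}_{\mathbb C}$ and $V_n(\phi_1\hat\otimes\cdots\hat\otimes\phi_n)=J(\phi_1)\cdots J(\phi_n)\Omega$ ($\phi_i\in H_+$, $n\in\mathbb N$) are continuous, and the operators $\mathcal F_n(H_+)\ni F_n\mapsto V_{n,n}F_n=(V_nF_n)_n\in\mathcal F_n(H_+)$, $n\in\mathbb N$, are invertible. **Spectral measure of $J$.** By the known projection spectral theorem, for a Jacobi field $J$ there exist a Borel probability measure $\rho$ on $H_-$ (the spectral measure) and a function $H_-\ni\xi\mapsto P(\xi)=(P_n(\xi))_{n=0}^\infty\in(\mathcal F_{\mathrm{fin}}(H_+))'$ such that: (1) $\langle P(\xi),\tilde J(\phi)\Phi\rangle_H=\langle\xi,\phi\rangle_H\langle P(\xi),\Phi\rangle_H$ for all $\xi\in H_-$, $\phi\in H_+$, $\Phi\in\mathcal F_{\mathrm{fin}}(H_+)$; (2) the map $\mathcal F_{\mathrm{fin}}(H_+)\ni\Phi\mapsto(I\Phi)(\xi)=\langle\Phi,P(\xi)\rangle_H=\sum_n\langle\Phi_n,P_n(\xi)\rangle_H$ extends by continuity to a unitary operator $I:\mathcal F(H)\to L^2(H_-,d\rho)$; (3) $I$ takes $\tilde J(\phi)$ to the operator of multiplication by $\xi\mapsto\langle\xi,\phi\rangle_H$. The normalization is $I\Omega=1$. Such $\rho$ and $P$ are fixed. **Image measure.** $K^+:H_-\to T_-$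 is the continuous linear operator defined by $\langle K^+\xi,f\rangle_T=\langle\xi,Kf\rangle_H$, $\xi\in H_-$, $f\in T_+$. $\rho_K$ is the image of $\rho$ under $K^+$: $\rho_K(\Delta)=\rho((K^+)^{-1}(\Delta))$ on the $\sigma$-algebra $\mathcal C=\{\Delta\subset T_-:(K^+)^{-1}(\Delta)\in\mathcal B(H_-)\}$, where $\mathcal B(H_-)$ is the Borel $\sigma$-algebra of $H_-$. **The family $J_K$.** $T$ is the completion of $T_+$ with respect to the scalar product $(f_1,f_2)_T=(Kf_1,Kf_2)_H$; $K$ induces a unitary $\bar K:T\to H$. The same symbols denote the extensions to complexifications. For $f\in T_+$, $n\in\mathbb Z_+$ put $\alpha_n(f)=(\bar K^{\otimes(n+1)})^{-1}a_n(Kf)\bar K^{\otimes n}$, $\beta_n(f)=(\bar K^{\otimes n})^{-1}b_n(Kf)\bar K^{\otimes n}$ (on their natural domains in $\mathcal F_n(T)$), and $\alpha_n^*(f)=(\alpha_n(f))^*$. $J_K(f)$ is the Hermitian operator in $\mathcal F(T)$ with domain $\mathcal F_{\mathrm{fin}}(T_+)$ given by $(J_K(f)F)_n=\alpha_{n-1}(f)F_{n-1}+\beta_n(f)F_n+\alpha_n^*(f)F_{n+1}$, $\alpha_{-1}(f)=0$. $\tilde J_K(f)$ is the closure of $J_K(f)$, and $J_K=(\tilde J_K(f))_{f\in T_+}$. **Notation.** $(\operatorname{Ran}(K))^{\hat\otimes n}$ denotes the image $K^{\otimes n}(\mathcal F_n(T_+))\subset\mathcal F_n(H_+)$ (equal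 to $\mathbb C$ for $n=0$). *)

theory Defs
  imports "HOL-Probability.Probability" "HOL-Combinatorics.Permutations"
begin

section \<open>Symmetric Fock spaces\<close>

text \<open>
  The Hilbert tensor power of the complexification of a real Hilbert space \<open>X\<close> is realised, as in
  Kadison and Ringrose (Section 2.6), by complex-valued Hilbert-Schmidt multilinear functionals
  on \<open>X\<close>; the elementary tensor of \<open>x\<^sub>1, \<dots>, x\<^sub>n\<close> is the functional sending \<open>[y\<^sub>1, \<dots>, y\<^sub>n]\<close> to the
  product of the inner products of \<open>x\<^sub>i\<close> and \<open>y\<^sub>i\<close>. A functional of degree \<open>n\<close> lives on lists of
  length \<open>n\<close>, so one function on all lists encodes the sequence of its homogeneous components
  and the orthogonal sum of the tensor powers is an internal one.
\<close>

type_synonym 'x fvec = "'x list \<Rightarrow> complex"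

definition is_onb :: "'x::real_inner set \<Rightarrow> bool" where
  "is_onb B \<longleftrightarrow> pairwise orthogonal B \<and> (\<forall>x\<in>B. norm x = 1) \<and> closure (span B) = UNIV"

text \<open>An arbitrary orthonormal basis; nothing below depends on the choice.\<close>
definition onb :: "'x::real_inner set" where
  "onb = (SOME B. is_onb B)"

definition sym_form :: "'x::real_inner fvec \<Rightarrow> bool" where
  "sym_form u \<longleftrightarrow>
     (\<forall>xs ys. linear (\<lambda>x. u (xs @ x # ys))) \<and>
     (\<forall>xs ys. mset xs = mset ys \<longrightarrow> u xs = u ys) \<and>
     (\<forall>n. \<exists>C. \<forall>xs. length xs = n \<longrightarrow> cmod (u xs) \<le> C * prod_list (map norm xs))"

definition fock :: "'x::real_inner fvec set" where
  "fock = {u. sym_form u \<and> (\<lambda>xs. (cmod (u xs))\<^sup>2) summable_on lists onb}"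

definition fip :: "'x::real_inner fvec \<Rightarrow> 'x fvec \<Rightarrow> complex" where
  "fip u v = (\<Sum>\<^sub>\<infinity>xs\<in>lists onb. u xs * cnj (v xs))"

definition fnorm :: "'x::real_inner fvec \<Rightarrow> real" where
  "fnorm u = sqrt (\<Sum>\<^sub>\<infinity>xs\<in>lists onb. (cmod (u xs))\<^sup>2)"

definition fock_n :: "nat \<Rightarrow> 'x::real_inner fvec set" where
  "fock_n n = {u \<in> fock. \<forall>xs. length xs \<noteq> n \<longrightarrow> u xs = 0}"

definition level :: "nat \<Rightarrow> 'x fvec \<Rightarrow> 'x fvec" where
  "level n u = (\<lambda>xs. if length xs = n then u xs else 0)"

definition fock_fin :: "'x::real_inner fvec set" where
  "fock_fin = {u \<in> fock. \<exists>N. \<forall>xs. length xs > N \<longrightarrow> u xs = 0}"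

text \<open>The direct product of the \<open>n\<close>-particle spaces. Over the negative space of a rigging this is
  the dual of \<open>fock_fin\<close> over the positive space.\<close>
definition fock_prod :: "'x::real_inner fvec set" where
  "fock_prod = {u. \<forall>n. level n u \<in> fock_n n}"

definition vacuum :: "'x fvec" where
  "vacuum = (\<lambda>xs. if xs = [] then 1 else 0)"

text \<open>The symmetrised tensor product of real vectors.\<close>
definition sym_tensor :: "'x::real_inner list \<Rightarrow> 'x fvec" where
  "sym_tensor xs = (\<lambda>ys. if length ys = length xs
     then of_real ((\<Sum>p | p permutes {..<length xs}. \<Prod>k<length xs. inner (xs ! k) (ys ! p k))
                   / fact (length xs))
     else 0)"

definition is_real :: "'x fvec \<Rightarrow> bool" where
  "is_real u \<longleftrightarrow> (\<forall>xs. u xs \<in> \<real>)"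

text \<open>The direct sum of the tensor powers of a bounded operator. It sends the functional given by
  \<open>x\<close> to the one given by \<open>A x\<close>, hence the adjoint.\<close>
definition tpow :: "('x::real_inner \<Rightarrow> 'y::real_inner) \<Rightarrow> 'x fvec \<Rightarrow> 'y fvec" where
  "tpow A u = (\<lambda>ys. u (map (adjoint A) ys))"

definition clinear_on :: "'x fvec set \<Rightarrow> ('x fvec \<Rightarrow> 'y fvec) \<Rightarrow> bool" where
  "clinear_on S f \<longleftrightarrow> (\<forall>u\<in>S. \<forall>v\<in>S. \<forall>c. f (\<lambda>xs. u xs + c * v xs) = (\<lambda>ys. f u ys + c * f v ys))"


section \<open>Unbounded operators\<close>

text \<open>Operators are identified with their graphs.\<close>
type_synonym 'x fop = "('x fvec \<times> 'x fvec) set"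

definition lin_op :: "'x fvec set \<Rightarrow> 'x fvec set \<Rightarrow> 'x fop \<Rightarrow> bool" where
  "lin_op U V A \<longleftrightarrow> A \<subseteq> U \<times> V \<and> single_valued A \<and> (\<lambda>_. 0, \<lambda>_. 0) \<in> A \<and>
     (\<forall>(u, v)\<in>A. \<forall>(u', v')\<in>A. \<forall>c. (\<lambda>xs. u xs + c * u' xs, \<lambda>xs. v xs + c * v' xs) \<in> A)"

definition app :: "'x fop \<Rightarrow> 'x fvec \<Rightarrow> 'x fvec" where
  "app A u = (THE v. (u, v) \<in> A)"

text \<open>The adjoint of an operator from \<open>U\<close> to \<open>V\<close> with dense domain.\<close>
definition adj_op :: "'x::real_inner fvec set \<Rightarrow> 'x fvec set \<Rightarrow> 'x fop \<Rightarrow> 'x fop" where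
  "adj_op U V A = {(v, w). v \<in> V \<and> w \<in> U \<and> (\<forall>(u, z)\<in>A. fip z v = fip u w)}"

definition cl_op :: "'x::real_inner fop \<Rightarrow> 'x fop" where
  "cl_op A = {(u, v). u \<in> fock \<and> v \<in> fock \<and>
     (\<exists>s t. (\<forall>k::nat. (s k, t k) \<in> A) \<and>
        (\<lambda>k. fnorm (\<lambda>xs. s k xs - u xs)) \<longlonglongrightarrow> 0 \<and> (\<lambda>k. fnorm (\<lambda>xs. t k xs - v xs)) \<longlonglongrightarrow> 0)}"

text \<open>For an embedding \<open>e\<close> this is the part of \<open>A\<close> in the smaller space; for a unitary \<open>e\<close> it is
  the operator \<open>A\<close> conjugated by the tensor powers of \<open>e\<close>.\<close>
definition pull :: "('x::real_inner \<Rightarrow> 'y::real_inner) \<Rightarrow> 'y fop \<Rightarrow> 'x fop" where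
  "pull e A = {(u, v). u \<in> fock \<and> v \<in> fock \<and> (tpow e u, tpow e v) \<in> A}"

definition real_op :: "'x fop \<Rightarrow> bool" where
  "real_op A \<longleftrightarrow> (\<forall>(u, v)\<in>A. is_real u \<longrightarrow> is_real v)"

definition orth_proj :: "('x::real_inner fvec \<Rightarrow> 'x fvec) \<Rightarrow> bool" where
  "orth_proj p \<longleftrightarrow> clinear_on fock p \<and>
     (\<forall>u\<in>fock. p u \<in> fock \<and> p (p u) = p u \<and> (\<forall>v\<in>fock. fip (p u) v = fip u (p v)))"

definition proj_measure :: "(real set \<Rightarrow> 'x::real_inner fvec \<Rightarrow> 'x fvec) \<Rightarrow> bool" where
  "proj_measure E \<longleftrightarrow>
     (\<forall>D\<in>sets borel. orth_proj (E D)) \<and> (\<forall>u\<in>fock. E UNIV u = u) \<and>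
     (\<forall>D. range D \<subseteq> sets borel \<and> disjoint_family D \<longrightarrow>
        (\<forall>u\<in>fock. (\<lambda>N. fnorm (\<lambda>xs. E (\<Union>k::nat. D k) u xs - (\<Sum>k<N. E (D k) u xs))) \<longlonglongrightarrow> 0))"

definition scalar_measure ::
  "(real set \<Rightarrow> 'x::real_inner fvec \<Rightarrow> 'x fvec) \<Rightarrow> 'x fvec \<Rightarrow> real measure" where
  "scalar_measure E u = measure_of UNIV (sets borel) (\<lambda>D. ennreal (Re (fip (E D u) u)))"

text \<open>\<open>A\<close> is the integral of the identity function with respect to \<open>E\<close>; by polarisation it is
  enough to fix the domain and the quadratic form.\<close>
definition is_spectral_measure_of ::
  "(real set \<Rightarrow> 'x::real_inner fvec \<Rightarrow> 'x fvec) \<Rightarrow> 'x fop \<Rightarrow> bool" where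
  "is_spectral_measure_of E A \<longleftrightarrow> proj_measure E \<and> lin_op fock fock A \<and>
     Domain A = {u \<in> fock. integrable (scalar_measure E u) (\<lambda>t. t\<^sup>2)} \<and>
     (\<forall>(u, v)\<in>A. fip v u = of_real (\<integral>t. t \<partial>scalar_measure E u))"

definition strongly_commute :: "'x::real_inner fop \<Rightarrow> 'x fop \<Rightarrow> bool" where
  "strongly_commute A B \<longleftrightarrow> (\<exists>E F. is_spectral_measure_of E A \<and> is_spectral_measure_of F B \<and>
     (\<forall>D\<in>sets borel. \<forall>D'\<in>sets borel. \<forall>u\<in>fock. E D (F D' u) = F D' (E D u)))"


section \<open>Riggings and pairings\<close>

text \<open>\<open>i\<close> embeds the positive space into the zero space, \<open>j\<close> the zero space into the negative one;
  the negative space is the dual of the positive one through the pairing \<open>pr\<close>, which extends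
  the inner product of the zero space.\<close>
definition rigging ::
  "('p::real_inner \<Rightarrow> 'z::real_inner) \<Rightarrow> ('z \<Rightarrow> 'm::real_inner) \<Rightarrow> ('m \<Rightarrow> 'p \<Rightarrow> real) \<Rightarrow> bool" where
  "rigging i j pr \<longleftrightarrow>
     bounded_linear i \<and> inj i \<and> closure (range i) = UNIV \<and>
     (\<forall>\<phi>. linear (\<lambda>\<xi>. pr \<xi> \<phi>)) \<and>
     (\<forall>\<xi>. bounded_linear (pr \<xi>) \<and> norm \<xi> = onorm (pr \<xi>)) \<and>
     (\<forall>l. bounded_linear l \<longrightarrow> (\<exists>\<xi>. pr \<xi> = l)) \<and>
     (\<forall>h \<phi>. pr (j h) \<phi> = inner h (i \<phi>))"

definition quasinuclear :: "('x::real_inner \<Rightarrow> 'y::real_inner) \<Rightarrow> bool" where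
  "quasinuclear A \<longleftrightarrow> bounded_linear A \<and> (\<lambda>x. (norm (A x))\<^sup>2) summable_on onb"

text \<open>The canonical isometry of the negative space onto the positive one.\<close>
definition riesz :: "('m \<Rightarrow> 'p::real_inner \<Rightarrow> real) \<Rightarrow> 'm \<Rightarrow> 'p" where
  "riesz pr \<xi> = (THE r. \<forall>\<phi>. pr \<xi> \<phi> = inner r \<phi>)"

text \<open>The pairing of \<open>q \<in> fock_prod\<close> over the negative space with \<open>F \<in> fock_fin\<close> over the positive
  one; on elementary tensors of equal degree it is the product of the pairings of the factors.\<close>
definition fpair :: "('m::real_inner \<Rightarrow> 'p::real_inner \<Rightarrow> real) \<Rightarrow> 'm fvec \<Rightarrow> 'p fvec \<Rightarrow> complex" where
  "fpair pr q F = (\<Sum>n. fip (tpow (riesz pr) (level n q)) (level n F))"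

text \<open>The operator \<open>K\<^sup>+\<close> between the negative spaces.\<close>
definition dual_op ::
  "('hm \<Rightarrow> 'hp \<Rightarrow> real) \<Rightarrow> ('tm \<Rightarrow> 'tp \<Rightarrow> real) \<Rightarrow> ('tp \<Rightarrow> 'hp) \<Rightarrow> 'hm \<Rightarrow> 'tm" where
  "dual_op prH prT K \<xi> = (THE \<omega>. \<forall>f. prT \<omega> f = prH \<xi> (K f))"

definition image_measure :: "'x::topological_space measure \<Rightarrow> ('x \<Rightarrow> 'y) \<Rightarrow> 'y measure" where
  "image_measure \<rho> k = distr \<rho> (sigma UNIV {D. k -` D \<in> sets borel}) k"


section \<open>Jacobi fields\<close>

text \<open>The Jacobi matrix with entries \<open>A n\<close>, \<open>B n\<close> and the adjoints of \<open>A n\<close>, on the finite vectors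
  over the space embedded by \<open>e\<close>.\<close>
definition jacobi_op ::
  "('p::real_inner \<Rightarrow> 'x::real_inner) \<Rightarrow> (nat \<Rightarrow> 'x fop) \<Rightarrow> (nat \<Rightarrow> 'x fop) \<Rightarrow> 'x fop" where
  "jacobi_op e A B = {(u, v). u \<in> tpow e ` fock_fin \<and> v \<in> fock \<and>
     (\<forall>n. \<exists>x y z.
        (case n of 0 \<Rightarrow> x = (\<lambda>_. 0) | Suc m \<Rightarrow> (level m u, x) \<in> A m) \<and>
        (level n u, y) \<in> B n \<and>
        (level (Suc n) u, z) \<in> adj_op (fock_n n) (fock_n (Suc n)) (A n) \<and>
        level n v = (\<lambda>xs. x xs + y xs + z xs))}"

definition acts_continuously ::
  "('p::real_inner \<Rightarrow> 'x::real_inner) \<Rightarrow> nat \<Rightarrow> nat \<Rightarrow> 'x fop \<Rightarrow> bool" where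
  "acts_continuously i n m A \<longleftrightarrow>
     (\<exists>C. \<forall>u\<in>fock_n n. \<exists>v\<in>fock_n m. (u, v) \<in> pull i A \<and> fnorm v \<le> C * fnorm u)"

definition depends_linearly_continuously ::
  "('p::real_inner \<Rightarrow> 'x::real_inner) \<Rightarrow> nat \<Rightarrow> ('p \<Rightarrow> 'x fop) \<Rightarrow> bool" where
  "depends_linearly_continuously i n A \<longleftrightarrow>
     (\<forall>u\<in>fock_n n. (\<forall>xs. linear (\<lambda>\<phi>. app (pull i (A \<phi>)) u xs)) \<and>
        (\<exists>C. \<forall>\<phi>. fnorm (app (pull i (A \<phi>)) u) \<le> C * norm \<phi>))"

definition jacobi_field ::
  "('p::real_inner \<Rightarrow> 'x::real_inner) \<Rightarrow> (nat \<Rightarrow> 'p \<Rightarrow> 'x fop) \<Rightarrow> (nat \<Rightarrow> 'p \<Rightarrow> 'x fop) \<Rightarrow> bool" where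
  "jacobi_field i a b \<longleftrightarrow>
    (let as = (\<lambda>n \<phi>. adj_op (fock_n n) (fock_n (Suc n)) (a n \<phi>));
         J = (\<lambda>\<phi>. jacobi_op i (\<lambda>n. a n \<phi>) (\<lambda>n. b n \<phi>))
     in
      (\<forall>n \<phi>. lin_op (fock_n n) (fock_n (Suc n)) (a n \<phi>) \<and> lin_op (fock_n n) (fock_n n) (b n \<phi>) \<and>
         tpow i ` fock_n n \<subseteq> Domain (a n \<phi>) \<and> tpow i ` fock_n n \<subseteq> Domain (b n \<phi>) \<and>
         tpow i ` fock_n (Suc n) \<subseteq> Domain (as n \<phi>) \<and>
         adj_op (fock_n n) (fock_n n) (b n \<phi>) = b n \<phi>) \<and>
      (\<forall>n \<phi>. real_op (a n \<phi>) \<and> real_op (b n \<phi>)) \<and>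
      (\<forall>n \<phi>. acts_continuously i n (Suc n) (a n \<phi>) \<and> acts_continuously i n n (b n \<phi>) \<and>
         acts_continuously i (Suc n) n (as n \<phi>)) \<and>
      (\<forall>\<phi>. adj_op fock fock (cl_op (J \<phi>)) = cl_op (J \<phi>)) \<and>
      (\<forall>\<phi> \<psi>. strongly_commute (cl_op (J \<phi>)) (cl_op (J \<psi>))) \<and>
      (\<forall>n. depends_linearly_continuously i n (a n) \<and> depends_linearly_continuously i n (b n) \<and>
         depends_linearly_continuously i (Suc n) (as n)) \<and>
      (\<forall>n. \<exists>V. clinear_on (fock_n n) V \<and>
         (\<forall>u\<in>fock_n n. V u \<in> fock \<and> (\<forall>xs. length xs > n \<longrightarrow> V u xs = 0) \<and>
            (is_real u \<longrightarrow> is_real (V u))) \<and>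
         (\<exists>C. \<forall>u\<in>fock_n n. fnorm (V u) \<le> C * fnorm u) \<and>
         (\<forall>\<phi>s. length \<phi>s = n \<longrightarrow>
            V (sym_tensor \<phi>s) = foldr (\<lambda>\<phi>. app (pull i (J \<phi>))) \<phi>s vacuum) \<and>
         bij_betw (\<lambda>u. level n (V u)) (fock_n n) (fock_n n)))"


section \<open>Generalized eigenvectors and Fourier transforms\<close>

text \<open>\<open>A\<close> acts in the Fock space over the space into which \<open>e\<close> embeds the positive space.\<close>
definition gen_eigenvector ::
  "('p::real_inner \<Rightarrow> 'x::real_inner) \<Rightarrow> ('m::real_inner \<Rightarrow> 'p \<Rightarrow> real) \<Rightarrow> 'x fop \<Rightarrow> real \<Rightarrow> 'm fvec \<Rightarrow> bool"
  where
  "gen_eigenvector e pr A l q \<longleftrightarrow>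
     (\<forall>F\<in>fock_fin. \<exists>G\<in>fock_fin. (tpow e F, tpow e G) \<in> A \<and> fpair pr q G = of_real l * fpair pr q F)"

definition L2 :: "'w measure \<Rightarrow> ('w \<Rightarrow> complex) set" where
  "L2 M = {g \<in> borel_measurable M. integrable M (\<lambda>w. (cmod (g w))\<^sup>2)}"

text \<open>Elements of the Hilbert space of square integrable functions are represented by functions,
  equality being almost everywhere equality.\<close>
definition unitary_onto_L2 :: "'w measure \<Rightarrow> ('x::real_inner fvec \<Rightarrow> 'w \<Rightarrow> complex) \<Rightarrow> bool" where
  "unitary_onto_L2 M U \<longleftrightarrow>
     (\<forall>u\<in>fock. U u \<in> L2 M \<and> (\<integral>w. (cmod (U u w))\<^sup>2 \<partial>M) = (fnorm u)\<^sup>2) \<and>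
     (\<forall>u\<in>fock. \<forall>v\<in>fock. \<forall>c. AE w in M. U (\<lambda>xs. u xs + c * v xs) w = U u w + c * U v w) \<and>
     (\<forall>g\<in>L2 M. \<exists>u\<in>fock. AE w in M. U u w = g w)"

text \<open>\<open>U\<close> is unitary and extends the Fourier transform defined by \<open>Q\<close> on the finite vectors; as
  these are dense, such a \<open>U\<close> is the extension by continuity.\<close>
definition fourier_extension ::
  "('p::real_inner \<Rightarrow> 'x::real_inner) \<Rightarrow> ('m::real_inner \<Rightarrow> 'p \<Rightarrow> real) \<Rightarrow> 'm measure \<Rightarrow>
   ('m \<Rightarrow> 'm fvec) \<Rightarrow> ('x fvec \<Rightarrow> 'm \<Rightarrow> complex) \<Rightarrow> bool" where
  "fourier_extension e pr M Q U \<longleftrightarrow> unitary_onto_L2 M U \<and>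
     (\<forall>F\<in>fock_fin. (\<lambda>w. cnj (fpair pr (Q w) F)) \<in> L2 M \<and>
        (AE w in M. U (tpow e F) w = cnj (fpair pr (Q w) F)))"

text \<open>The domain of the multiplication operator is the maximal one.\<close>
definition takes_to_multiplication ::
  "'w measure \<Rightarrow> ('x::real_inner fvec \<Rightarrow> 'w \<Rightarrow> complex) \<Rightarrow> 'x fop \<Rightarrow> ('w \<Rightarrow> real) \<Rightarrow> bool" where
  "takes_to_multiplication M U A m \<longleftrightarrow>
     (\<forall>u\<in>fock. \<forall>v\<in>fock. (u, v) \<in> A \<longleftrightarrow> (AE w in M. U v w = of_real (m w) * U u w))"

definition spectral_data ::
  "('p::real_inner \<Rightarrow> 'x::real_inner) \<Rightarrow> ('m::real_inner \<Rightarrow> 'p \<Rightarrow> real) \<Rightarrow> ('p \<Rightarrow> 'x fop) \<Rightarrow>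
   'm measure \<Rightarrow> ('m \<Rightarrow> 'm fvec) \<Rightarrow> bool" where
  "spectral_data i pr Jt \<rho> P \<longleftrightarrow> prob_space \<rho> \<and> sets \<rho> = sets borel \<and>
     (\<forall>\<xi>. P \<xi> \<in> fock_prod) \<and>
     (\<forall>\<xi> \<phi>. gen_eigenvector i pr (Jt \<phi>) (pr \<xi> \<phi>) (P \<xi>)) \<and>
     (\<exists>I. fourier_extension i pr \<rho> P I \<and> (AE \<xi> in \<rho>. I vacuum \<xi> = 1) \<and>
        (\<forall>\<phi>. takes_to_multiplication \<rho> I (Jt \<phi>) (\<lambda>\<xi>. pr \<xi> \<phi>)))"


section \<open>The transformed family\<close>

text \<open>\<open>c\<close> is a completion map of the domain of \<open>k\<close> for the scalar product induced by \<open>k\<close>.\<close>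
definition completion_map ::
  "('tp::real_inner \<Rightarrow> 'h::real_inner) \<Rightarrow> ('tp \<Rightarrow> 't::{real_inner, complete_space}) \<Rightarrow> bool" where
  "completion_map k c \<longleftrightarrow> linear c \<and> (\<forall>f g. inner (c f) (c g) = inner (k f) (k g)) \<and>
     closure (range c) = UNIV"

definition extension ::
  "('tp \<Rightarrow> 'h::real_normed_vector) \<Rightarrow> ('tp \<Rightarrow> 't::real_normed_vector) \<Rightarrow> 't \<Rightarrow> 'h" where
  "extension k c = (THE L. bounded_linear L \<and> (\<forall>f. L (c f) = k f))"

definition J_K ::
  "('hp::real_inner \<Rightarrow> 'h::real_inner) \<Rightarrow> (nat \<Rightarrow> 'hp \<Rightarrow> 'h fop) \<Rightarrow> (nat \<Rightarrow> 'hp \<Rightarrow> 'h fop) \<Rightarrow>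
   ('tp::real_inner \<Rightarrow> 'hp) \<Rightarrow> ('tp \<Rightarrow> 't::real_inner) \<Rightarrow> 'tp \<Rightarrow> 't fop" where
  "J_K i a b K c f = (let Kbar = extension (i \<circ> K) c in
     jacobi_op c (\<lambda>n. pull Kbar (a n (K f))) (\<lambda>n. pull Kbar (b n (K f))))"

definition maps_into ::
  "('p::real_inner \<Rightarrow> 'x::real_inner) \<Rightarrow> 'x fop \<Rightarrow> 'p fvec set \<Rightarrow> 'p fvec set \<Rightarrow> bool" where
  "maps_into i A S S' \<longleftrightarrow> (\<forall>u\<in>S. \<exists>v\<in>S'. (u, v) \<in> pull i A)"

end

theory Submission
  imports Defs
begin

text \<open>
  Let \<open>U\<close> be the unitary extension of \<open>K\<close> and \<open>D = K\<^sup>+\<close>, which is injective because \<open>K\<close> has dense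
  range. The \<open>\<sigma>\<close>-algebra of the image measure is so large that composition with \<open>D\<close> identifies
  the two \<open>L\<^sup>2\<close> spaces. Hence \<open>Q (D \<xi>)\<close> is the tensor power of \<open>D\<close> applied to \<open>P \<xi>\<close>, and \<open>I_K\<close> is
  \<open>I\<close> after the tensor power of \<open>U\<close>; the eigenvector equation and unitarity carry over. For the
  multiplication operators one needs that \<open>U\<close> carries the closure of \<open>J_K f\<close> onto the whole closure
  of \<open>J (K f)\<close>: vectors over \<open>Ran K\<close> are dense in the finite vectors over the positive space, on
  which the Jacobi matrix is continuous.

  That tensor powers act on Hilbert-Schmidt functionals, with the expected adjoints, is proved by
  exchanging the two orthonormal bases one slot at a time with Parseval's identity.
\<close>

section \<open>Hilbert space preliminaries\<close>

text \<open>Tensors are multilinear functionals, so \<open>tpow A\<close> precomposes with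
  \<open>adjoint A\<close>, and a bound C on A yields the bound C^n in degree n. Hence only
  contractions such as the unitary and the embedding \<open>iH\<close> act on all of
  \<open>fock\<close>; \<open>K\<close> and the approximants are applied to vectors of bounded
  degree, \<open>D\<close> to one degree at a time. For functionals, pointwise convergence on basis
  lists together with control of the norms gives norm convergence. Density of the range of
  \<open>tpow K\<close> therefore rests on approximate right inverses S of \<open>K\<close>: the
  adjoints of K o S converge on the basis, and the norm bounds of K o S tend to 1, as do their N-th
  powers for fixed N. Operators are graphs, so a Jacobi matrix is a priori a relation. Its
  single-valuedness, needed to identify independently constructed images of one vector, is read off
  from \<open>I\<close>, which turns the closure into a multiplication operator. \<open>D\<close>
  need not be onto; \<open>Q\<close> and \<open>I_K\<close> are defined through
  \<open>inv D\<close>, and their values off the range of \<open>D\<close> do not matter since that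
  set is null for the image measure.\<close>

lemma riesz_subspace:
  fixes l :: "'a::{real_inner, complete_space} \<Rightarrow> real"
  assumes S: "subspace S" "closed S" and l: "bounded_linear l"
  shows "\<exists>r\<in>S. \<forall>x\<in>S. l x = r \<bullet> x"
proof -
  interpret l: bounded_linear l by (rule l)
  \<comment> \<open>If r represents l on S, then q x = |x - r|^2 - |r|^2 on S, so r is sought as a
    minimiser of q. Boundedness of l keeps the infimum finite.\<close>
  define q where "q x = x \<bullet> x - 2 * l x" for x
  obtain C where C: "\<And>x. \<bar>l x\<bar> \<le> norm x * C" using l.bounded by auto
  have q_lower: "q x \<ge> - (C\<^sup>2)" for x
  proof -
    have "0 \<le> (norm x - C)\<^sup>2" by simp
    also have "\<dots> = x \<bullet> x - 2 * (norm x * C) + C\<^sup>2"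
      by (simp add: power2_diff power2_norm_eq_inner algebra_simps)
    also have "\<dots> \<le> q x + C\<^sup>2" using C[of x] unfolding q_def by linarith
    finally show ?thesis by simp
  qed
  define m where "m = Inf (q ` S)"
  have bdd: "bdd_below (q ` S)" using q_lower by (auto intro!: bdd_belowI[of _ "- (C\<^sup>2)"])
  have ne: "q ` S \<noteq> {}" using subspace_0[OF S(1)] by auto
  have m_le: "m \<le> q x" if "x \<in> S" for x
    unfolding m_def by (rule cInf_lower) (use that bdd in auto)
  have "\<exists>x\<in>S. q x < m + 1 / Suc n" for n :: nat
  proof -
    have "Inf (q ` S) < m + 1 / Suc n" unfolding m_def by simp
    from cInf_lessD[OF ne this] show ?thesis by auto
  qed
  then obtain X where X: "\<And>n. X n \<in> S" "\<And>n. q (X n) < m + 1 / Suc n" by metis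
  \<comment> \<open>The parallelogram law: q at a midpoint is at least the infimum, so a minimising
    sequence is Cauchy.\<close>
  have par: "(norm (x - y))\<^sup>2 = 2 * (q x + q y - 2 * q ((1/2) *\<^sub>R (x + y)))" for x y
    unfolding q_def by (simp add: power2_norm_eq_inner inner_simps l.add l.scaleR inner_commute algebra_simps)
  have XX: "(norm (X i - X j))\<^sup>2 \<le> 2 * (1 / Suc i + 1 / Suc j)" for i j
  proof -
    have "(1/2) *\<^sub>R (X i + X j) \<in> S" using S(1) X(1) by (simp add: subspace_add subspace_scale)
    from m_le[OF this] show ?thesis unfolding par using X(2)[of i] X(2)[of j] by simp
  qed
  have "Cauchy X"
  proof (rule metric_CauchyI)
    fix e :: real assume "e > 0"
    then obtain N :: nat where N: "inverse (real (Suc N)) < e\<^sup>2 / 4" using reals_Archimedean[of "e\<^sup>2 / 4"] by auto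
    show "\<exists>M. \<forall>i\<ge>M. \<forall>j\<ge>M. dist (X i) (X j) < e"
    proof (intro exI allI impI)
      fix i j assume "i \<ge> N" "j \<ge> N"
      then have "1 / real (Suc i) \<le> inverse (real (Suc N))" "1 / real (Suc j) \<le> inverse (real (Suc N))"
        by (simp_all add: divide_simps)
      moreover have "2 * (p + p') \<le> 4 * r" if "p \<le> r" "p' \<le> r" for p p' r :: real
        using that by simp
      ultimately have "2 * (1 / real (Suc i) + 1 / real (Suc j)) \<le> 4 * inverse (real (Suc N))"
        by blast
      also have "\<dots> < e\<^sup>2" using N by linarith
      finally have "(norm (X i - X j))\<^sup>2 < e\<^sup>2" using XX[of i j] by linarith
      then show "dist (X i) (X j) < e" using \<open>e > 0\<close> by (simp add: dist_norm power2_less_imp_less)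
    qed
  qed
  then obtain r where r: "X \<longlonglongrightarrow> r" using Cauchy_convergent convergent_def by blast
  have rS: "r \<in> S" using S(2) X(1) r closed_sequentially by blast
  have "(\<lambda>n. q (X n)) \<longlonglongrightarrow> q r" unfolding q_def by (intro tendsto_intros r l.tendsto)
  moreover have "(\<lambda>n. m + 1 / Suc n) \<longlonglongrightarrow> m + 0"
    by (intro tendsto_intros) (use LIMSEQ_inverse_real_of_nat in \<open>simp add: inverse_eq_divide\<close>)
  ultimately have "q r \<le> m + 0" by (rule LIMSEQ_le) (use X(2) less_imp_le in blast)
  then have qr: "q r \<le> m" by simp
  have "l x = r \<bullet> x" if x: "x \<in> S" for x
  proof (rule ccontr)
    assume ne: "l x \<noteq> r \<bullet> x"
    define d where "d = l x - r \<bullet> x"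
    have x0: "x \<bullet> x > 0" using ne l.zero by auto
    \<comment> \<open>The minimiser of q on the line through r in direction x; moving there would
      lower q by d^2 / (x . x).\<close>
    define t where "t = d / (x \<bullet> x)"
    have "r + t *\<^sub>R x \<in> S" using rS x S(1) by (simp add: subspace_add subspace_scale)
    from m_le[OF this] have "q r \<le> q (r + t *\<^sub>R x)" using qr by simp
    also have "\<dots> = q r + t * (t * (x \<bullet> x) - 2 * d)"
      unfolding q_def d_def by (simp add: l.add l.scaleR inner_simps inner_commute algebra_simps)
    finally have "0 \<le> t * (t * (x \<bullet> x) - 2 * d)" by simp
    also have "\<dots> = - (d * d / (x \<bullet> x))" unfolding t_def using x0 by (simp add: field_simps)
    finally have "d * d / (x \<bullet> x) \<le> 0" by simp
    then have "d * d \<le> 0" using x0 by (simp add: divide_le_0_iff)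
    then have "d = 0" by (auto simp: mult_le_0_iff)
    then show False using ne by (simp add: d_def)
  qed
  with rS show ?thesis by blast
qed

lemma riesz_representation:
  fixes l :: "'a::{real_inner, complete_space} \<Rightarrow> real"
  assumes "bounded_linear l"
  obtains r where "\<And>x. l x = r \<bullet> x"
  using riesz_subspace[OF subspace_UNIV closed_UNIV assms] by auto

lemma dense_eqI:
  fixes x y :: "'a::real_inner"
  assumes "closure S = UNIV" "\<And>s. s \<in> S \<Longrightarrow> x \<bullet> s = y \<bullet> s"
  shows "x = y"
proof -
  have "closed {z. x \<bullet> z = y \<bullet> z}" by (intro closed_Collect_eq continuous_intros)
  then have "closure S \<subseteq> {z. x \<bullet> z = y \<bullet> z}" by (rule closure_minimal[rotated]) (use assms(2) in auto)
  then have "x \<bullet> (x - y) = y \<bullet> (x - y)" using assms(1) by auto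
  then have "(x - y) \<bullet> (x - y) = 0" by (simp add: inner_simps)
  then show ?thesis by simp
qed

lemma subspace_closure:
  fixes S :: "'a::real_normed_vector set"
  assumes S: "subspace S"
  shows "subspace (closure S)"
proof (rule subspaceI)
  show "0 \<in> closure S" using subspace_0[OF S] closure_subset by blast
  show "x + y \<in> closure S" if xy: "x \<in> closure S" "y \<in> closure S" for x y
  proof -
    obtain f g where "\<forall>n. f n \<in> S" "f \<longlonglongrightarrow> x" "\<forall>n. g n \<in> S" "g \<longlonglongrightarrow> y"
      using xy unfolding closure_sequential by blast
    then show ?thesis unfolding closure_sequential
      by (intro exI[of _ "\<lambda>n. f n + g n"]) (auto intro!: subspace_add[OF S] tendsto_add)
  qed
  show "c *\<^sub>R x \<in> closure S" if xy: "x \<in> closure S" for c x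
  proof -
    obtain f where "\<forall>n. f n \<in> S" "f \<longlonglongrightarrow> x" using xy unfolding closure_sequential by blast
    then show ?thesis unfolding closure_sequential
      by (intro exI[of _ "\<lambda>n. c *\<^sub>R f n"]) (auto intro!: subspace_scale[OF S] tendsto_intros)
  qed
qed

text \<open>The vector is y minus its orthogonal projection r onto \<open>closure S\<close>, where r
  is the Riesz vector, within that closed subspace, of the inner product with y.\<close>

lemma orthogonal_complement_nontrivial:
  fixes S :: "'a::{real_inner, complete_space} set"
  assumes "subspace S" "closure S \<noteq> UNIV"
  obtains z where "z \<noteq> 0" "\<And>s. s \<in> S \<Longrightarrow> z \<bullet> s = 0"
proof -
  obtain y where y: "y \<notin> closure S" using assms(2) by auto
  have "subspace (closure S)" using assms(1) by (rule subspace_closure)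
  from riesz_subspace[OF this closed_closure, of "(\<bullet>) y"]
  obtain r where r: "r \<in> closure S" "\<forall>x\<in>closure S. y \<bullet> x = r \<bullet> x"
    by (auto simp: bounded_linear_inner_right)
  show thesis
  proof (rule that[of "y - r"])
    show "y - r \<noteq> 0" using r y by auto
    show "(y - r) \<bullet> s = 0" if "s \<in> S" for s using that r closure_subset[of S] by (auto simp: inner_simps)
  qed
qed

text \<open>Zorn's lemma gives a maximal orthonormal set; if its span were not dense, a unit vector
  orthogonal to it could be adjoined. So the choice \<open>onb\<close> is meaningful in every
  complete space.\<close>

lemma is_onb_onb: "is_onb (onb :: 'a::{real_inner, complete_space} set)"
proof -
  define A where "A = {B :: 'a set. pairwise orthogonal B \<and> (\<forall>x\<in>B. norm x = 1)}"
  have "\<exists>M\<in>A. \<forall>X\<in>A. M \<subseteq> X \<longrightarrow> X = M"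
  proof (rule subset_Zorn')
    fix C assume C: "subset.chain A C"
    have CA: "C \<subseteq> A" using C by (simp add: subset_chain_def)
    have "orthogonal x y" if xy: "x \<in> \<Union>C" "y \<in> \<Union>C" "x \<noteq> y" for x y
    proof -
      obtain X Y where XY: "X \<in> C" "Y \<in> C" "x \<in> X" "y \<in> Y" using xy by auto
      then consider "X \<subseteq> Y" | "Y \<subseteq> X" using C by (auto simp: subset_chain_def)
      then obtain Z where "Z \<in> C" "x \<in> Z" "y \<in> Z" using XY by cases auto
      then show ?thesis using CA xy(3) by (auto simp: A_def pairwise_def)
    qed
    then show "\<Union>C \<in> A" using CA unfolding A_def by (auto simp: pairwise_def)
  qed
  then obtain M where M: "M \<in> A" "\<And>X. X \<in> A \<Longrightarrow> M \<subseteq> X \<Longrightarrow> X = M" by auto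
  have "closure (span M) = UNIV"
  proof (rule ccontr)
    assume "closure (span M) \<noteq> UNIV"
    from orthogonal_complement_nontrivial[OF subspace_span this]
    obtain z where z: "z \<noteq> 0" "\<And>s. s \<in> span M \<Longrightarrow> z \<bullet> s = 0" by blast
    define e where "e = (1 / norm z) *\<^sub>R z"
    have e: "norm e = 1" "\<And>s. s \<in> M \<Longrightarrow> e \<bullet> s = 0"
      using z by (auto simp: e_def span_base)
    have "insert e M \<in> A" using M(1) e unfolding A_def
      by (auto simp: pairwise_insert orthogonal_def inner_commute)
    from M(2)[OF this] have "e \<in> M" by auto
    from e(2)[OF this] e(1) show False by (simp add: norm_eq_sqrt_inner)
  qed
  then have "is_onb M" using M(1) by (auto simp: is_onb_def A_def)
  then show ?thesis unfolding onb_def by (rule someI)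
qed

section \<open>Finite expansions in an orthonormal basis, Bessel and Parseval\<close>

lemma inner_onb:
  assumes "is_onb B" "x \<in> B" "y \<in> B"
  shows "x \<bullet> y = (if x = y then 1 else 0)"
  using assms by (auto simp: is_onb_def pairwise_def orthogonal_def power2_norm_eq_inner[symmetric])

text \<open>One identity with three uses: Fourier coefficients for u give Bessel's inequality,
  nonnegativity of the last sum gives their optimality as needed for Parseval, and x = 0 gives
  Pythagoras.\<close>

lemma norm_diff_onb_sum:
  assumes B: "is_onb B" and F: "finite F" "F \<subseteq> B"
  shows "(norm (x - (\<Sum>b\<in>F. u b *\<^sub>R b)))\<^sup>2 = (norm x)\<^sup>2 - (\<Sum>b\<in>F. (x \<bullet> b)\<^sup>2) + (\<Sum>b\<in>F. (x \<bullet> b - u b)\<^sup>2)"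
proof -
  define s where "s = (\<Sum>b\<in>F. u b *\<^sub>R b)"
  have xs: "x \<bullet> s = (\<Sum>b\<in>F. u b * (x \<bullet> b))" by (simp add: s_def inner_sum_right)
  have bs: "b \<bullet> s = u b" if "b \<in> F" for b
  proof -
    have "b \<bullet> s = (\<Sum>b'\<in>F. u b' * (if b = b' then 1 else 0))"
      unfolding s_def inner_sum_right inner_scaleR_right
    proof (rule sum.cong)
      fix b' assume "b' \<in> F"
      then have "b \<in> B" "b' \<in> B" using that F by auto
      from inner_onb[OF B this] show "u b' * (b \<bullet> b') = u b' * (if b = b' then 1 else 0)" by simp
    qed simp
    also have "\<dots> = (\<Sum>b'\<in>F. if b = b' then u b' else 0)" by (rule sum.cong) auto
    also have "\<dots> = u b" using that F by (simp add: sum.delta')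
    finally show ?thesis .
  qed
  have ss: "s \<bullet> s = (\<Sum>b\<in>F. (u b)\<^sup>2)"
  proof -
    have "s \<bullet> s = (\<Sum>b\<in>F. u b * (b \<bullet> s))" by (simp add: s_def inner_sum_left)
    also have "\<dots> = (\<Sum>b\<in>F. (u b)\<^sup>2)" by (rule sum.cong) (simp_all add: bs power2_eq_square)
    finally show ?thesis .
  qed
  have "(norm (x - s))\<^sup>2 = x \<bullet> x - 2 * (x \<bullet> s) + s \<bullet> s"
    by (simp add: power2_norm_eq_inner inner_simps inner_commute)
  also have "\<dots> = (norm x)\<^sup>2 - (\<Sum>b\<in>F. (x \<bullet> b)\<^sup>2) + (\<Sum>b\<in>F. (x \<bullet> b - u b)\<^sup>2)"
    unfolding xs ss
    by (simp add: power2_norm_eq_inner power2_diff sum.distrib sum_subtractf sum_distrib_left mult_ac)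
  finally show ?thesis unfolding s_def .
qed

lemma bessel:
  assumes "is_onb B" "finite F" "F \<subseteq> B"
  shows "(\<Sum>b\<in>F. (x \<bullet> b)\<^sup>2) \<le> (norm x)\<^sup>2"
  using norm_diff_onb_sum[OF assms, of x "\<lambda>b. x \<bullet> b"] zero_le_power2[of "norm (x - (\<Sum>b\<in>F. (x \<bullet> b) *\<^sub>R b))"] by simp

lemma parseval:
  assumes B: "is_onb B"
  shows "((\<lambda>b. (x \<bullet> b)\<^sup>2) has_sum (norm x)\<^sup>2) B"
  unfolding has_sum_def
proof (rule tendstoI)
  fix e :: real assume e: "e > 0"
  have "x \<in> closure (span B)" using B by (auto simp: is_onb_def)
  then obtain y where y: "y \<in> span B" "dist y x < sqrt e"
    using e unfolding closure_approachable by (meson real_sqrt_gt_zero)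
  obtain F u where F: "finite F" "F \<subseteq> B" "y = (\<Sum>b\<in>F. u b *\<^sub>R b)"
    using y(1) unfolding span_explicit by auto
  have "(norm (x - y))\<^sup>2 < e"
    using y(2) e by (metis dist_commute dist_norm norm_ge_zero power_strict_mono real_sqrt_pow2 zero_less_numeral less_imp_le)
  \<comment> \<open>Passing from the coefficients u to the Fourier coefficients of x only decreases
    the distance, so the approximant y bounds the partial sum over F from below.\<close>
  then have low: "(norm x)\<^sup>2 - e < (\<Sum>b\<in>F. (x \<bullet> b)\<^sup>2)"
    using norm_diff_onb_sum[OF B F(1,2), of x u] F(3) sum_nonneg[of F "\<lambda>b. (x \<bullet> b - u b)\<^sup>2"] by simp
  show "\<forall>\<^sub>F F in finite_subsets_at_top B. dist (\<Sum>b\<in>F. (x \<bullet> b)\<^sup>2) ((norm x)\<^sup>2) < e"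
    unfolding eventually_finite_subsets_at_top
  proof (intro exI[of _ F] conjI allI impI F)
    fix G assume G: "finite G \<and> F \<subseteq> G \<and> G \<subseteq> B"
    then have "(\<Sum>b\<in>F. (x \<bullet> b)\<^sup>2) \<le> (\<Sum>b\<in>G. (x \<bullet> b)\<^sup>2)" by (intro sum_mono2) auto
    with low bessel[OF B, of G x] G show "dist (\<Sum>b\<in>G. (x \<bullet> b)\<^sup>2) ((norm x)\<^sup>2) < e"
      by (auto simp: dist_real_def)
  qed
qed

text \<open>Polarisation of \<open>parseval\<close>.\<close>

lemma parseval_inner:
  assumes B: "is_onb B"
  shows "((\<lambda>b. (x \<bullet> b) * (y \<bullet> b)) has_sum x \<bullet> y) B"
proof -
  have "((\<lambda>b. (1/4) * (((x + y) \<bullet> b)\<^sup>2 + - ((x - y) \<bullet> b)\<^sup>2)) has_sum (1/4) * ((norm (x + y))\<^sup>2 + - (norm (x - y))\<^sup>2)) B"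
    by (intro has_sum_cmult_right has_sum_add has_sum_uminusI parseval B)
  moreover have "(1/4) * (((x + y) \<bullet> b)\<^sup>2 + - ((x - y) \<bullet> b)\<^sup>2) = (x \<bullet> b) * (y \<bullet> b)" for b
    by (simp add: inner_simps power2_eq_square algebra_simps)
  moreover have "(1/4) * ((norm (x + y))\<^sup>2 + - (norm (x - y))\<^sup>2) = x \<bullet> y"
    by (simp add: power2_norm_eq_inner inner_simps inner_commute)
  ultimately show ?thesis by simp
qed

text \<open>\<open>adjoint\<close> is defined by choice and satisfies its equation as soon as some
  adjoint exists; the Riesz vectors of x |-> A x . y provide one.\<close>

lemma adjoint_works_hilbert:
  fixes A :: "'a::{real_inner, complete_space} \<Rightarrow> 'b::real_inner"
  assumes "bounded_linear A"
  shows "A x \<bullet> y = x \<bullet> adjoint A y"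
proof -
  have "\<exists>r. \<forall>x. A x \<bullet> y = x \<bullet> r" for y
  proof -
    have "bounded_linear (\<lambda>x. A x \<bullet> y)"
      using bounded_linear_compose[OF bounded_linear_inner_left assms] .
    from riesz_representation[OF this] show ?thesis by (metis inner_commute)
  qed
  then have "\<exists>f'. \<forall>x y. A x \<bullet> y = x \<bullet> f' y" by metis
  then show ?thesis unfolding adjoint_def by (rule someI2_ex) auto
qed

lemma norm_adjoint_le:
  fixes A :: "'a::{real_inner, complete_space} \<Rightarrow> 'b::real_inner"
  assumes A: "bounded_linear A" and C: "\<And>x. norm (A x) \<le> C * norm x" and "C \<ge> 0"
  shows "norm (adjoint A y) \<le> C * norm y"
proof -
  have "norm (adjoint A y) * norm (adjoint A y) = A (adjoint A y) \<bullet> y"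
    by (simp add: adjoint_works_hilbert[OF A] norm_eq_sqrt_inner)
  also have "\<dots> \<le> norm (A (adjoint A y)) * norm y" by (rule norm_cauchy_schwarz)
  also have "\<dots> \<le> C * norm (adjoint A y) * norm y" by (intro mult_right_mono C) simp
  finally have "norm (adjoint A y) * norm (adjoint A y) \<le> (C * norm y) * norm (adjoint A y)" by (simp add: mult_ac)
  then show ?thesis using \<open>C \<ge> 0\<close> by (cases "norm (adjoint A y) = 0") (auto simp: mult_le_cancel_right)
qed

lemma bounded_linear_adjoint:
  fixes A :: "'a::{real_inner, complete_space} \<Rightarrow> 'b::real_inner"
  assumes A: "bounded_linear A"
  shows "bounded_linear (adjoint A)"
proof -
  obtain C where C: "C \<ge> 0" "\<And>x. norm (A x) \<le> C * norm x"
    using bounded_linear.nonneg_bounded[OF A] by (auto simp: mult.commute)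
  show ?thesis
  proof (rule bounded_linear_intro)
    show "adjoint A (x + y) = adjoint A x + adjoint A y" for x y
      by (rule vector_eq_ldot[THEN iffD1])
        (simp add: inner_add_right adjoint_works_hilbert[OF A, symmetric])
    show "adjoint A (r *\<^sub>R x) = r *\<^sub>R adjoint A x" for r x
      by (rule vector_eq_ldot[THEN iffD1]) (simp add: inner_scaleR_right adjoint_works_hilbert[OF A, symmetric])
    show "norm (adjoint A x) \<le> norm x * C" for x
      using norm_adjoint_le[OF A C(2,1)] by (simp add: mult.commute)
  qed
qed

lemma adjoint_unique_hilbert:
  fixes A :: "'a::{real_inner, complete_space} \<Rightarrow> 'b::real_inner"
  assumes A: "bounded_linear A" and B: "\<And>x y. A x \<bullet> y = x \<bullet> B y"
  shows "adjoint A = B"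
proof
  fix y show "adjoint A y = B y"
    by (rule vector_eq_ldot[THEN iffD1]) (metis B adjoint_works_hilbert[OF A])
qed

lemma adjoint_adjoint_hilbert:
  fixes A :: "'a::{real_inner, complete_space} \<Rightarrow> 'b::{real_inner, complete_space}"
  assumes "bounded_linear A"
  shows "adjoint (adjoint A) = A"
  by (rule adjoint_unique_hilbert[OF bounded_linear_adjoint[OF assms]])
    (metis adjoint_works_hilbert[OF assms] inner_commute)

lemma adjoint_compose_hilbert:
  fixes A :: "'a::{real_inner, complete_space} \<Rightarrow> 'b::{real_inner, complete_space}"
    and B :: "'b \<Rightarrow> 'c::real_inner"
  assumes "bounded_linear A" "bounded_linear B"
  shows "adjoint (B \<circ> A) = adjoint A \<circ> adjoint B"
  by (rule adjoint_unique_hilbert)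
    (simp_all add: comp_def bounded_linear_compose assms adjoint_works_hilbert)

text \<open>A vector orthogonal to the range of the adjoint lies in the kernel of A.\<close>

lemma adjoint_dense_range:
  fixes A :: "'a::{real_inner, complete_space} \<Rightarrow> 'b::{real_inner, complete_space}"
  assumes A: "bounded_linear A" and inj: "\<And>x. A x = 0 \<Longrightarrow> x = 0"
  shows "closure (range (adjoint A)) = UNIV"
proof (rule ccontr)
  have sub: "subspace (range (adjoint A))"
    using bounded_linear_adjoint[OF A] by (auto intro!: linear_subspace_image simp: bounded_linear.linear)
  assume "closure (range (adjoint A)) \<noteq> UNIV"
  from orthogonal_complement_nontrivial[OF sub this]
  obtain z where z: "z \<noteq> 0" "\<And>s. s \<in> range (adjoint A) \<Longrightarrow> z \<bullet> s = 0" by blast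
  have "A z \<bullet> A z = 0" using z(2)[of "adjoint A (A z)"] by (simp add: adjoint_works_hilbert[OF A])
  then show False using inj z(1) by simp
qed

section \<open>Hilbert-Schmidt multilinear forms\<close>

text \<open>As integrals over counting measures, nonnegative sums can be interchanged
  unconditionally, so Hilbert-Schmidt norms can be estimated before they are known to be
  finite.\<close>

lemma summable_on_iff_nn_integral:
  assumes "\<And>x. x \<in> A \<Longrightarrow> f x \<ge> (0::real)"
  shows "f summable_on A \<longleftrightarrow> (\<integral>\<^sup>+x. ennreal (f x) \<partial>count_space A) < \<infinity>"
proof -
  have "f summable_on A \<longleftrightarrow> Infinite_Set_Sum.abs_summable_on f A"
    by (subst summable_on_iff_abs_summable_on_real) (simp only: abs_summable_equivalent)
  also have "\<dots> \<longleftrightarrow> (\<integral>\<^sup>+x. ennreal (norm (f x)) \<partial>count_space A) < \<infinity>"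
    by (simp add: Infinite_Set_Sum.abs_summable_on_def integrable_iff_bounded)
  also have "(\<integral>\<^sup>+x. ennreal (norm (f x)) \<partial>count_space A) = (\<integral>\<^sup>+x. ennreal (f x) \<partial>count_space A)"
    by (rule nn_integral_cong) (use assms in auto)
  finally show ?thesis .
qed

lemma nn_integral_count_space_eq_infsum:
  assumes "\<And>x. x \<in> A \<Longrightarrow> f x \<ge> (0::real)" "f summable_on A"
  shows "(\<integral>\<^sup>+x. ennreal (f x) \<partial>count_space A) = ennreal (infsum f A)"
proof -
  have abs: "Infinite_Set_Sum.abs_summable_on f A"
    using assms(2) by (subst (asm) summable_on_iff_abs_summable_on_real) (simp only: abs_summable_equivalent)
  have "(\<integral>\<^sup>+x. ennreal (f x) \<partial>count_space A) = ennreal (infsetsum f A)"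
    unfolding infsetsum_def
    by (rule nn_integral_eq_integral) (use abs assms in \<open>auto simp: Infinite_Set_Sum.abs_summable_on_def intro!: AE_I2\<close>)
  also have "infsetsum f A = infsum f A" using abs by (rule infsetsum_infsum)
  finally show ?thesis .
qed

lemma nn_integral_count_space_has_sum:
  assumes "\<And>x. x \<in> A \<Longrightarrow> f x \<ge> (0::real)" "(f has_sum s) A"
  shows "(\<integral>\<^sup>+x. ennreal (f x) \<partial>count_space A) = ennreal s"
  using nn_integral_count_space_eq_infsum[OF assms(1)] assms(2) by (auto simp: has_sum_iff)

text \<open>Reduction to counting measures on whole types, where iterated integration holds without
  sigma-finiteness; the index sets may be uncountable.\<close>

lemma nn_integral_count_space_Times:
  "(\<integral>\<^sup>+x. \<integral>\<^sup>+y. f (x, y) \<partial>count_space B \<partial>count_space A) = (\<integral>\<^sup>+p. f p \<partial>count_space (A \<times> B))"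
proof -
  have "(\<integral>\<^sup>+p. f p \<partial>count_space (A \<times> B)) = (\<integral>\<^sup>+p. f p * indicator (A \<times> B) p \<partial>count_space UNIV)"
    by (simp add: nn_integral_count_space_indicator)
  also have "\<dots> = (\<integral>\<^sup>+x. \<integral>\<^sup>+y. f (x, y) * indicator (A \<times> B) (x, y) \<partial>count_space UNIV \<partial>count_space UNIV)"
    by (rule nn_integral_fst_count_space[symmetric])
  also have "\<dots> = (\<integral>\<^sup>+x. (\<integral>\<^sup>+y. f (x, y) * indicator B y \<partial>count_space UNIV) * indicator A x \<partial>count_space UNIV)"
    by (rule nn_integral_cong) (auto simp: indicator_def intro!: nn_integral_cong)
  also have "\<dots> = (\<integral>\<^sup>+x. \<integral>\<^sup>+y. f (x, y) \<partial>count_space B \<partial>count_space A)"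
    by (simp add: nn_integral_count_space_indicator)
  finally show ?thesis ..
qed

lemma nn_integral_count_space_swap:
  "(\<integral>\<^sup>+x. \<integral>\<^sup>+y. f x y \<partial>count_space B \<partial>count_space A) = (\<integral>\<^sup>+y. \<integral>\<^sup>+x. f x y \<partial>count_space A \<partial>count_space B)"
proof -
  have "(\<integral>\<^sup>+x. \<integral>\<^sup>+y. f x y \<partial>count_space B \<partial>count_space A) = (\<integral>\<^sup>+p. case_prod f p \<partial>count_space (A \<times> B))"
    by (simp flip: nn_integral_count_space_Times)
  also have "\<dots> = (\<integral>\<^sup>+p. case_prod f (prod.swap p) \<partial>count_space (B \<times> A))"
    by (rule nn_integral_bij_count_space[symmetric]) (auto simp: bij_betw_def inj_on_def)
  also have "\<dots> = (\<integral>\<^sup>+y. \<integral>\<^sup>+x. f x y \<partial>count_space A \<partial>count_space B)"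
    by (simp flip: nn_integral_count_space_Times)
  finally show ?thesis .
qed

text \<open>Real and imaginary part each have a Riesz vector. This turns one slot of a form into two
  vectors to which Parseval applies.\<close>

lemma complex_functional_repr:
  fixes l :: "'a::{real_inner, complete_space} \<Rightarrow> complex"
  assumes "bounded_linear l"
  obtains p q where "\<And>x. l x = Complex (p \<bullet> x) (q \<bullet> x)"
proof -
  obtain p where p: "\<And>x. Re (l x) = p \<bullet> x"
    using riesz_representation[OF bounded_linear_compose[OF bounded_linear_Re assms]] by blast
  obtain q where q: "\<And>x. Im (l x) = q \<bullet> x"
    using riesz_representation[OF bounded_linear_compose[OF bounded_linear_Im assms]] by blast
  show thesis by (rule that[of p q]) (simp add: complex_eq_iff p q)
qed

text \<open>Parseval for p and for q. The value does not mention the basis, which is what allows a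
  basis to be exchanged in one slot.\<close>

lemma nn_integral_onb_functional:
  "(\<integral>\<^sup>+b. ennreal ((cmod (Complex (p \<bullet> b) (q \<bullet> b)))\<^sup>2) \<partial>count_space (onb :: 'a::{real_inner, complete_space} set))
     = ennreal ((norm p)\<^sup>2 + (norm q)\<^sup>2)"
  by (rule nn_integral_count_space_has_sum)
    (simp_all add: cmod_power2 has_sum_add parseval is_onb_onb)

text \<open>The sesquilinear counterpart: the sum over the basis is the complex inner product of the
  vectors p + i q and r + i s.\<close>

lemma has_sum_onb_functionals:
  "((\<lambda>b. Complex (p \<bullet> b) (q \<bullet> b) * cnj (Complex (r \<bullet> b) (s \<bullet> b))) has_sum
     Complex (p \<bullet> r + q \<bullet> s) (q \<bullet> r - p \<bullet> s)) (onb :: 'a::{real_inner, complete_space} set)"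
proof -
  have "((\<lambda>b. of_real ((p \<bullet> b) * (r \<bullet> b) + (q \<bullet> b) * (s \<bullet> b))
        + \<i> * of_real ((q \<bullet> b) * (r \<bullet> b) + - ((p \<bullet> b) * (s \<bullet> b)))) has_sum
      of_real (p \<bullet> r + q \<bullet> s) + \<i> * of_real (q \<bullet> r + - (p \<bullet> s))) (onb :: 'a set)"
    by (intro has_sum_add has_sum_cmult_right has_sum_of_real has_sum_uminusI parseval_inner is_onb_onb)
  moreover have "of_real ((p \<bullet> b) * (r \<bullet> b) + (q \<bullet> b) * (s \<bullet> b))
        + \<i> * of_real ((q \<bullet> b) * (r \<bullet> b) + - ((p \<bullet> b) * (s \<bullet> b)))
      = Complex (p \<bullet> b) (q \<bullet> b) * cnj (Complex (r \<bullet> b) (s \<bullet> b))" for b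
    by (simp add: complex_eq_iff)
  moreover have "of_real (p \<bullet> r + q \<bullet> s) + \<i> * of_real (q \<bullet> r + - (p \<bullet> s)) = Complex (p \<bullet> r + q \<bullet> s) (q \<bullet> r - p \<bullet> s)"
    by (simp add: complex_eq_iff)
  ultimately show ?thesis by simp
qed

text \<open>Bounded multilinear functionals of one fixed degree, with no condition on lists of other
  lengths. Fixing the first argument gives such a functional of degree one less, the shape in which
  all inductions over slots run.\<close>

definition mform :: "nat \<Rightarrow> ('x::real_inner list \<Rightarrow> complex) \<Rightarrow> bool" where
  "mform n u \<longleftrightarrow>
     (\<forall>xs ys. length xs + length ys + 1 = n \<longrightarrow> linear (\<lambda>x. u (xs @ x # ys))) \<and>
     (\<exists>C. \<forall>xs. length xs = n \<longrightarrow> cmod (u xs) \<le> C * prod_list (map norm xs))"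

lemma mform_Cons:
  assumes "mform (Suc n) u" shows "mform n (\<lambda>xs. u (x # xs))"
proof -
  have "linear (\<lambda>z. u (x # xs @ z # ys))" if "length xs + length ys + 1 = n" for xs ys
    using assms[unfolded mform_def, THEN conjunct1, rule_format, of "x # xs" ys] that by simp
  moreover obtain C where C: "\<And>xs. length xs = Suc n \<Longrightarrow> cmod (u xs) \<le> C * prod_list (map norm xs)"
    using assms unfolding mform_def by auto
  have "cmod (u (x # xs)) \<le> (C * norm x) * prod_list (map norm xs)" if "length xs = n" for xs
    using C[of "x # xs"] that by (simp add: mult_ac)
  ultimately show ?thesis unfolding mform_def by blast
qed

lemma mform_slot:
  assumes "mform (Suc n) u" "length xs = n" shows "bounded_linear (\<lambda>x. u (x # xs))"
proof -
  have lin: "linear (\<lambda>x. u (x # xs))"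
    using assms(1)[unfolded mform_def, THEN conjunct1, rule_format, of "[]" xs] assms(2) by simp
  obtain C where C: "\<And>xs. length xs = Suc n \<Longrightarrow> cmod (u xs) \<le> C * prod_list (map norm xs)"
    using assms unfolding mform_def by auto
  show ?thesis
  proof (rule bounded_linear_intro)
    show "norm (u (x # xs)) \<le> norm x * (C * prod_list (map norm xs))" for x
      using C[of "x # xs"] assms(2) by (simp add: mult_ac)
  qed (rule linear_add[OF lin] linear_scale[OF lin])+
qed

lemma prod_list_norm_map_le:
  assumes "\<And>x. norm (A x) \<le> C * norm x" "C \<ge> 0"
  shows "prod_list (map norm (map A xs)) \<le> C ^ length xs * prod_list (map norm xs)"
proof (induction xs)
  case (Cons x xs)
  have "norm (A x) * prod_list (map norm (map A xs)) \<le> (C * norm x) * (C ^ length xs * prod_list (map norm xs))"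
    by (intro mult_mono Cons assms) (auto intro!: prod_list_nonneg mult_nonneg_nonneg assms)
  then show ?case by (simp add: mult_ac)
qed simp

lemma mform_map:
  fixes A :: "'y::real_inner \<Rightarrow> 'x::real_inner"
  assumes u: "mform n u" and A: "bounded_linear A"
  shows "mform n (\<lambda>xs. u (map A xs))"
proof -
  obtain C where C: "C \<ge> 0" "\<And>x. norm (A x) \<le> C * norm x"
    using bounded_linear.nonneg_bounded[OF A] by (auto simp: mult.commute)
  obtain D where D: "\<And>xs. length xs = n \<Longrightarrow> cmod (u xs) \<le> D * prod_list (map norm xs)"
    using u unfolding mform_def by auto
  have "linear (\<lambda>x. u (map A (xs @ x # ys)))" if "length xs + length ys + 1 = n" for xs ys
  proof -
    have "linear (\<lambda>x. u (map A xs @ x # map A ys))" using u that unfolding mform_def by simp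
    from linear_compose[OF bounded_linear.linear[OF A] this] show ?thesis by (simp add: comp_def)
  qed
  moreover have "cmod (u (map A xs)) \<le> (\<bar>D\<bar> * C ^ n) * prod_list (map norm xs)" if "length xs = n" for xs
  proof -
    have "cmod (u (map A xs)) \<le> D * prod_list (map norm (map A xs))" using D[of "map A xs"] that by simp
    also have "\<dots> \<le> \<bar>D\<bar> * prod_list (map norm (map A xs))"
      by (intro mult_right_mono prod_list_nonneg) auto
    also have "\<dots> \<le> \<bar>D\<bar> * (C ^ length xs * prod_list (map norm xs))"
      by (intro mult_left_mono prod_list_norm_map_le C) auto
    finally show ?thesis using that by (simp add: mult_ac)
  qed
  ultimately show ?thesis unfolding mform_def by blast
qed

definition onb_lists :: "nat \<Rightarrow> 'x::real_inner list set" where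
  "onb_lists n = {xs \<in> lists onb. length xs = n}"

lemma onb_lists_0: "onb_lists 0 = {[]}"
  by (auto simp: onb_lists_def)

lemma bij_onb_lists_Suc: "bij_betw (\<lambda>p. fst p # snd p) (onb \<times> onb_lists n) (onb_lists (Suc n))"
  by (auto simp: bij_betw_def inj_on_def onb_lists_def image_iff length_Suc_conv)

text \<open>The squared Hilbert-Schmidt norm of the degree n part, allowed to be infinite.\<close>

definition hs :: "nat \<Rightarrow> ('x::real_inner list \<Rightarrow> complex) \<Rightarrow> ennreal" where
  "hs n u = (\<integral>\<^sup>+xs. ennreal ((cmod (u xs))\<^sup>2) \<partial>count_space (onb_lists n))"

lemma hs_Suc: "hs (Suc n) u = (\<integral>\<^sup>+x. hs n (\<lambda>xs. u (x # xs)) \<partial>count_space onb)"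
  unfolding hs_def by (simp add: nn_integral_bij_count_space[OF bij_onb_lists_Suc, symmetric]
    nn_integral_count_space_Times[symmetric])

text \<open>If p, q are the Riesz vectors of l, then A p, A q are those of l o
  \<open>adjoint A\<close>; both sides are given by
  \<open>nn_integral_onb_functional\<close>.\<close>

lemma hs_slot_le:
  fixes A :: "'x::{real_inner, complete_space} \<Rightarrow> 'y::{real_inner, complete_space}"
  assumes A: "bounded_linear A" "\<And>x. norm (A x) \<le> C * norm x" "C \<ge> 0" and l: "bounded_linear l"
  shows "(\<integral>\<^sup>+y. ennreal ((cmod (l (adjoint A y)))\<^sup>2) \<partial>count_space onb)
    \<le> ennreal (C\<^sup>2) * (\<integral>\<^sup>+x. ennreal ((cmod (l x))\<^sup>2) \<partial>count_space onb)"
proof -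
  obtain p q where l: "\<And>x. l x = Complex (p \<bullet> x) (q \<bullet> x)" using complex_functional_repr[OF l] by blast
  have "(norm (A p))\<^sup>2 + (norm (A q))\<^sup>2 \<le> (C * norm p)\<^sup>2 + (C * norm q)\<^sup>2"
    by (intro add_mono power_mono A) auto
  also have "\<dots> = C\<^sup>2 * ((norm p)\<^sup>2 + (norm q)\<^sup>2)" by (simp add: power_mult_distrib algebra_simps)
  finally show ?thesis
    by (simp add: l adjoint_works_hilbert[OF A(1), symmetric] nn_integral_onb_functional ennreal_mult[symmetric] ennreal_leI del: ennreal_plus)
qed

text \<open>The first slot runs over the basis of the target space, the others still over the basis
  of the source. Interchanging the sums makes the changed slot innermost, where the one-slot
  estimate applies.\<close>

lemma hs_slot_mixed_le:
  fixes A :: "'x::{real_inner, complete_space} \<Rightarrow> 'y::{real_inner, complete_space}"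
  assumes A: "bounded_linear A" "\<And>x. norm (A x) \<le> C * norm x" "C \<ge> 0" and u: "mform (Suc n) u"
  shows "(\<integral>\<^sup>+y. hs n (\<lambda>xs. u (adjoint A y # xs)) \<partial>count_space onb) \<le> ennreal (C\<^sup>2) * hs (Suc n) u"
proof -
  have "(\<integral>\<^sup>+y. hs n (\<lambda>xs. u (adjoint A y # xs)) \<partial>count_space onb)
      = (\<integral>\<^sup>+xs. \<integral>\<^sup>+y. ennreal ((cmod (u (adjoint A y # xs)))\<^sup>2) \<partial>count_space onb \<partial>count_space (onb_lists n))"
    unfolding hs_def by (rule nn_integral_count_space_swap)
  also have "\<dots> \<le> (\<integral>\<^sup>+xs. ennreal (C\<^sup>2) * (\<integral>\<^sup>+x. ennreal ((cmod (u (x # xs)))\<^sup>2) \<partial>count_space onb) \<partial>count_space (onb_lists n))"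
    by (intro nn_integral_mono hs_slot_le[OF A] mform_slot[OF u]) (auto simp: onb_lists_def)
  also have "\<dots> = ennreal (C\<^sup>2) * (\<integral>\<^sup>+xs. \<integral>\<^sup>+x. ennreal ((cmod (u (x # xs)))\<^sup>2) \<partial>count_space onb \<partial>count_space (onb_lists n))"
    by (rule nn_integral_cmult) simp
  also have "(\<integral>\<^sup>+xs. \<integral>\<^sup>+x. ennreal ((cmod (u (x # xs)))\<^sup>2) \<partial>count_space onb \<partial>count_space (onb_lists n)) = hs (Suc n) u"
    unfolding hs_Suc unfolding hs_def by (rule nn_integral_count_space_swap)
  finally show ?thesis .
qed

text \<open>Each of the n slots costs a factor C^2.\<close>

lemma hs_map_le:
  fixes A :: "'x::{real_inner, complete_space} \<Rightarrow> 'y::{real_inner, complete_space}"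
  assumes A: "bounded_linear A" "\<And>x. norm (A x) \<le> C * norm x" "C \<ge> 0"
  shows "mform n u \<Longrightarrow> hs n (\<lambda>ys. u (map (adjoint A) ys)) \<le> ennreal (C ^ (2 * n)) * hs n u"
proof (induction n arbitrary: u)
  case 0
  then show ?case by (simp add: hs_def onb_lists_0 nn_integral_count_space_finite)
next
  case (Suc n)
  have "hs (Suc n) (\<lambda>ys. u (map (adjoint A) ys)) = (\<integral>\<^sup>+y. hs n (\<lambda>ys. u (adjoint A y # map (adjoint A) ys)) \<partial>count_space onb)"
    by (simp add: hs_Suc)
  also have "\<dots> \<le> (\<integral>\<^sup>+y. ennreal (C ^ (2 * n)) * hs n (\<lambda>xs. u (adjoint A y # xs)) \<partial>count_space onb)"
    by (intro nn_integral_mono Suc.IH mform_Cons[OF Suc.prems])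
  also have "\<dots> = ennreal (C ^ (2 * n)) * (\<integral>\<^sup>+y. hs n (\<lambda>xs. u (adjoint A y # xs)) \<partial>count_space onb)"
    by (rule nn_integral_cmult) simp
  also have "\<dots> \<le> ennreal (C ^ (2 * n)) * (ennreal (C\<^sup>2) * hs (Suc n) u)"
    by (intro mult_left_mono hs_slot_mixed_le[OF A] Suc.prems) simp
  also have "\<dots> = ennreal (C ^ (2 * Suc n)) * hs (Suc n) u"
  proof -
    have "C ^ (2 * Suc n) = C ^ (2 * n) * C\<^sup>2" by (simp add: power_add[symmetric])
    then have "ennreal (C ^ (2 * Suc n)) = ennreal (C ^ (2 * n)) * ennreal (C\<^sup>2)"
      using A(3) by (simp only: ennreal_mult zero_le_power)
    then show ?thesis by (simp only: mult.assoc)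
  qed
  finally show ?case .
qed

lemma summable_mult_cnj:
  fixes f g :: "'a \<Rightarrow> complex"
  assumes "(\<lambda>x. (cmod (f x))\<^sup>2) summable_on A" "(\<lambda>x. (cmod (g x))\<^sup>2) summable_on A"
  shows "(\<lambda>x. f x * cnj (g x)) summable_on A"
proof -
  have "(\<lambda>x. (cmod (f x))\<^sup>2 + (cmod (g x))\<^sup>2) summable_on A" by (intro summable_on_add assms)
  then have "Infinite_Sum.abs_summable_on (\<lambda>x. f x * cnj (g x)) A"
  proof (rule Infinite_Sum.abs_summable_on_comparison_test')
    fix x
    have "0 \<le> (cmod (f x) - cmod (g x))\<^sup>2 + (cmod (f x))\<^sup>2 + (cmod (g x))\<^sup>2" by simp
    then show "norm (f x * cnj (g x)) \<le> (cmod (f x))\<^sup>2 + (cmod (g x))\<^sup>2"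
      by (simp add: norm_mult power2_diff)
  qed
  then show "(\<lambda>x. f x * cnj (g x)) summable_on A" by (rule abs_summable_summable)
qed

lemma summable_Times_if_hs_finite:
  assumes "(\<integral>\<^sup>+y. hs n (u y) \<partial>count_space B) < \<infinity>"
  shows "(\<lambda>p. (cmod (u (fst p) (snd p)))\<^sup>2) summable_on (B \<times> onb_lists n)"
  using assms unfolding hs_def
  by (subst summable_on_iff_nn_integral) (auto simp: nn_integral_count_space_Times[symmetric])

text \<open>The transfer of a tensor power to the other side of the inner product. The induction
  hypothesis treats all slots but the first; in the first slot both sides reduce by Parseval to an
  inner product of Riesz vectors, where A can be moved.\<close>

lemma infsum_map_adjoint:
  fixes A :: "'x::{real_inner, complete_space} \<Rightarrow> 'y::{real_inner, complete_space}"
  assumes A: "bounded_linear A"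
  shows "mform n u \<Longrightarrow> mform n v \<Longrightarrow> hs n u < \<infinity> \<Longrightarrow> hs n v < \<infinity> \<Longrightarrow>
    (\<Sum>\<^sub>\<infinity>ys\<in>onb_lists n. u (map (adjoint A) ys) * cnj (v ys)) = (\<Sum>\<^sub>\<infinity>xs\<in>onb_lists n. u xs * cnj (v (map A xs)))"
proof (induction n arbitrary: u v)
  case 0
  then show ?case by (simp add: onb_lists_0)
next
  case (Suc n)
  obtain C where C: "C \<ge> 0" "\<And>x. norm (A x) \<le> C * norm x"
    using bounded_linear.nonneg_bounded[OF A] by (auto simp: mult.commute)
  note A' = A C(2) C(1)
  have A'': "bounded_linear (adjoint A)" "\<And>x. norm (adjoint A x) \<le> C * norm x" "C \<ge> 0"
    by (rule bounded_linear_adjoint[OF A], rule norm_adjoint_le[OF A'], rule C(1))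
  \<comment> \<open>Every rearrangement of a double sum below is justified by square summability of
    its two factors: the pairs are \<open>mixuu\<close> with \<open>hv\<close>, \<open>mix\<close>
    with \<open>mixv\<close>, and \<open>hu\<close> with \<open>mixvv\<close>.\<close>
  have mix: "(\<integral>\<^sup>+y. hs n (\<lambda>xs. u (adjoint A y # xs)) \<partial>count_space onb) < \<infinity>"
    by (rule le_less_trans[OF hs_slot_mixed_le[OF A' Suc.prems(1)]])
      (use Suc.prems(3) in \<open>simp add: ennreal_mult_less_top\<close>)
  have hv: "(\<integral>\<^sup>+y. hs n (\<lambda>ys. v (y # ys)) \<partial>count_space onb) < \<infinity>" using Suc.prems(4) by (simp add: hs_Suc)
  have mixv: "(\<integral>\<^sup>+y. hs n (\<lambda>xs. v (y # map A xs)) \<partial>count_space onb) < \<infinity>"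
  proof -
    have "hs n (\<lambda>xs. v (y # map A xs)) \<le> ennreal (C ^ (2 * n)) * hs n (\<lambda>ys. v (y # ys))" for y
      using hs_map_le[OF A'' mform_Cons[OF Suc.prems(2)], of y] by (simp add: adjoint_adjoint_hilbert[OF A])
    then have "(\<integral>\<^sup>+y. hs n (\<lambda>xs. v (y # map A xs)) \<partial>count_space onb)
       \<le> (\<integral>\<^sup>+y. ennreal (C ^ (2 * n)) * hs n (\<lambda>ys. v (y # ys)) \<partial>count_space onb)" by (intro nn_integral_mono)
    also have "\<dots> = ennreal (C ^ (2 * n)) * (\<integral>\<^sup>+y. hs n (\<lambda>ys. v (y # ys)) \<partial>count_space onb)"
      by (rule nn_integral_cmult) simp
    also have "\<dots> < \<infinity>" using hv by (simp add: ennreal_mult_less_top)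
    finally show ?thesis .
  qed
  have mixuu: "(\<integral>\<^sup>+y. hs n (\<lambda>ys. u (adjoint A y # map (adjoint A) ys)) \<partial>count_space onb) < \<infinity>"
  proof -
    have "(\<integral>\<^sup>+y. hs n (\<lambda>ys. u (adjoint A y # map (adjoint A) ys)) \<partial>count_space onb) = hs (Suc n) (\<lambda>ys. u (map (adjoint A) ys))"
      by (simp add: hs_Suc)
    also have "\<dots> \<le> ennreal (C ^ (2 * Suc n)) * hs (Suc n) u" by (rule hs_map_le[OF A' Suc.prems(1)])
    also have "\<dots> < \<infinity>" using Suc.prems(3) by (simp add: ennreal_mult_less_top)
    finally show ?thesis .
  qed
  have mixvv: "(\<integral>\<^sup>+x. hs n (\<lambda>xs. v (A x # map A xs)) \<partial>count_space onb) < \<infinity>"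
  proof -
    have "(\<integral>\<^sup>+x. hs n (\<lambda>xs. v (A x # map A xs)) \<partial>count_space onb) = hs (Suc n) (\<lambda>xs. v (map A xs))"
      by (simp add: hs_Suc)
    also have "\<dots> \<le> ennreal (C ^ (2 * Suc n)) * hs (Suc n) v"
      using hs_map_le[OF A'' Suc.prems(2)] by (simp add: adjoint_adjoint_hilbert[OF A])
    also have "\<dots> < \<infinity>" using Suc.prems(4) by (simp add: ennreal_mult_less_top)
    finally show ?thesis .
  qed
  have hu: "(\<integral>\<^sup>+x. hs n (\<lambda>xs. u (x # xs)) \<partial>count_space onb) < \<infinity>" using Suc.prems(3) by (simp add: hs_Suc)
  have "(\<Sum>\<^sub>\<infinity>ys\<in>onb_lists (Suc n). u (map (adjoint A) ys) * cnj (v ys))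
      = (\<Sum>\<^sub>\<infinity>p\<in>onb \<times> onb_lists n. u (adjoint A (fst p) # map (adjoint A) (snd p)) * cnj (v (fst p # snd p)))"
    by (subst infsum_reindex_bij_betw[OF bij_onb_lists_Suc, symmetric]) simp
  also have "\<dots> = (\<Sum>\<^sub>\<infinity>y\<in>onb. \<Sum>\<^sub>\<infinity>ys\<in>onb_lists n. u (adjoint A y # map (adjoint A) ys) * cnj (v (y # ys)))"
    by (subst infsum_Sigma_banach[symmetric])
      (simp_all add: summable_mult_cnj[OF summable_Times_if_hs_finite[OF mixuu] summable_Times_if_hs_finite[OF hv]])
  also have "\<dots> = (\<Sum>\<^sub>\<infinity>y\<in>onb. \<Sum>\<^sub>\<infinity>xs\<in>onb_lists n. u (adjoint A y # xs) * cnj (v (y # map A xs)))"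
  proof (rule infsum_cong)
    fix y :: 'y assume y: "y \<in> onb"
    show "(\<Sum>\<^sub>\<infinity>ys\<in>onb_lists n. u (adjoint A y # map (adjoint A) ys) * cnj (v (y # ys)))
       = (\<Sum>\<^sub>\<infinity>xs\<in>onb_lists n. u (adjoint A y # xs) * cnj (v (y # map A xs)))"
    proof (rule Suc.IH)
      show "hs n (\<lambda>xs. u (adjoint A y # xs)) < \<infinity>"
        using nn_integral_ge_point[OF y, of "\<lambda>y. hs n (\<lambda>xs. u (adjoint A y # xs))"] mix by (rule le_less_trans)
      show "hs n (\<lambda>ys. v (y # ys)) < \<infinity>"
        using nn_integral_ge_point[OF y, of "\<lambda>y. hs n (\<lambda>xs. v (y # xs))"] hv by (rule le_less_trans)
    qed (intro mform_Cons Suc.prems)+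
  qed
  \<comment> \<open>The first slot becomes the inner sum, so that Parseval can exchange the basis of
    the target for that of the source.\<close>
  also have "\<dots> = (\<Sum>\<^sub>\<infinity>xs\<in>onb_lists n. \<Sum>\<^sub>\<infinity>y\<in>onb. u (adjoint A y # xs) * cnj (v (y # map A xs)))"
    by (rule infsum_swap_banach)
      (simp add: case_prod_unfold summable_mult_cnj[OF summable_Times_if_hs_finite[OF mix] summable_Times_if_hs_finite[OF mixv]])
  also have "\<dots> = (\<Sum>\<^sub>\<infinity>xs\<in>onb_lists n. \<Sum>\<^sub>\<infinity>x\<in>onb. u (x # xs) * cnj (v (A x # map A xs)))"
  proof (rule infsum_cong)
    fix xs :: "'x list" assume xs: "xs \<in> onb_lists n"
    obtain p q where pq: "\<And>x. u (x # xs) = Complex (p \<bullet> x) (q \<bullet> x)"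
      using complex_functional_repr[OF mform_slot[OF Suc.prems(1), of xs]] xs by (auto simp: onb_lists_def)
    obtain r s where rs: "\<And>y. v (y # map A xs) = Complex (r \<bullet> y) (s \<bullet> y)"
      using complex_functional_repr[OF mform_slot[OF Suc.prems(2), of "map A xs"]] xs by (auto simp: onb_lists_def)
    have adj: "z \<bullet> A x = adjoint A z \<bullet> x" for x z
      by (simp add: inner_commute[of z] inner_commute[of _ x] adjoint_works_hilbert[OF A])
    show "(\<Sum>\<^sub>\<infinity>y\<in>onb. u (adjoint A y # xs) * cnj (v (y # map A xs)))
        = (\<Sum>\<^sub>\<infinity>x\<in>onb. u (x # xs) * cnj (v (A x # map A xs)))"
      \<comment> \<open>Parseval evaluates the left side as the inner product of A p + i A q with r
        + i s, and the right side as that of p + i q with the images of r and s under the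
        adjoint.\<close>
      unfolding pq rs adjoint_works_hilbert[OF A, symmetric] adj infsumI[OF has_sum_onb_functionals] ..
  qed
  also have "\<dots> = (\<Sum>\<^sub>\<infinity>x\<in>onb. \<Sum>\<^sub>\<infinity>xs\<in>onb_lists n. u (x # xs) * cnj (v (A x # map A xs)))"
    by (rule infsum_swap_banach[symmetric])
      (simp add: case_prod_unfold summable_mult_cnj[OF summable_Times_if_hs_finite[OF hu] summable_Times_if_hs_finite[OF mixvv]])
  also have "\<dots> = (\<Sum>\<^sub>\<infinity>p\<in>onb \<times> onb_lists n. u (fst p # snd p) * cnj (v (A (fst p) # map A (snd p))))"
    by (subst infsum_Sigma_banach[symmetric])
      (simp_all add: summable_mult_cnj[OF summable_Times_if_hs_finite[OF hu] summable_Times_if_hs_finite[OF mixvv]])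
  also have "\<dots> = (\<Sum>\<^sub>\<infinity>xs\<in>onb_lists (Suc n). u xs * cnj (v (map A xs)))"
    by (subst infsum_reindex_bij_betw[OF bij_onb_lists_Suc, symmetric]) simp
  finally show ?case .
qed

section \<open>Fock spaces and tensor powers of operators\<close>

lemma sym_form_mset: "sym_form u \<Longrightarrow> mset xs = mset ys \<Longrightarrow> u xs = u ys"
  by (drule sym_form_def[THEN iffD1, THEN conjunct2, THEN conjunct1]) (elim allE impE)

lemma sym_form_mform:
  assumes "sym_form u" shows "mform n u"
proof -
  note d = assms[unfolded sym_form_def]
  show ?thesis unfolding mform_def
    by (intro conjI allI impI d[THEN conjunct1, rule_format] d[THEN conjunct2, THEN conjunct2, THEN spec])
qed

lemma sym_formI:
  assumes u: "\<And>n. mform n u" and m: "\<And>xs ys. mset xs = mset ys \<Longrightarrow> u xs = u ys"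
  shows "sym_form u"
  unfolding sym_form_def
proof (intro conjI allI impI)
  show "linear (\<lambda>x. u (xs @ x # ys))" for xs ys
    using u[unfolded mform_def, THEN conjunct1, rule_format, of xs ys "length xs + length ys + 1"] by simp
  show "\<exists>C. \<forall>xs. length xs = n \<longrightarrow> cmod (u xs) \<le> C * prod_list (map norm xs)" for n
    using u[of n] unfolding mform_def by (rule conjunct2)
qed (rule m)

lemma mform_linear:
  "mform n u \<Longrightarrow> length xs + length ys + 1 = n \<Longrightarrow> linear (\<lambda>x. u (xs @ x # ys))"
  unfolding mform_def by (elim conjE allE impE)

lemma mform_bound:
  assumes "mform n u"
  obtains C where "\<And>xs. length xs = n \<Longrightarrow> cmod (u xs) \<le> C * prod_list (map norm xs)"
  using assms unfolding mform_def by blast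

lemma mform_add_scale:
  assumes "mform n u" "mform n v" shows "mform n (\<lambda>xs. u xs + c * v xs)"
proof -
  have "linear (\<lambda>x. u (xs @ x # ys) + c * v (xs @ x # ys))" if "length xs + length ys + 1 = n" for xs ys
  proof -
    have u: "linear (\<lambda>x. u (xs @ x # ys))" by (rule mform_linear[OF assms(1) that])
    have v: "linear (\<lambda>x. v (xs @ x # ys))" by (rule mform_linear[OF assms(2) that])
    have "linear (\<lambda>z. c * z)" by (rule bounded_linear.linear[OF bounded_linear_mult_right])
    from linear_compose_add[OF u linear_compose[OF v this, unfolded comp_def]] show ?thesis .
  qed
  moreover
  obtain C where C: "\<And>xs. length xs = n \<Longrightarrow> cmod (u xs) \<le> C * prod_list (map norm xs)"
    using mform_bound[OF assms(1)] by blast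
  obtain D where D: "\<And>xs. length xs = n \<Longrightarrow> cmod (v xs) \<le> D * prod_list (map norm xs)"
    using mform_bound[OF assms(2)] by blast
  have "cmod (u xs + c * v xs) \<le> (C + cmod c * D) * prod_list (map norm xs)" if "length xs = n" for xs
  proof -
    have "cmod (u xs + c * v xs) \<le> cmod (u xs) + cmod c * cmod (v xs)"
      using norm_triangle_ineq[of "u xs" "c * v xs"] by (simp add: norm_mult)
    also have "\<dots> \<le> C * prod_list (map norm xs) + cmod c * (D * prod_list (map norm xs))"
      by (intro add_mono mult_left_mono C D that) simp
    finally show ?thesis by (simp add: algebra_simps)
  qed
  ultimately show ?thesis unfolding mform_def by (intro conjI exI[of _ "C + cmod c * D"]) simp_all
qed

lemma sym_form_add_scale:
  "sym_form u \<Longrightarrow> sym_form v \<Longrightarrow> sym_form (\<lambda>xs. u xs + c * v xs)"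
proof (rule sym_formI)
  assume u: "sym_form u" and v: "sym_form v"
  show "mform n (\<lambda>xs. u xs + c * v xs)" for n by (intro mform_add_scale sym_form_mform u v)
  show "u xs + c * v xs = u ys + c * v ys" if "mset xs = mset ys" for xs ys
    by (simp only: sym_form_mset[OF u that] sym_form_mset[OF v that])
qed

lemma sym_form_tpow:
  fixes A :: "'x::{real_inner, complete_space} \<Rightarrow> 'y::real_inner"
  assumes "sym_form u" "bounded_linear A"
  shows "sym_form (tpow A u)"
proof (rule sym_formI)
  show "mform n (tpow A u)" for n
    unfolding tpow_def by (intro mform_map sym_form_mform bounded_linear_adjoint assms)
  show "tpow A u xs = tpow A u ys" if "mset xs = mset ys" for xs ys
    unfolding tpow_def by (rule sym_form_mset[OF assms(1)]) (simp add: that)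
qed

section \<open>Norm estimates for tensor powers, degree by degree\<close>

definition hsq :: "('x::real_inner list \<Rightarrow> complex) \<Rightarrow> ennreal" where
  "hsq u = (\<integral>\<^sup>+xs. ennreal ((cmod (u xs))\<^sup>2) \<partial>count_space (lists onb))"

lemma fock_iff: "u \<in> fock \<longleftrightarrow> sym_form u \<and> hsq u < \<infinity>"
  unfolding fock_def hsq_def by (simp add: summable_on_iff_nn_integral)

lemma fnorm_nonneg: "fnorm u \<ge> 0"
  unfolding fnorm_def by (simp add: infsum_nonneg)

lemma hsq_eq_fnorm: "u \<in> fock \<Longrightarrow> hsq u = ennreal ((fnorm u)\<^sup>2)"
  unfolding hsq_def fnorm_def fock_def by (simp add: nn_integral_count_space_eq_infsum infsum_nonneg)

lemma hsq_eq_suminf_hs: "hsq u = (\<Sum>n. hs n u)"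
proof -
  let ?f = "\<lambda>xs. ennreal ((cmod (u xs))\<^sup>2)"
  have "hsq u = (\<integral>\<^sup>+xs. ?f xs * indicator (lists onb) xs \<partial>count_space UNIV)"
    unfolding hsq_def by (simp add: nn_integral_count_space_indicator)
  also have "\<dots> = (\<integral>\<^sup>+xs. (\<Sum>n. ?f xs * indicator (onb_lists n) xs) \<partial>count_space UNIV)"
  proof (rule nn_integral_cong)
    fix xs
    have "(\<Sum>n. ?f xs * indicator (onb_lists n) xs) = (\<Sum>n\<in>{length xs}. ?f xs * indicator (onb_lists n) xs)"
      by (rule suminf_finite) (auto simp: onb_lists_def)
    then show "?f xs * indicator (lists onb) xs = (\<Sum>n. ?f xs * indicator (onb_lists n) xs)"
      by (simp add: onb_lists_def indicator_def)
  qed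
  also have "\<dots> = (\<Sum>n. \<integral>\<^sup>+xs. ?f xs * indicator (onb_lists n) xs \<partial>count_space UNIV)"
    by (rule nn_integral_suminf) simp
  also have "\<dots> = (\<Sum>n. hs n u)"
    unfolding hs_def by (simp add: nn_integral_count_space_indicator)
  finally show ?thesis .
qed

lemma hs_le_hsq: "hs n u \<le> hsq u"
  unfolding hsq_eq_suminf_hs using sum_le_suminf[OF summableI, of "{n}" "\<lambda>n. hs n u"] by simp

lemma hs_cong: "(\<And>xs. length xs = n \<Longrightarrow> u xs = v xs) \<Longrightarrow> hs n u = hs n v"
  unfolding hs_def by (rule nn_integral_cong) (auto simp: onb_lists_def)

text \<open>D has to dominate C^(2n) only in degrees where u does not vanish. This covers
  contractions in all degrees (D = 1) as well as arbitrary bounded operators on degrees up to N (D =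
  C^(2N)).\<close>

lemma hsq_tpow_le:
  fixes A :: "'x::{real_inner, complete_space} \<Rightarrow> 'y::{real_inner, complete_space}"
  assumes A: "bounded_linear A" "\<And>x. norm (A x) \<le> C * norm x" "C \<ge> 0" and u: "sym_form u"
    and D: "\<And>n. hs n u = 0 \<or> C ^ (2 * n) \<le> D"
  shows "hsq (tpow A u) \<le> ennreal D * hsq u"
proof -
  have "hsq (tpow A u) \<le> (\<Sum>n. ennreal D * hs n u)"
    unfolding hsq_eq_suminf_hs
  proof (rule suminf_le[OF _ summableI summableI])
    fix n
    have "hs n (tpow A u) \<le> ennreal (C ^ (2 * n)) * hs n u"
      unfolding tpow_def using u by (intro hs_map_le A) (auto intro: sym_form_mform)
    also have "\<dots> \<le> ennreal D * hs n u"
      using D[of n] by (cases "hs n u = 0") (auto intro!: mult_right_mono ennreal_leI)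
    finally show "hs n (tpow A u) \<le> ennreal D * hs n u" .
  qed
  then show ?thesis unfolding hsq_eq_suminf_hs by (simp add: ennreal_suminf_cmult)
qed

lemma tpow_contraction:
  fixes A :: "'x::{real_inner, complete_space} \<Rightarrow> 'y::{real_inner, complete_space}"
  assumes A: "bounded_linear A" "\<And>x. norm (A x) \<le> norm x" and u: "u \<in> fock"
  shows "tpow A u \<in> fock" "fnorm (tpow A u) \<le> fnorm u"
proof -
  have "hsq (tpow A u) \<le> ennreal 1 * hsq u"
    by (rule hsq_tpow_le[where C = 1]) (use A u in \<open>auto simp: fock_iff\<close>)
  then have le: "hsq (tpow A u) \<le> hsq u" by simp
  then show mem: "tpow A u \<in> fock"
    using u sym_form_tpow[OF _ A(1)] by (auto simp: fock_iff)
  have "(fnorm (tpow A u))\<^sup>2 \<le> (fnorm u)\<^sup>2"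
    using le by (simp add: hsq_eq_fnorm mem u)
  then show "fnorm (tpow A u) \<le> fnorm u" by (simp add: power2_le_iff_abs_le fnorm_nonneg)
qed

text \<open>The condition in \<open>fock_fin\<close> with its bound named, because norms of tensor
  powers depend on that bound.\<close>

definition supp_le :: "nat \<Rightarrow> 'x fvec \<Rightarrow> bool" where
  "supp_le N u \<longleftrightarrow> (\<forall>xs. length xs > N \<longrightarrow> u xs = 0)"

lemma fock_fin_iff: "u \<in> fock_fin \<longleftrightarrow> u \<in> fock \<and> (\<exists>N. supp_le N u)"
  by (auto simp: fock_fin_def supp_le_def)

lemma supp_le_mono: "supp_le N u \<Longrightarrow> N \<le> M \<Longrightarrow> supp_le M u"
  by (auto simp: supp_le_def)

lemma supp_le_tpow: "supp_le N u \<Longrightarrow> supp_le N (tpow A u)"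
  by (auto simp: supp_le_def tpow_def)

lemma hs_eq_0: "(\<And>xs. length xs = n \<Longrightarrow> u xs = 0) \<Longrightarrow> hs n u = 0"
  using hs_cong[of n u "\<lambda>_. 0"] by (simp add: hs_def)

text \<open>With C at least 1 the factors C^(2n) increase with the degree, so the top degree N gives
  the worst one.\<close>

lemma tpow_supp_le:
  fixes A :: "'x::{real_inner, complete_space} \<Rightarrow> 'y::{real_inner, complete_space}"
  assumes A: "bounded_linear A" "\<And>x. norm (A x) \<le> C * norm x" "C \<ge> 1" and u: "u \<in> fock" "supp_le N u"
  shows "tpow A u \<in> fock" "fnorm (tpow A u) \<le> C ^ N * fnorm u"
proof -
  have "hs n u = 0 \<or> C ^ (2 * n) \<le> C ^ (2 * N)" for n
  proof (cases "n \<le> N")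
    case True
    then show ?thesis using A(3) by (auto intro!: power_increasing)
  next
    case False
    then show ?thesis using u(2) by (auto intro!: hs_eq_0 simp: supp_le_def)
  qed
  then have le: "hsq (tpow A u) \<le> ennreal (C ^ (2 * N)) * hsq u"
    by (intro hsq_tpow_le A) (use A u in \<open>auto simp: fock_iff\<close>)
  have "ennreal (C ^ (2 * N)) * hsq u < \<infinity>" using u by (simp add: fock_iff ennreal_mult_less_top)
  with le have "hsq (tpow A u) < \<infinity>" by (rule le_less_trans)
  then show mem: "tpow A u \<in> fock"
    using u sym_form_tpow[OF _ A(1)] by (auto simp: fock_iff)
  have "ennreal ((fnorm (tpow A u))\<^sup>2) \<le> ennreal (C ^ (2 * N) * (fnorm u)\<^sup>2)"
    using le A(3) by (simp add: hsq_eq_fnorm mem u ennreal_mult)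
  then have "(fnorm (tpow A u))\<^sup>2 \<le> C ^ (2 * N) * (fnorm u)\<^sup>2"
    using A(3) by (simp add: ennreal_le_iff)
  also have "\<dots> = (C ^ N * fnorm u)\<^sup>2" by (simp add: power_mult_distrib power_mult[symmetric] mult.commute)
  finally show "fnorm (tpow A u) \<le> C ^ N * fnorm u"
    using A(3) by (simp add: power2_le_iff_abs_le fnorm_nonneg)
qed

lemma bounded_linear_bound_ge_1:
  assumes "bounded_linear A"
  obtains C where "C \<ge> 1" "\<And>x. norm (A x) \<le> C * norm x"
proof -
  obtain K where K: "\<And>x. norm (A x) \<le> norm x * K" using bounded_linear.bounded[OF assms] by auto
  show thesis
  proof (rule that[of "max 1 K"])
    fix x
    have "norm (A x) \<le> norm x * K" by (rule K)
    also have "\<dots> \<le> norm x * max 1 K" by (intro mult_left_mono) auto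
    finally show "norm (A x) \<le> max 1 K * norm x" by (simp add: mult.commute)
  qed simp
qed

lemma tpow_fock_fin:
  fixes A :: "'x::{real_inner, complete_space} \<Rightarrow> 'y::{real_inner, complete_space}"
  assumes A: "bounded_linear A" and u: "u \<in> fock_fin"
  shows "tpow A u \<in> fock_fin"
proof -
  obtain C where "C \<ge> 1" "\<And>x. norm (A x) \<le> C * norm x" using bounded_linear_bound_ge_1[OF A] by blast
  with u show ?thesis using tpow_supp_le(1)[OF A] by (auto simp: fock_fin_iff intro: supp_le_tpow)
qed

lemma fock_n_iff: "u \<in> fock_n n \<longleftrightarrow> u \<in> fock \<and> (\<forall>xs. length xs \<noteq> n \<longrightarrow> u xs = 0)"
  by (simp add: fock_n_def)

lemma fock_n_fock_fin: "u \<in> fock_n n \<Longrightarrow> u \<in> fock_fin"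
  by (auto simp: fock_n_iff fock_fin_def intro!: exI[of _ n])

lemma tpow_fock_n:
  fixes A :: "'x::{real_inner, complete_space} \<Rightarrow> 'y::{real_inner, complete_space}"
  assumes A: "bounded_linear A" and u: "u \<in> fock_n n"
  shows "tpow A u \<in> fock_n n"
  using tpow_fock_fin[OF A fock_n_fock_fin[OF u]] u
  by (auto simp: fock_n_iff fock_fin_iff tpow_def)

text \<open>Precomposition reverses the order and so does taking adjoints; the two reversals
  cancel.\<close>

lemma tpow_compose:
  fixes A :: "'x::{real_inner, complete_space} \<Rightarrow> 'y::{real_inner, complete_space}"
    and B :: "'y \<Rightarrow> 'z::real_inner"
  assumes "bounded_linear A" "bounded_linear B"
  shows "tpow B (tpow A u) = tpow (B \<circ> A) u"
  unfolding tpow_def by (simp add: adjoint_compose_hilbert[OF assms])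

lemma tpow_ident:
  fixes u :: "'x::{real_inner, complete_space} fvec"
  shows "tpow (\<lambda>x. x) u = u"
proof -
  have "adjoint (\<lambda>x::'x. x) = (\<lambda>x. x)"
    by (rule adjoint_unique_hilbert) (simp_all add: bounded_linear_ident)
  then show ?thesis by (simp add: tpow_def)
qed

lemma tpow_add_scale: "tpow A (\<lambda>xs. u xs + c * v xs) = (\<lambda>ys. tpow A u ys + c * tpow A v ys)"
  by (simp add: tpow_def)

lemma tpow_diff: "tpow A (\<lambda>xs. u xs - v xs) = (\<lambda>ys. tpow A u ys - tpow A v ys)"
  by (simp add: tpow_def)

lemma tpow_0: "tpow A (\<lambda>_. 0) = (\<lambda>_. 0)"
  by (simp add: tpow_def)

lemma level_tpow: "level n (tpow A u) = tpow A (level n u)"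
  by (auto simp: level_def tpow_def)

section \<open>Linear structure and triangle inequality of the Fock space\<close>

lemma fnorm_add_le:
  assumes u: "u \<in> fock" and v: "v \<in> fock"
  shows "(\<lambda>xs. (cmod (u xs + v xs))\<^sup>2) summable_on lists onb"
    "fnorm (\<lambda>xs. u xs + v xs) \<le> fnorm u + fnorm v"
proof -
  let ?B = "lists onb :: 'a list set"
  have le: "(\<Sum>xs\<in>F. (cmod (u xs + v xs))\<^sup>2) \<le> (fnorm u + fnorm v)\<^sup>2" if F: "finite F" "F \<subseteq> ?B" for F
  proof -
    have fin: "L2_set (\<lambda>xs. cmod (w xs)) F \<le> fnorm w" if "w \<in> fock" for w
      unfolding L2_set_def fnorm_def
      by (intro real_sqrt_le_mono finite_sum_le_infsum) (use that F in \<open>auto simp: fock_def\<close>)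
    have "sqrt (\<Sum>xs\<in>F. (cmod (u xs + v xs))\<^sup>2) = L2_set (\<lambda>xs. cmod (u xs + v xs)) F"
      by (simp add: L2_set_def)
    also have "\<dots> \<le> L2_set (\<lambda>xs. cmod (u xs) + cmod (v xs)) F"
      by (intro L2_set_mono norm_triangle_ineq) auto
    also have "\<dots> \<le> L2_set (\<lambda>xs. cmod (u xs)) F + L2_set (\<lambda>xs. cmod (v xs)) F"
      by (rule L2_set_triangle_ineq)
    also have "\<dots> \<le> fnorm u + fnorm v" by (intro add_mono fin u v)
    finally show ?thesis by (rule sqrt_le_D)
  qed
  show s: "(\<lambda>xs. (cmod (u xs + v xs))\<^sup>2) summable_on ?B"
    by (rule nonneg_bdd_above_summable_on) (auto intro!: bdd_aboveI2 le)
  have "(\<Sum>\<^sub>\<infinity>xs\<in>?B. (cmod (u xs + v xs))\<^sup>2) \<le> (fnorm u + fnorm v)\<^sup>2"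
    by (rule infsum_le_finite_sums[OF s]) (use le in auto)
  then show "fnorm (\<lambda>xs. u xs + v xs) \<le> fnorm u + fnorm v"
    unfolding fnorm_def[of "\<lambda>xs. u xs + v xs"] by (intro real_le_lsqrt) (simp_all add: fnorm_nonneg infsum_nonneg)
qed

lemma fnorm_scale: "fnorm (\<lambda>xs. c * u xs) = cmod c * fnorm u"
  unfolding fnorm_def by (simp add: norm_mult power_mult_distrib infsum_cmult_right' real_sqrt_mult)

lemma zero_fock: "(\<lambda>_. 0) \<in> fock"
proof -
  have "sym_form (\<lambda>_ :: 'a list. 0)"
    unfolding sym_form_def by (auto simp: linear_iff intro!: exI[of _ 0])
  then show ?thesis by (simp add: fock_def)
qed

lemma zero_fock_n: "(\<lambda>_. 0) \<in> fock_n n"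
  by (simp add: fock_n_iff zero_fock)

lemma fock_scale:
  assumes "u \<in> fock" shows "(\<lambda>xs. c * u xs) \<in> fock"
  using assms sym_form_add_scale[of "\<lambda>_. 0" u c] zero_fock
  by (auto simp: fock_def norm_mult power_mult_distrib intro!: summable_on_cmult_right)

lemma fock_add_scale:
  assumes "u \<in> fock" "v \<in> fock" shows "(\<lambda>xs. u xs + c * v xs) \<in> fock"
  using assms fnorm_add_le(1)[OF assms(1) fock_scale[OF assms(2)], of c] sym_form_add_scale[of u v c]
  by (auto simp: fock_def)

lemma fock_add: "u \<in> fock \<Longrightarrow> v \<in> fock \<Longrightarrow> (\<lambda>xs. u xs + v xs) \<in> fock"
  using fock_add_scale[of u v 1] by simp

lemma fock_diff: "u \<in> fock \<Longrightarrow> v \<in> fock \<Longrightarrow> (\<lambda>xs. u xs - v xs) \<in> fock"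
  using fock_add_scale[of u v "-1"] by simp

lemma fnorm_diff_triangle:
  assumes "u \<in> fock" "v \<in> fock" "w \<in> fock"
  shows "fnorm (\<lambda>xs. u xs - w xs) \<le> fnorm (\<lambda>xs. u xs - v xs) + fnorm (\<lambda>xs. v xs - w xs)"
  using fnorm_add_le(2)[OF fock_diff[OF assms(1,2)] fock_diff[OF assms(2,3)]] by simp

lemma fock_sum:
  assumes "\<And>i. i \<in> I \<Longrightarrow> u i \<in> fock"
  shows "(\<lambda>xs. \<Sum>i\<in>I. u i xs) \<in> fock" "fnorm (\<lambda>xs. \<Sum>i\<in>I. u i xs) \<le> (\<Sum>i\<in>I. fnorm (u i))"
proof -
  have "(\<lambda>xs. \<Sum>i\<in>I. u i xs) \<in> fock \<and> fnorm (\<lambda>xs. \<Sum>i\<in>I. u i xs) \<le> (\<Sum>i\<in>I. fnorm (u i))"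
    using assms
  proof (induction I rule: infinite_finite_induct)
    case (insert i I)
    then have 1: "u i \<in> fock" and 2: "(\<lambda>xs. \<Sum>i\<in>I. u i xs) \<in> fock" by auto
    from fock_add[OF 1 2] fnorm_add_le(2)[OF 1 2] insert show ?case by auto
  qed (auto simp: zero_fock fnorm_def)
  then show "(\<lambda>xs. \<Sum>i\<in>I. u i xs) \<in> fock" "fnorm (\<lambda>xs. \<Sum>i\<in>I. u i xs) \<le> (\<Sum>i\<in>I. fnorm (u i))" by auto
qed

text \<open>Fill all slots but the first by the induction hypothesis; the Riesz vectors of the first
  slot are then orthogonal to a total set. Applied to the basis this makes \<open>fnorm\<close>
  definite, applied to the range of an adjoint it makes \<open>tpow\<close> injective.\<close>

lemma mform_eq_0:
  fixes u :: "'x::{real_inner, complete_space} list \<Rightarrow> complex"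
  assumes S: "closure (span S) = UNIV"
  shows "mform n u \<Longrightarrow> (\<And>xs. set xs \<subseteq> S \<Longrightarrow> length xs = n \<Longrightarrow> u xs = 0) \<Longrightarrow> length xs = n \<Longrightarrow> u xs = 0"
proof (induction n arbitrary: u xs)
  case (Suc n)
  obtain x ys where xs: "xs = x # ys" and ys: "length ys = n" using Suc.prems(3) by (cases xs) auto
  have S0: "u (s # ys) = 0" if "s \<in> S" for s
    by (rule Suc.IH[of "\<lambda>xs. u (s # xs)"]) (use that Suc.prems(2) mform_Cons[OF Suc.prems(1)] ys in auto)
  obtain p q where pq: "\<And>x. u (x # ys) = Complex (p \<bullet> x) (q \<bullet> x)"
    using complex_functional_repr[OF mform_slot[OF Suc.prems(1) ys]] by blast
  have z: "r = 0" if r: "\<And>s. s \<in> S \<Longrightarrow> r \<bullet> s = 0" for r :: 'x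
  proof (rule dense_eqI[OF S])
    fix s assume "s \<in> span S"
    then show "r \<bullet> s = 0 \<bullet> s"
      by (induction rule: span_induct_alt) (auto simp: inner_simps r)
  qed
  have "p = 0" "q = 0" using S0 by (auto intro!: z simp: pq complex_eq_iff)
  then show ?case by (simp add: xs pq complex_eq_iff)
qed simp

text \<open>\<open>fnorm\<close> sees only the values on basis lists, but these determine a bounded
  multilinear form.\<close>

lemma fock_eq_0:
  fixes u :: "'x::{real_inner, complete_space} fvec"
  assumes u: "u \<in> fock" and 0: "fnorm u = 0"
  shows "u = (\<lambda>_. 0)"
proof
  fix xs :: "'x list"
  have "(\<lambda>xs. (cmod (u xs))\<^sup>2) summable_on lists onb" using u by (simp add: fock_def)
  moreover have "(\<Sum>\<^sub>\<infinity>xs\<in>lists onb. (cmod (u xs))\<^sup>2) \<le> 0" using 0 by (simp add: fnorm_def)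
  ultimately have "(cmod (u xs))\<^sup>2 = 0" if "xs \<in> lists onb" for xs
    using nonneg_infsum_le_0D[of "\<lambda>xs. (cmod (u xs))\<^sup>2" "lists onb" xs] that by simp
  then have "u xs = 0" if "set xs \<subseteq> onb" for xs using that by auto
  moreover have "closure (span onb) = (UNIV :: 'x set)" using is_onb_onb[where ?'a = 'x] by (simp add: is_onb_def)
  moreover have "mform (length xs) u" using u by (auto simp: fock_def intro: sym_form_mform)
  ultimately show "u xs = 0" by (intro mform_eq_0[of onb "length xs" u xs]) auto
qed

text \<open>The hypothesis says that u vanishes on lists from the range of \<open>adjoint A\<close>,
  and this range is dense because A is injective.\<close>

lemma tpow_eq_0:
  fixes A :: "'x::{real_inner, complete_space} \<Rightarrow> 'y::{real_inner, complete_space}"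
  assumes A: "bounded_linear A" and inj: "\<And>x. A x = 0 \<Longrightarrow> x = 0"
    and u: "sym_form u" and 0: "tpow A u = (\<lambda>_. 0)"
  shows "u = (\<lambda>_. 0)"
proof
  fix xs :: "'x list"
  have "u ys = 0" if "set ys \<subseteq> range (adjoint A)" for ys
  proof -
    have "\<exists>zs. ys = map (adjoint A) zs" using that by (auto simp: ex_map_conv)
    then show ?thesis using 0 by (auto simp: tpow_def fun_eq_iff)
  qed
  moreover have "closure (span (range (adjoint A))) = UNIV"
    using adjoint_dense_range[OF A inj] closure_mono[OF span_superset[of "range (adjoint A)"]] by auto
  moreover have "mform (length xs) u" using u by (auto intro: sym_form_mform)
  ultimately show "u xs = 0" by (intro mform_eq_0[of "range (adjoint A)" "length xs" u xs]) auto
qed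

lemma tpow_inj:
  fixes A :: "'x::{real_inner, complete_space} \<Rightarrow> 'y::{real_inner, complete_space}"
  assumes A: "bounded_linear A" "inj A" and uv: "u \<in> fock" "v \<in> fock" and eq: "tpow A u = tpow A v"
  shows "u = v"
proof -
  have "A x = 0 \<Longrightarrow> x = 0" for x
    using A by (metis injD linear_0 bounded_linear.linear)
  then have "(\<lambda>xs. u xs - v xs) = (\<lambda>_. 0)"
    by (rule tpow_eq_0[OF A(1)]) (use fock_diff[OF uv] eq in \<open>auto simp: fock_def tpow_diff fun_eq_iff\<close>)
  then show ?thesis by (simp add: fun_eq_iff)
qed

lemma level_fock_n:
  assumes u: "u \<in> fock" shows "level n u \<in> fock_n n" "fnorm (level n u) \<le> fnorm u"
proof -
  have le: "cmod (level n u xs) \<le> cmod (u xs)" for xs by (simp add: level_def)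
  have sf: "sym_form u" and su: "(\<lambda>xs. (cmod (u xs))\<^sup>2) summable_on lists onb" using u by (auto simp: fock_def)
  have "sym_form (level n u)"
  proof (rule sym_formI)
    show "level n u xs = level n u ys" if "mset xs = mset ys" for xs ys
      using sym_form_mset[OF sf that] mset_eq_length[OF that] by (simp add: level_def)
    show "mform m (level n u)" for m
    proof (cases "m = n")
      case True
      have "mform n u" by (rule sym_form_mform[OF sf])
      then show ?thesis unfolding mform_def True level_def by (simp cong: conj_cong)
    next
      case False
      then show ?thesis unfolding mform_def level_def
        by (auto simp: linear_iff intro!: exI[of _ 0])
    qed
  qed
  moreover have s: "(\<lambda>xs. (cmod (level n u xs))\<^sup>2) summable_on lists onb"
    by (rule summable_on_comparison_test[OF su]) (simp_all add: le power_mono)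
  ultimately show "level n u \<in> fock_n n" by (simp add: fock_n_iff fock_def level_def)
  show "fnorm (level n u) \<le> fnorm u"
    unfolding fnorm_def by (intro real_sqrt_le_mono infsum_mono s su power_mono le) simp
qed

lemma fip_fock_n: "v \<in> fock_n n \<Longrightarrow> fip u v = (\<Sum>\<^sub>\<infinity>xs\<in>onb_lists n. u xs * cnj (v xs))"
  unfolding fip_def by (rule infsum_cong_neutral) (auto simp: fock_n_iff onb_lists_def)

lemma fock_n_hs: "u \<in> fock_n n \<Longrightarrow> mform n u \<and> hs n u < \<infinity>"
  using hs_le_hsq[of n u] by (auto simp: fock_n_iff fock_iff intro: sym_form_mform le_less_trans)

lemma fip_tpow:
  fixes A :: "'x::{real_inner, complete_space} \<Rightarrow> 'y::{real_inner, complete_space}"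
  assumes A: "bounded_linear A" and u: "u \<in> fock_n n" and v: "v \<in> fock_n n"
  shows "fip (tpow A u) v = fip u (tpow (adjoint A) v)"
proof -
  have "fip (tpow A u) v = (\<Sum>\<^sub>\<infinity>ys\<in>onb_lists n. u (map (adjoint A) ys) * cnj (v ys))"
    using v by (simp add: fip_fock_n tpow_def)
  also have "\<dots> = (\<Sum>\<^sub>\<infinity>xs\<in>onb_lists n. u xs * cnj (v (map A xs)))"
    using fock_n_hs[OF u] fock_n_hs[OF v] by (intro infsum_map_adjoint A) auto
  also have "\<dots> = fip u (tpow (adjoint A) v)"
    unfolding fip_fock_n[OF tpow_fock_n[OF bounded_linear_adjoint[OF A] v]]
    by (simp add: tpow_def adjoint_adjoint_hilbert[OF A])
  finally show ?thesis .
qed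

section \<open>Riggings and image measures\<close>

lemma riggingD:
  assumes "rigging i j pr"
  shows "bounded_linear i" "inj i" "closure (range i) = UNIV" "linear (\<lambda>\<xi>. pr \<xi> \<phi>)"
    "bounded_linear (pr \<xi>)" "norm \<xi> = onorm (pr \<xi>)"
    "\<And>l. bounded_linear l \<Longrightarrow> \<exists>\<xi>. pr \<xi> = l"
  using assms unfolding rigging_def by blast+

text \<open>The norm of the negative space is the dual norm, so a vector pairing to zero with
  everything is zero.\<close>

lemma rigging_inj:
  assumes R: "rigging i j pr" and eq: "pr \<xi> = pr \<eta>"
  shows "\<xi> = \<eta>"
proof -
  have "pr (\<xi> - \<eta>) \<phi> = 0" for \<phi>
    using linear_diff[OF riggingD(4)[OF R]] eq by simp
  then have "pr (\<xi> - \<eta>) = (\<lambda>_. 0)" by (rule ext)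
  then have "norm (\<xi> - \<eta>) = 0" using riggingD(6)[OF R, of "\<xi> - \<eta>"] by (simp add: onorm_zero)
  then show ?thesis by simp
qed

lemma riesz_inner:
  fixes i :: "'p::{real_inner, complete_space} \<Rightarrow> 'z::real_inner"
  assumes R: "rigging i j pr"
  shows "pr \<xi> \<phi> = riesz pr \<xi> \<bullet> \<phi>"
proof -
  obtain r where r: "\<And>\<phi>. pr \<xi> \<phi> = r \<bullet> \<phi>" using riesz_representation[OF riggingD(5)[OF R]] by blast
  have "riesz pr \<xi> = r"
    unfolding riesz_def
  proof (rule the_equality)
    fix r' assume "\<forall>\<phi>. pr \<xi> \<phi> = r' \<bullet> \<phi>"
    then show "r' = r" by (intro vector_eq_rdot[THEN iffD1]) (simp add: r)
  qed (simp add: r)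
  then show ?thesis by (simp add: r)
qed

lemma bounded_linear_riesz:
  fixes i :: "'p::{real_inner, complete_space} \<Rightarrow> 'z::real_inner"
  assumes R: "rigging i j pr"
  shows "bounded_linear (riesz pr)"
proof (rule bounded_linear_intro)
  show "riesz pr (x + y) = riesz pr x + riesz pr y" for x y
    by (rule vector_eq_rdot[THEN iffD1])
      (simp add: inner_add_left riesz_inner[OF R, symmetric] linear_add[OF riggingD(4)[OF R]])
  show "riesz pr (r *\<^sub>R x) = r *\<^sub>R riesz pr x" for r x
    by (rule vector_eq_rdot[THEN iffD1])
      (simp add: riesz_inner[OF R, symmetric] linear_scale[OF riggingD(4)[OF R]])
  show "norm (riesz pr \<xi>) \<le> norm \<xi> * 1" for \<xi>
  proof -
    let ?r = "riesz pr \<xi>"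
    have "norm ?r * norm ?r = pr \<xi> ?r" by (simp add: riesz_inner[OF R] norm_eq_sqrt_inner)
    also have "\<dots> \<le> norm \<xi> * norm ?r"
      using onorm[OF riggingD(5)[OF R], of \<xi> ?r] riggingD(6)[OF R, of \<xi>] by simp
    finally show ?thesis by (cases "?r = 0") simp_all
  qed
qed

locale dual_operator =
  fixes iH :: "'hp::{real_inner, complete_space} \<Rightarrow> 'h::real_inner"
    and jH :: "'h \<Rightarrow> 'hm::{real_inner, complete_space}"
    and prH :: "'hm \<Rightarrow> 'hp \<Rightarrow> real"
    and iT :: "'tp::{real_inner, complete_space} \<Rightarrow> 't0::real_inner"
    and jT :: "'t0 \<Rightarrow> 'tm::{real_inner, complete_space}"
    and prT :: "'tm \<Rightarrow> 'tp \<Rightarrow> real"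
    and K :: "'tp \<Rightarrow> 'hp"
  assumes RH: "rigging iH jH prH" and RT: "rigging iT jT prT" and K: "bounded_linear K"
    and K_dense: "closure (range K) = UNIV"
begin

abbreviation D where "D \<equiv> dual_op prH prT K"

text \<open>The definite description in \<open>dual_op\<close> is legitimate: the negative space
  represents every bounded functional, and it does so uniquely.\<close>

lemma prT_D: "prT (D \<xi>) f = prH \<xi> (K f)"
proof -
  have "bounded_linear (\<lambda>f. prH \<xi> (K f))"
    by (rule bounded_linear_compose[OF riggingD(5)[OF RH] K])
  then obtain \<omega> where \<omega>: "prT \<omega> = (\<lambda>f. prH \<xi> (K f))" using riggingD(7)[OF RT] by blast
  have "D \<xi> = \<omega>"
    unfolding dual_op_def
  proof (rule the_equality)
    fix \<omega>' assume "\<forall>f. prT \<omega>' f = prH \<xi> (K f)"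
    then show "\<omega>' = \<omega>" using \<omega> by (intro rigging_inj[OF RT]) (simp add: fun_eq_iff)
  qed (simp add: \<omega>)
  then show ?thesis by (simp add: \<omega>)
qed

lemma bounded_linear_D: "bounded_linear D"
proof -
  obtain C where C: "C \<ge> 0" "\<And>f. norm (K f) \<le> C * norm f"
    using bounded_linear.nonneg_bounded[OF K] by (auto simp: mult.commute)
  show ?thesis
  proof (rule bounded_linear_intro)
    show "D (x + y) = D x + D y" for x y
      by (rule rigging_inj[OF RT])
        (simp add: fun_eq_iff prT_D linear_add[OF riggingD(4)[OF RT]] linear_add[OF riggingD(4)[OF RH]])
    show "D (r *\<^sub>R x) = r *\<^sub>R D x" for r x
      by (rule rigging_inj[OF RT])
        (simp add: fun_eq_iff prT_D linear_scale[OF riggingD(4)[OF RT]] linear_scale[OF riggingD(4)[OF RH]])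
    show "norm (D \<xi>) \<le> norm \<xi> * C" for \<xi>
      unfolding riggingD(6)[OF RT, of "D \<xi>"]
    proof (rule onorm_bound)
      show "0 \<le> norm \<xi> * C" using C by simp
      fix f
      have "norm (prT (D \<xi>) f) \<le> norm \<xi> * norm (K f)"
        using onorm[OF riggingD(5)[OF RH], of \<xi> "K f"] riggingD(6)[OF RH, of \<xi>] by (simp add: prT_D)
      also have "\<dots> \<le> norm \<xi> * (C * norm f)" by (intro mult_left_mono C) simp
      finally show "norm (prT (D \<xi>) f) \<le> norm \<xi> * C * norm f" by (simp add: mult.assoc)
    qed
  qed
qed

lemma inj_D: "inj D"
proof (rule injI)
  fix \<xi> \<eta> assume eq: "D \<xi> = D \<eta>"
  have "riesz prH \<xi> = riesz prH \<eta>"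
    by (rule dense_eqI[OF K_dense]) (auto simp: riesz_inner[OF RH, symmetric] prT_D[symmetric] eq)
  then show "\<xi> = \<eta>" by (intro rigging_inj[OF RH] ext) (simp add: riesz_inner[OF RH])
qed

text \<open>Seen through the canonical maps onto the positive spaces, \<open>D\<close> is the
  Hilbert space adjoint of \<open>K\<close>. This reduces statements about pairings to
  \<open>fip_tpow\<close>.\<close>

lemma riesz_D: "riesz prT \<circ> D = adjoint K \<circ> riesz prH"
proof
  fix \<xi>
  show "(riesz prT \<circ> D) \<xi> = (adjoint K \<circ> riesz prH) \<xi>"
  proof (rule vector_eq_rdot[THEN iffD1, rule_format])
    fix f
    have "(riesz prT \<circ> D) \<xi> \<bullet> f = prT (D \<xi>) f" by (simp add: riesz_inner[OF RT])
    also have "\<dots> = prH \<xi> (K f)" by (rule prT_D)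
    also have "\<dots> = riesz prH \<xi> \<bullet> K f" by (rule riesz_inner[OF RH])
    also have "\<dots> = K f \<bullet> riesz prH \<xi>" by (rule inner_commute)
    also have "\<dots> = f \<bullet> adjoint K (riesz prH \<xi>)" by (rule adjoint_works_hilbert[OF K])
    finally show "(riesz prT \<circ> D) \<xi> \<bullet> f = (adjoint K \<circ> riesz prH) \<xi> \<bullet> f"
      by (simp add: inner_commute)
  qed
qed

lemma fock_prod_D: "p \<in> fock_prod \<Longrightarrow> tpow D p \<in> fock_prod"
  unfolding fock_prod_def by (simp add: level_tpow tpow_fock_n[OF bounded_linear_D])

text \<open>The defining relation of \<open>D\<close>, lifted to the Fock pairing. The two series
  agree term by term: \<open>riesz_D\<close> replaces \<open>D\<close> by \<open>adjoint K\<close>,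
  and \<open>fip_tpow\<close> moves the latter to the other side as \<open>K\<close>.\<close>

lemma fpair_D:
  assumes p: "p \<in> fock_prod" and F: "F \<in> fock_fin"
  shows "fpair prT (tpow D p) F = fpair prH p (tpow K F)"
proof -
  have "fip (tpow (riesz prT) (level n (tpow D p))) (level n F)
      = fip (tpow (riesz prH) (level n p)) (level n (tpow K F))" for n
  proof -
    have F_n: "level n F \<in> fock_n n" using F level_fock_n(1) by (auto simp: fock_fin_def)
    have "fip (tpow (riesz prT) (level n (tpow D p))) (level n F)
        = fip (tpow (adjoint K) (tpow (riesz prH) (level n p))) (level n F)"
      by (simp add: level_tpow riesz_D tpow_compose[OF bounded_linear_D bounded_linear_riesz[OF RT]]
          tpow_compose[OF bounded_linear_riesz[OF RH] bounded_linear_adjoint[OF K]])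
    also have "\<dots> = fip (tpow (riesz prH) (level n p)) (tpow (adjoint (adjoint K)) (level n F))"
      using p by (intro fip_tpow[where n = n] bounded_linear_adjoint K tpow_fock_n bounded_linear_riesz[OF RH] F_n)
        (simp add: fock_prod_def)
    finally show ?thesis by (simp add: adjoint_adjoint_hilbert[OF K] level_tpow)
  qed
  then show ?thesis by (simp add: fpair_def)
qed

end

section \<open>The image measure and its square integrable functions\<close>

lemma sigma_algebra_vimage_borel:
  "sigma_algebra UNIV {E :: 'b set. k -` E \<in> sets (borel :: 'a::topological_space measure)}"
proof (unfold sigma_algebra_iff2, intro conjI ballI allI impI)
  fix E :: "'b set" assume "E \<in> {E. k -` E \<in> sets (borel :: 'a measure)}"
  then have "- (k -` E) \<in> sets borel" by (intro borel_comp) simp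
  then show "UNIV - E \<in> {E. k -` E \<in> sets (borel :: 'a measure)}"
    by (simp add: vimage_Compl Compl_eq_Diff_UNIV[symmetric])
next
  fix E :: "nat \<Rightarrow> 'b set" assume "range E \<subseteq> {E. k -` E \<in> sets (borel :: 'a measure)}"
  then have "(\<Union>i. k -` E i) \<in> sets borel" by (intro sets.countable_UN) auto
  then show "(\<Union>i. E i) \<in> {E. k -` E \<in> sets (borel :: 'a measure)}" by (simp add: vimage_UN)
qed auto

text \<open>The sets with Borel preimage already form a sigma-algebra, so \<open>sigma\<close> adds
  nothing to them.\<close>

lemma sets_image_measure: "sets (image_measure \<rho> k) = {E. k -` E \<in> sets borel}"
  unfolding image_measure_def
  by (simp add: sigma_algebra.sets_measure_of_eq[OF sigma_algebra_vimage_borel])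

lemma space_image_measure: "space (image_measure \<rho> k) = UNIV"
  by (simp add: image_measure_def)

lemma measurable_image_measure:
  assumes "sets \<rho> = sets borel"
  shows "k \<in> measurable \<rho> (sigma UNIV {E. k -` E \<in> sets borel})"
proof (rule measurable_sigma_sets)
  show "sets (sigma UNIV {E. k -` E \<in> sets borel}) = sigma_sets UNIV {E. k -` E \<in> sets borel}" by simp
  show "k -` A \<inter> space \<rho> \<in> sets \<rho>" if "A \<in> {E. k -` E \<in> sets borel}" for A
    using that assms sets_eq_imp_space_eq[OF assms] by simp
qed auto

text \<open>P is an arbitrary predicate. From right to left, injectivity of k allows a null set of
  \<rho> to be pushed forward to a set whose preimage is exactly that null set.\<close>

lemma AE_image_measure:
  assumes \<rho>: "sets \<rho> = sets borel" and k: "inj k"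
  shows "(AE w in image_measure \<rho> k. P w) \<longleftrightarrow> (AE x in \<rho>. P (k x))"
proof
  have sp: "space \<rho> = UNIV" using sets_eq_imp_space_eq[OF \<rho>] by simp
  note meas = measurable_image_measure[OF \<rho>, of k]
  show "AE x in \<rho>. P (k x)" if "AE w in image_measure \<rho> k. P w"
    using AE_distrD[OF meas] that unfolding image_measure_def .
  assume "AE x in \<rho>. P (k x)"
  then obtain N where N: "{x \<in> space \<rho>. \<not> P (k x)} \<subseteq> N" "emeasure \<rho> N = 0" "N \<in> sets \<rho>"
    by (rule AE_E)
  \<comment> \<open>The complement of the range is added so that P is settled there as well; its
    preimage is empty, so it costs no measure.\<close>
  define M where "M = k ` N \<union> - range k"
  have kM: "k -` M = N" using k by (auto simp: M_def inj_def)
  have Ms: "M \<in> sets (image_measure \<rho> k)" using N(3) by (simp add: sets_image_measure kM \<rho>)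
  have "emeasure (image_measure \<rho> k) M = emeasure \<rho> (k -` M \<inter> space \<rho>)"
    unfolding image_measure_def by (rule emeasure_distr[OF meas]) (use Ms in \<open>simp add: image_measure_def\<close>)
  then have "M \<in> null_sets (image_measure \<rho> k)" using Ms N(2) by (simp add: kM sp null_sets_def)
  then show "AE w in image_measure \<rho> k. P w"
    by (rule AE_I') (use N(1) sp in \<open>auto simp: M_def\<close>)
qed

text \<open>Since the measurable sets are all those with Borel preimage, measurability of g and of g
  o k are the same condition; the integrals then transfer.\<close>

lemma L2_image_measure:
  assumes \<rho>: "sets \<rho> = sets borel"
  shows "g \<in> L2 (image_measure \<rho> k) \<longleftrightarrow> (\<lambda>x. g (k x)) \<in> L2 \<rho>"
    "g \<in> L2 (image_measure \<rho> k) \<Longrightarrow>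
      (\<integral>w. (cmod (g w))\<^sup>2 \<partial>image_measure \<rho> k) = (\<integral>x. (cmod (g (k x)))\<^sup>2 \<partial>\<rho>)"
proof -
  note meas = measurable_image_measure[OF \<rho>, of k]
  have sp: "space \<rho> = UNIV" using sets_eq_imp_space_eq[OF \<rho>] by simp
  have m: "g \<in> borel_measurable (image_measure \<rho> k) \<longleftrightarrow> (\<lambda>x. g (k x)) \<in> borel_measurable \<rho>"
    unfolding measurable_def
    by (simp add: space_image_measure sets_image_measure \<rho> sp vimage_def)
  have d: "borel_measurable (image_measure \<rho> k) = borel_measurable (sigma UNIV {E. k -` E \<in> sets borel})"
    by (rule measurable_cong_sets) (simp_all add: image_measure_def)
  have i: "integrable (image_measure \<rho> k) (\<lambda>w. (cmod (g w))\<^sup>2) \<longleftrightarrow> integrable \<rho> (\<lambda>x. (cmod (g (k x)))\<^sup>2)"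
    if "g \<in> borel_measurable (image_measure \<rho> k)"
    unfolding image_measure_def by (rule integrable_distr_eq[OF meas]) (use that[unfolded d] in measurable)
  show "g \<in> L2 (image_measure \<rho> k) \<longleftrightarrow> (\<lambda>x. g (k x)) \<in> L2 \<rho>"
    unfolding L2_def using m i by auto
  show "(\<integral>w. (cmod (g w))\<^sup>2 \<partial>image_measure \<rho> k) = (\<integral>x. (cmod (g (k x)))\<^sup>2 \<partial>\<rho>)"
    if "g \<in> L2 (image_measure \<rho> k)"
  proof -
    have "g \<in> borel_measurable (sigma UNIV {E. k -` E \<in> sets borel})"
      using that unfolding L2_def d by simp
    then have "(\<lambda>w. (cmod (g w))\<^sup>2) \<in> borel_measurable (sigma UNIV {E. k -` E \<in> sets borel})"
      by (intro borel_measurable_power measurable_compose[OF _ borel_measurable_norm])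
    then show ?thesis unfolding image_measure_def by (rule integral_distr[OF meas])
  qed
qed

section \<open>Density of the range of a tensor power\<close>

lemma sum_le_fnorm: "u \<in> fock \<Longrightarrow> finite G \<Longrightarrow> G \<subseteq> lists onb \<Longrightarrow> (\<Sum>xs\<in>G. (cmod (u xs))\<^sup>2) \<le> (fnorm u)\<^sup>2"
  unfolding fnorm_def by (simp add: infsum_nonneg) (rule finite_sum_le_infsum, auto simp: fock_def)

lemma fnorm_parallelogram:
  assumes u: "u \<in> fock" and v: "v \<in> fock"
  shows "(fnorm (\<lambda>xs. u xs - v xs))\<^sup>2 = 2 * (fnorm u)\<^sup>2 + 2 * (fnorm v)\<^sup>2 - (fnorm (\<lambda>xs. u xs + v xs))\<^sup>2"
proof -
  let ?B = "lists onb :: 'a list set"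
  have sq: "(fnorm w)\<^sup>2 = (\<Sum>\<^sub>\<infinity>xs\<in>?B. (cmod (w xs))\<^sup>2)" for w :: "'a fvec"
    by (simp add: fnorm_def infsum_nonneg)
  have su: "(\<lambda>xs. (cmod (w xs))\<^sup>2) summable_on ?B" if "w \<in> fock" for w using that by (simp add: fock_def)
  have "(fnorm (\<lambda>xs. u xs - v xs))\<^sup>2 + (fnorm (\<lambda>xs. u xs + v xs))\<^sup>2
      = (\<Sum>\<^sub>\<infinity>xs\<in>?B. (cmod (u xs - v xs))\<^sup>2 + (cmod (u xs + v xs))\<^sup>2)"
    unfolding sq by (intro infsum_add[symmetric] su fock_diff fock_add u v)
  also have "\<dots> = (\<Sum>\<^sub>\<infinity>xs\<in>?B. 2 * (cmod (u xs))\<^sup>2 + 2 * (cmod (v xs))\<^sup>2)"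
    by (rule infsum_cong) (simp add: cmod_power2 power2_sum power2_diff)
  also have "\<dots> = (\<Sum>\<^sub>\<infinity>xs\<in>?B. 2 * (cmod (u xs))\<^sup>2) + (\<Sum>\<^sub>\<infinity>xs\<in>?B. 2 * (cmod (v xs))\<^sup>2)"
    by (intro infsum_add summable_on_cmult_right su u v)
  also have "\<dots> = 2 * (fnorm u)\<^sup>2 + 2 * (fnorm v)\<^sup>2"
    unfolding sq by (simp add: infsum_cmult_right')
  finally show ?thesis by simp
qed

text \<open>By the parallelogram law it is enough that \<open>w k + u\<close> does not lose norm in the limit.\<close>
lemma fnorm_tendsto_if_pointwise:
  assumes w: "\<And>k. w k \<in> fock" and u: "u \<in> fock"
    and lim: "\<And>xs. xs \<in> lists onb \<Longrightarrow> (\<lambda>k. w k xs) \<longlonglongrightarrow> u xs"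
    and c: "\<And>k. fnorm (w k) \<le> c k" "c \<longlonglongrightarrow> fnorm u"
  shows "(\<lambda>k. fnorm (\<lambda>xs. w k xs - u xs)) \<longlonglongrightarrow> 0"
proof -
  let ?B = "lists onb :: 'a list set"
  have "(\<lambda>k. (fnorm (\<lambda>xs. w k xs - u xs))\<^sup>2) \<longlonglongrightarrow> 0"
  proof (rule order_tendstoI)
    fix e :: real assume e: "e > 0"
    \<comment> \<open>The sum of \<open>w k\<close> and u should approach 2 u, whose squared norm is
      4 |u|^2; the finite set G captures this up to e/2.\<close>
    have "(\<lambda>xs. (cmod (2 * u xs))\<^sup>2) summable_on ?B" using fock_scale[OF u, of 2] by (simp add: fock_def)
    from infsum_finite_approximation[OF this, of "e/2"] e obtain G where
      G: "finite G" "G \<subseteq> ?B" "dist (\<Sum>xs\<in>G. (cmod (2 * u xs))\<^sup>2) (\<Sum>\<^sub>\<infinity>xs\<in>?B. (cmod (2 * u xs))\<^sup>2) \<le> e/2" by auto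
    have "(\<Sum>\<^sub>\<infinity>xs\<in>?B. (cmod (2 * u xs))\<^sup>2) = (fnorm (\<lambda>xs. 2 * u xs))\<^sup>2"
      by (simp add: fnorm_def infsum_nonneg)
    also have "\<dots> = 4 * (fnorm u)\<^sup>2" by (simp add: fnorm_scale power_mult_distrib)
    finally have "\<bar>(\<Sum>xs\<in>G. (cmod (2 * u xs))\<^sup>2) - 4 * (fnorm u)\<^sup>2\<bar> \<le> e / 2"
      using G(3) by (simp only: dist_real_def)
    then have "4 * (fnorm u)\<^sup>2 - e < (\<Sum>xs\<in>G. (cmod (2 * u xs))\<^sup>2)"
      using e by linarith
    then have pos: "0 < e + (\<Sum>xs\<in>G. (cmod (u xs + u xs))\<^sup>2) - 2 * (fnorm u)\<^sup>2 - 2 * (fnorm u)\<^sup>2"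
      by simp
    \<comment> \<open>Once this expression is positive, the parallelogram law gives the claim: the
      finite sum bounds |w k + u|^2 from below and \<open>c k\<close> bounds |w k| from above. Its
      limit is the positive number in \<open>pos\<close>.\<close>
    have "(\<lambda>k. e + (\<Sum>xs\<in>G. (cmod (w k xs + u xs))\<^sup>2) - 2 * (c k)\<^sup>2 - 2 * (fnorm u)\<^sup>2)
        \<longlonglongrightarrow> e + (\<Sum>xs\<in>G. (cmod (u xs + u xs))\<^sup>2) - 2 * (fnorm u)\<^sup>2 - 2 * (fnorm u)\<^sup>2"
      by (intro tendsto_intros lim c) (use G(2) in auto)
    from order_tendstoD(1)[OF this pos]
    show "\<forall>\<^sub>F k in sequentially. (fnorm (\<lambda>xs. w k xs - u xs))\<^sup>2 < e"
    proof (rule eventually_mono)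
      fix k assume "0 < e + (\<Sum>xs\<in>G. (cmod (w k xs + u xs))\<^sup>2) - 2 * (c k)\<^sup>2 - 2 * (fnorm u)\<^sup>2"
      moreover have "(\<Sum>xs\<in>G. (cmod (w k xs + u xs))\<^sup>2) \<le> (fnorm (\<lambda>xs. w k xs + u xs))\<^sup>2"
        by (rule sum_le_fnorm[OF fock_add[OF w u] G(1,2)])
      moreover have "(fnorm (w k))\<^sup>2 \<le> (c k)\<^sup>2" by (intro power_mono c fnorm_nonneg)
      ultimately show "(fnorm (\<lambda>xs. w k xs - u xs))\<^sup>2 < e"
        unfolding fnorm_parallelogram[OF w u] by linarith
    qed
  next
    fix e :: real assume "e < 0"
    then show "\<forall>\<^sub>F k in sequentially. e < (fnorm (\<lambda>xs. w k xs - u xs))\<^sup>2"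
      by (intro always_eventually allI) (meson less_le_trans zero_le_power2)
  qed
  from tendsto_real_sqrt[OF this] show ?thesis by (simp add: fnorm_nonneg)
qed

text \<open>Telescoping over the slots: replace the first argument by its limit, estimate the error
  by the bound of u times convergent norms, and continue with one slot fewer.\<close>

lemma mform_tendsto:
  fixes g :: "'a \<Rightarrow> 'x::real_inner"
  shows "mform (length ys) u \<Longrightarrow> (\<And>y. y \<in> set ys \<Longrightarrow> (\<lambda>k. f k y) \<longlonglongrightarrow> g y) \<Longrightarrow>
    (\<lambda>k::nat. u (map (f k) ys)) \<longlonglongrightarrow> u (map g ys)"
proof (induction ys arbitrary: u)
  case (Cons y ys)
  obtain C where C: "\<And>xs. length xs = length (y # ys) \<Longrightarrow> cmod (u xs) \<le> C * prod_list (map norm xs)"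
    using mform_bound[OF Cons.prems(1)] by blast
  have prod: "(\<lambda>k. prod_list (map norm (map (f k) zs))) \<longlonglongrightarrow> prod_list (map norm (map g zs))"
    if "set zs \<subseteq> set (y # ys)" for zs
    using that by (induction zs) (auto intro!: tendsto_mult tendsto_norm Cons.prems(2))
  have "(\<lambda>k. C * (norm (f k y - g y) * prod_list (map norm (map (f k) ys)))) \<longlonglongrightarrow> C * (norm (g y - g y) * prod_list (map norm (map g ys)))"
    by (intro tendsto_intros prod Cons.prems(2)) auto
  then have lim: "(\<lambda>k. C * (norm (f k y - g y) * prod_list (map norm (map (f k) ys)))) \<longlonglongrightarrow> 0" by simp
  have m: "mform (Suc (length ys)) u" using Cons.prems(1) by simp
  have eq: "u (map (f k) (y # ys)) = u ((f k y - g y) # map (f k) ys) + u (g y # map (f k) ys)" for k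
    using bounded_linear.linear[OF mform_slot[OF m, of "map (f k) ys"], THEN linear_diff, of "f k y" "g y"] by simp
  have 1: "(\<lambda>k. u ((f k y - g y) # map (f k) ys)) \<longlonglongrightarrow> 0"
  proof (rule Lim_null_comparison[OF always_eventually lim], rule allI)
    fix k
    show "norm (u ((f k y - g y) # map (f k) ys)) \<le> C * (norm (f k y - g y) * prod_list (map norm (map (f k) ys)))"
      using C[of "(f k y - g y) # map (f k) ys"] by simp
  qed
  have 2: "(\<lambda>k. u (g y # map (f k) ys)) \<longlonglongrightarrow> u (g y # map g ys)"
    by (rule Cons.IH[OF mform_Cons[OF m]]) (use Cons.prems(2) in auto)
  show ?case using tendsto_add[OF 1 2] unfolding eq by simp
qed simp

lemma norm_onb_sum:
  assumes "finite F" "F \<subseteq> (onb :: 'a::{real_inner, complete_space} set)"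
  shows "(norm (\<Sum>b\<in>F. u b *\<^sub>R b))\<^sup>2 = (\<Sum>b\<in>F. (u b)\<^sup>2)"
  using norm_diff_onb_sum[OF is_onb_onb assms, of 0 u] by simp

lemma norm_onb: "b \<in> (onb :: 'a::{real_inner, complete_space} set) \<Longrightarrow> norm b = 1"
  using is_onb_onb[where ?'a = 'a] by (simp add: is_onb_def)

text \<open>\<open>S k\<close> sends each of finitely many basis vectors b to a vector whose image
  under \<open>K\<close> is close to b, and the remaining basis vectors to zero. Thus K o
  \<open>S k\<close> is an orthogonal projection up to an error of norm at most 1 / (k + 1). The
  convergence is stated for adjoints because \<open>tpow\<close> precomposes with them.\<close>

lemma approximate_identity:
  fixes K :: "'x::{real_inner, complete_space} \<Rightarrow> 'y::{real_inner, complete_space}"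
  assumes K: "bounded_linear K" "closure (range K) = UNIV" and cnt: "countable (onb :: 'y set)"
  obtains S :: "nat \<Rightarrow> 'y \<Rightarrow> 'x" where "\<And>k. bounded_linear (S k)"
    "\<And>k x. norm (K (S k x)) \<le> (1 + 1 / Suc k) * norm x"
    "\<And>b. b \<in> onb \<Longrightarrow> (\<lambda>k. adjoint (K \<circ> S k) b) \<longlonglongrightarrow> b"
proof -
  define F where "F k = {b \<in> (onb :: 'y set). to_nat_on onb b < k}" for k
  have F: "F k \<subseteq> onb" for k by (auto simp: F_def)
  have inj: "inj_on (to_nat_on onb) (F k)" for k
    using inj_on_to_nat_on[OF cnt] F by (rule inj_on_subset)
  have im: "to_nat_on onb ` F k \<subseteq> {..<k}" for k by (auto simp: F_def)
  have fin: "finite (F k)" for k using inj_on_finite[OF inj im] by simp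
  have card: "card (F k) \<le> k" for k using card_inj_on_le[OF inj im] by simp
  \<comment> \<open>At most k basis vectors are involved, so individual errors of size 1 / (k + 1)^2
    add up to at most 1 / (k + 1).\<close>
  define d where "d k = 1 / (real (Suc k))\<^sup>2" for k
  have d: "d k > 0" "real (card (F k)) * d k \<le> 1 / Suc k" for k
  proof -
    show "d k > 0" by (simp add: d_def)
    have "real (card (F k)) * d k \<le> real (Suc k) * d k"
      using card[of k] \<open>d k > 0\<close> by (intro mult_right_mono) auto
    also have "\<dots> = 1 / Suc k" by (simp add: d_def power2_eq_square)
    finally show "real (card (F k)) * d k \<le> 1 / Suc k" .
  qed
  have "\<exists>t. norm (K t - b) \<le> d k" for k b
  proof -
    have "b \<in> closure (range K)" using K(2) by simp
    then obtain y where "y \<in> range K" "dist y b < d k" using d(1) unfolding closure_approachable by blast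
    then show ?thesis by (auto simp: dist_norm intro: less_imp_le)
  qed
  then have ex: "\<exists>t. norm (K t - b) \<le> d k" for k b by blast
  define t where "t k b = (SOME t. norm (K t - b) \<le> d k)" for k b
  have t: "norm (K (t k b) - b) \<le> d k" for k b unfolding t_def by (rule someI_ex[OF ex])
  define S where "S k x = (\<Sum>b\<in>F k. (x \<bullet> b) *\<^sub>R t k b)" for k x
  have S: "bounded_linear (S k)" for k
    unfolding S_def by (intro bounded_linear_sum bounded_linear_compose[OF bounded_linear_scaleR_left bounded_linear_inner_left])
  have KS: "K (S k x) = (\<Sum>b\<in>F k. (x \<bullet> b) *\<^sub>R K (t k b))" for k x
    unfolding S_def using bounded_linear.linear[OF K(1)] by (simp add: linear_sum linear_scale)
  have adj: "adjoint (K \<circ> S k) y = (\<Sum>b\<in>F k. (K (t k b) \<bullet> y) *\<^sub>R b)" for k y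
  proof -
    have "adjoint (K \<circ> S k) = (\<lambda>y. \<Sum>b\<in>F k. (K (t k b) \<bullet> y) *\<^sub>R b)"
    proof (rule adjoint_unique_hilbert)
      show "bounded_linear (K \<circ> S k)" using bounded_linear_compose[OF K(1) S] by (simp add: comp_def)
      show "(K \<circ> S k) x \<bullet> y = x \<bullet> (\<Sum>b\<in>F k. (K (t k b) \<bullet> y) *\<^sub>R b)" for x y
        by (simp add: KS inner_sum_left inner_sum_right mult.commute)
    qed
    then show ?thesis by simp
  qed
  show thesis
  proof (rule that[of S])
    show "bounded_linear (S k)" for k by (rule S)
    show "norm (K (S k x)) \<le> (1 + 1 / Suc k) * norm x" for k x
    proof -
      have "K (S k x) = (\<Sum>b\<in>F k. (x \<bullet> b) *\<^sub>R b) + (\<Sum>b\<in>F k. (x \<bullet> b) *\<^sub>R (K (t k b) - b))"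
        by (simp add: KS sum.distrib[symmetric] scaleR_add_right[symmetric])
      also have "norm \<dots> \<le> norm (\<Sum>b\<in>F k. (x \<bullet> b) *\<^sub>R b) + norm (\<Sum>b\<in>F k. (x \<bullet> b) *\<^sub>R (K (t k b) - b))"
        by (rule norm_triangle_ineq)
      also have "norm (\<Sum>b\<in>F k. (x \<bullet> b) *\<^sub>R b) \<le> norm x"
        using bessel[OF is_onb_onb fin[of k] F[of k], of x] by (simp add: norm_onb_sum[OF fin F, symmetric] power2_le_iff_abs_le)
      also have "norm (\<Sum>b\<in>F k. (x \<bullet> b) *\<^sub>R (K (t k b) - b)) \<le> (\<Sum>b\<in>F k. norm x * d k)"
      proof (rule sum_norm_le)
        fix b assume "b \<in> F k"
        then have "norm b = 1" using F by (intro norm_onb) auto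
        then have "\<bar>x \<bullet> b\<bar> \<le> norm x" using Cauchy_Schwarz_ineq2[of x b] by simp
        then show "norm ((x \<bullet> b) *\<^sub>R (K (t k b) - b)) \<le> norm x * d k"
          using t[of k b] by (auto intro!: mult_mono)
      qed
      also have "(\<Sum>b\<in>F k. norm x * d k) = (real (card (F k)) * d k) * norm x" by simp
      also have "\<dots> \<le> (1 / Suc k) * norm x" by (intro mult_right_mono d) simp
      finally show ?thesis by (simp add: algebra_simps)
    qed
    show "(\<lambda>k. adjoint (K \<circ> S k) y) \<longlonglongrightarrow> y" if y: "y \<in> onb" for y
    proof -
      \<comment> \<open>Once k exceeds the index of y, the projection part fixes y and only the
        approximation error remains.\<close>
      have "norm (adjoint (K \<circ> S k) y - y) \<le> 1 / Suc k" if k: "k > to_nat_on onb y" for k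
      proof -
        have yF: "y \<in> F k" using y k by (simp add: F_def)
        have "(\<Sum>b\<in>F k. (b \<bullet> y) *\<^sub>R b) = (\<Sum>b\<in>F k. if b = y then b else 0)"
        proof (rule sum.cong)
          fix b assume "b \<in> F k"
          then have "b \<in> onb" using F by auto
          from inner_onb[OF is_onb_onb this y] show "(b \<bullet> y) *\<^sub>R b = (if b = y then b else 0)" by simp
        qed simp
        also have "\<dots> = y" using yF fin by (simp add: sum.delta)
        finally have "adjoint (K \<circ> S k) y - y = (\<Sum>b\<in>F k. (K (t k b) \<bullet> y) *\<^sub>R b) - (\<Sum>b\<in>F k. (b \<bullet> y) *\<^sub>R b)"
          by (simp add: adj)
        also have "\<dots> = (\<Sum>b\<in>F k. ((K (t k b) - b) \<bullet> y) *\<^sub>R b)"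
          by (simp add: sum_subtractf inner_diff_left scaleR_left_diff_distrib)
        also have "norm \<dots> \<le> (\<Sum>b\<in>F k. d k)"
        proof (rule sum_norm_le)
          fix b assume "b \<in> F k"
          then have "norm b = 1" using F by (intro norm_onb) auto
          then show "norm (((K (t k b) - b) \<bullet> y) *\<^sub>R b) \<le> d k"
            using Cauchy_Schwarz_ineq2[of "K (t k b) - b" y] t[of k b] norm_onb[OF y] by simp
        qed
        also have "\<dots> \<le> 1 / Suc k" using d(2)[of k] by simp
        finally show ?thesis .
      qed
      then have "\<forall>\<^sub>F k in sequentially. norm (adjoint (K \<circ> S k) y - y) \<le> 1 / Suc k"
        using eventually_gt_at_top by (rule eventually_mono[rotated])
      then have "(\<lambda>k. adjoint (K \<circ> S k) y - y) \<longlonglongrightarrow> 0"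
        by (rule Lim_null_comparison) (use LIMSEQ_inverse_real_of_nat in \<open>simp add: inverse_eq_divide\<close>)
      then show ?thesis by (simp add: LIM_zero_iff)
    qed
  qed
qed

text \<open>The approximants are \<open>tpow (S k) u\<close>. They converge on basis lists by
  multilinear continuity, and their images under \<open>tpow K\<close> have norm at most (1 + 1 / (k
  + 1))^N |u|. This tends to |u| because the degree bound N is fixed, so the convergence is in
  norm.\<close>

lemma tpow_dense:
  fixes K :: "'x::{real_inner, complete_space} \<Rightarrow> 'y::{real_inner, complete_space}"
  assumes K: "bounded_linear K" "closure (range K) = UNIV" and cnt: "countable (onb :: 'y set)"
    and u: "u \<in> fock" "supp_le N u"
  obtains s where "\<And>k::nat. s k \<in> fock_fin" "\<And>k. supp_le N (s k)"
    "(\<lambda>k. fnorm (\<lambda>xs. tpow K (s k) xs - u xs)) \<longlonglongrightarrow> 0"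
proof -
  obtain S :: "nat \<Rightarrow> 'y \<Rightarrow> 'x" where S: "\<And>k. bounded_linear (S k)"
    "\<And>k x. norm (K (S k x)) \<le> (1 + 1 / Suc k) * norm x"
    "\<And>b. b \<in> onb \<Longrightarrow> (\<lambda>k. adjoint (K \<circ> S k) b) \<longlonglongrightarrow> b"
    using approximate_identity[OF K cnt] by blast
  have KS: "bounded_linear (K \<circ> S k)" for k using bounded_linear_compose[OF K(1) S(1)] by (simp add: comp_def)
  show thesis
  proof (rule that[of "\<lambda>k. tpow (S k) u"])
    show "tpow (S k) u \<in> fock_fin" for k using u by (intro tpow_fock_fin S) (auto simp: fock_fin_iff)
    show "supp_le N (tpow (S k) u)" for k by (rule supp_le_tpow[OF u(2)])
    have "(\<lambda>k. fnorm (\<lambda>xs. tpow (K \<circ> S k) u xs - u xs)) \<longlonglongrightarrow> 0"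
    proof (rule fnorm_tendsto_if_pointwise[OF _ u(1)])
      show "tpow (K \<circ> S k) u \<in> fock" "fnorm (tpow (K \<circ> S k) u) \<le> (1 + 1 / Suc k) ^ N * fnorm u" for k
        using tpow_supp_le[OF KS _ _ u, of k "1 + 1 / Suc k"] S(2) by simp_all
      show "(\<lambda>k. tpow (K \<circ> S k) u xs) \<longlonglongrightarrow> u xs" if xs: "xs \<in> lists onb" for xs
      proof -
        have "(\<lambda>k. u (map (adjoint (K \<circ> S k)) xs)) \<longlonglongrightarrow> u (map (\<lambda>x. x) xs)"
          using xs S(3) u(1) by (intro mform_tendsto) (auto simp: fock_def intro: sym_form_mform)
        then show ?thesis by (simp add: tpow_def)
      qed
      have "(\<lambda>k. (1 + 1 / real (Suc k)) ^ N * fnorm u) \<longlonglongrightarrow> (1 + 0) ^ N * fnorm u"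
        by (intro tendsto_intros) (use LIMSEQ_inverse_real_of_nat in \<open>simp add: inverse_eq_divide\<close>)
      then show "(\<lambda>k. (1 + 1 / real (Suc k)) ^ N * fnorm u) \<longlonglongrightarrow> fnorm u" by simp
    qed
    then show "(\<lambda>k. fnorm (\<lambda>xs. tpow K (tpow (S k) u) xs - u xs)) \<longlonglongrightarrow> 0"
      by (simp add: tpow_compose[OF S(1) K(1)])
  qed
qed

text \<open>A summable family has only countably many nonzero terms, and by injectivity no basis
  vector is mapped to zero. Countability of the basis thus comes from the Hilbert-Schmidt
  embedding.\<close>

lemma countable_onb:
  fixes i :: "'x::{real_inner, complete_space} \<Rightarrow> 'y::real_inner"
  assumes q: "quasinuclear i" and inj: "inj i"
  shows "countable (onb :: 'x set)"
proof -
  have "countable {x \<in> (onb :: 'x set). (norm (i x))\<^sup>2 \<noteq> 0}"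
    using q unfolding quasinuclear_def by (intro summable_countable_real) auto
  also have "{x \<in> (onb :: 'x set). (norm (i x))\<^sup>2 \<noteq> 0} = onb"
  proof -
    have "i x \<noteq> 0" if "x \<in> onb" for x
    proof
      assume "i x = 0"
      moreover have "linear i" using q by (simp add: quasinuclear_def bounded_linear.linear)
      ultimately have "x = 0" using inj by (metis injD linear_0)
      then show False using norm_onb[OF that] by simp
    qed
    then show ?thesis by auto
  qed
  finally show ?thesis .
qed

section \<open>Unitary operators and Jacobi matrices\<close>

text \<open>The map c f |-> k f is isometric on the dense range of c, hence extends by uniform
  continuity to the whole space. Density also gives the uniqueness that the definite description
  requires.\<close>

lemma extension_isometry:
  fixes k :: "'p::real_inner \<Rightarrow> 'h::{real_inner, complete_space}" and c :: "'p \<Rightarrow> 't::{real_inner, complete_space}"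
  assumes c: "completion_map k c" and k: "linear k"
  shows "bounded_linear (extension k c)" "extension k c (c f) = k f" "norm (extension k c x) = norm x"
proof -
  have lc: "linear c" and ic: "\<And>f g. c f \<bullet> c g = k f \<bullet> k g" and dc: "closure (range c) = UNIV"
    using c unfolding completion_map_def by blast+
  have nc: "norm (c f) = norm (k f)" for f by (simp add: norm_eq_sqrt_inner ic)
  have dist: "dist (k f) (k f') = dist (c f) (c f')" for f f'
    using nc[of "f - f'"] by (simp add: dist_norm linear_diff[OF lc] linear_diff[OF k])
  \<comment> \<open>The choice of the preimage is immaterial: by \<open>dist\<close>, two vectors
    with the same image under c have the same image under k.\<close>
  define g0 where "g0 y = k (SOME f. c f = y)" for y
  have g0: "g0 (c f) = k f" for f
  proof -
    have "c (SOME f'. c f' = c f) = c f" by (rule someI[of _ f]) simp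
    then have "dist (g0 (c f)) (k f) = 0" unfolding g0_def dist by simp
    then show ?thesis by simp
  qed
  have "uniformly_continuous_on (range c) g0"
    unfolding uniformly_continuous_on_def
  proof (intro allI impI)
    fix e :: real assume "e > 0"
    then show "\<exists>d>0. \<forall>x\<in>range c. \<forall>x'\<in>range c. dist x' x < d \<longrightarrow> dist (g0 x') (g0 x) < e"
      by (intro exI[of _ e]) (auto simp: g0 dist)
  qed
  then obtain L where
    L: "uniformly_continuous_on (closure (range c)) L" "\<And>x. x \<in> range c \<Longrightarrow> g0 x = L x"
    by (rule uniformly_continuous_on_extension_on_closure) (rule that)
  have cont: "continuous_on UNIV L" using uniformly_continuous_imp_continuous[OF L(1)] dc by simp
  have Lc: "L (c f) = k f" for f using L(2)[of "c f"] g0[of f] by simp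
  have lim: "(\<lambda>n. L (s n)) \<longlonglongrightarrow> L x" if "s \<longlonglongrightarrow> x" for s x
    using continuous_on_tendsto_compose[OF cont that] by simp
  have ap: "\<exists>f. (\<lambda>n. c (f n)) \<longlonglongrightarrow> x" for x
  proof -
    have "x \<in> closure (range c)" using dc by simp
    then obtain s where s: "\<forall>n. s n \<in> range c" "s \<longlonglongrightarrow> x" unfolding closure_sequential by blast
    from s(1) have "\<forall>n. \<exists>f. s n = c f" by blast
    from choice[OF this] obtain f where "\<forall>n. s n = c (f n)" by blast
    then have "s = (\<lambda>n. c (f n))" by (intro ext) simp
    with s(2) have "(\<lambda>n. c (f n)) \<longlonglongrightarrow> x" by simp
    then show ?thesis by blast
  qed
  have nL: "norm (L x) = norm x" for x
  proof -
    obtain f where f: "(\<lambda>n. c (f n)) \<longlonglongrightarrow> x" using ap by blast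
    show ?thesis
      using LIMSEQ_unique[OF tendsto_norm[OF lim[OF f]]] tendsto_norm[OF f] by (simp add: Lc nc)
  qed
  have bL: "bounded_linear L"
  proof (rule bounded_linear_intro)
    fix x y
    obtain f g where fg: "(\<lambda>n. c (f n)) \<longlonglongrightarrow> x" "(\<lambda>n. c (g n)) \<longlonglongrightarrow> y" using ap[of x] ap[of y] by blast
    have "(\<lambda>n. L (c (f n + g n))) \<longlonglongrightarrow> L (x + y)"
      by (rule lim) (simp add: linear_add[OF lc] tendsto_add fg)
    moreover have "(\<lambda>n. L (c (f n + g n))) \<longlonglongrightarrow> L x + L y"
      using tendsto_add[OF lim[OF fg(1)] lim[OF fg(2)]] by (simp add: Lc linear_add[OF k])
    ultimately show "L (x + y) = L x + L y" by (rule LIMSEQ_unique)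
    fix r
    have "(\<lambda>n. L (c (r *\<^sub>R f n))) \<longlonglongrightarrow> L (r *\<^sub>R x)"
      by (rule lim) (simp add: linear_scale[OF lc] tendsto_scaleR fg)
    moreover have "(\<lambda>n. L (c (r *\<^sub>R f n))) \<longlonglongrightarrow> r *\<^sub>R L x"
      using tendsto_scaleR[OF tendsto_const lim[OF fg(1)], of r] by (simp add: Lc linear_scale[OF k])
    ultimately show "L (r *\<^sub>R x) = r *\<^sub>R L x" by (rule LIMSEQ_unique)
    show "norm (L x) \<le> norm x * 1" by (simp add: nL)
  qed
  have "extension k c = L"
    unfolding extension_def
  proof (rule the_equality)
    show "bounded_linear L \<and> (\<forall>f. L (c f) = k f)" using bL Lc by blast
    fix M assume M: "bounded_linear M \<and> (\<forall>f. M (c f) = k f)"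
    show "M = L"
    proof
      fix x
      obtain f where f: "(\<lambda>n. c (f n)) \<longlonglongrightarrow> x" using ap by blast
      have "(\<lambda>n. M (c (f n))) \<longlonglongrightarrow> M x" using M f bounded_linear.tendsto by blast
      moreover have "(\<lambda>n. M (c (f n))) \<longlonglongrightarrow> L x" using lim[OF f] M by (simp add: Lc)
      ultimately show "M x = L x" by (rule LIMSEQ_unique)
    qed
  qed
  then show "bounded_linear (extension k c)" "extension k c (c f) = k f" "norm (extension k c x) = norm x"
    using bL Lc nL by simp_all
qed

text \<open>An isometry reflects Cauchy sequences, so by completeness of the domain its dense range
  is everything.\<close>

lemma extension_surj:
  fixes k :: "'p::real_inner \<Rightarrow> 'h::{real_inner, complete_space}" and c :: "'p \<Rightarrow> 't::{real_inner, complete_space}"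
  assumes c: "completion_map k c" and k: "linear k" and dense: "closure (range k) = UNIV"
  shows "surj (extension k c)"
proof -
  let ?L = "extension k c"
  note L = extension_isometry[OF c k]
  have "\<exists>x. y = ?L x" for y
  proof -
    have "y \<in> closure (range k)" using dense by simp
    then obtain s where s: "\<forall>n. s n \<in> range k" "s \<longlonglongrightarrow> y" unfolding closure_sequential by blast
    from s(1) have "\<forall>n. \<exists>f. s n = k f" by blast
    from choice[OF this] obtain f where f: "\<And>n. s n = k (f n)" by blast
    have "dist (c (f m)) (c (f n)) = dist (s m) (s n)" for m n
      using L(3)[of "c (f m) - c (f n)"]
      by (simp add: f dist_norm linear_diff[OF bounded_linear.linear[OF L(1)]] L(2))
    then have "Cauchy (\<lambda>n. c (f n))"
      using LIMSEQ_imp_Cauchy[OF s(2)] by (simp add: Cauchy_def)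
    then obtain x where "(\<lambda>n. c (f n)) \<longlonglongrightarrow> x" using Cauchy_convergent convergent_def by blast
    from bounded_linear.tendsto[OF L(1) this] have "s \<longlonglongrightarrow> ?L x" by (simp add: L(2) f[symmetric])
    then show ?thesis using s(2) LIMSEQ_unique by blast
  qed
  then show ?thesis by (auto simp: surj_def)
qed

section \<open>Unitary operators and conjugated adjoints\<close>

locale unitary =
  fixes U :: "'t::{real_inner, complete_space} \<Rightarrow> 'h::{real_inner, complete_space}"
  assumes lin: "bounded_linear U" and isometry: "\<And>x. norm (U x) = norm x" and surj: "surj U"
begin

text \<open>Polarisation turns preservation of norms into preservation of inner products.\<close>

lemma adjoint_U: "adjoint U (U x) = x"
proof (rule vector_eq_rdot[THEN iffD1, rule_format])
  fix y
  have "adjoint U (U x) \<bullet> y = U x \<bullet> U y"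
    by (simp add: inner_commute[of _ y] adjoint_works_hilbert[OF lin, symmetric]) (simp add: inner_commute)
  also have "\<dots> = x \<bullet> y"
    by (simp add: dot_norm linear_add[OF bounded_linear.linear[OF lin], symmetric] isometry)
  finally show "adjoint U (U x) \<bullet> y = x \<bullet> y" .
qed

lemma U_adjoint: "U (adjoint U y) = y"
  using surj adjoint_U by (metis surj_def)

lemma norm_adjoint_U: "norm (adjoint U y) = norm y"
  using isometry[of "adjoint U y"] by (simp add: U_adjoint)

lemma tpow_adjoint_U: "tpow (adjoint U) (tpow U u) = u"
  using tpow_compose[OF lin bounded_linear_adjoint[OF lin], of u] by (simp add: comp_def adjoint_U tpow_ident)

lemma tpow_U_adjoint: "tpow U (tpow (adjoint U) u) = u"
  using tpow_compose[OF bounded_linear_adjoint[OF lin] lin, of u] by (simp add: comp_def U_adjoint tpow_ident)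

lemma tpow_U_fock: "u \<in> fock \<Longrightarrow> tpow U u \<in> fock"
  by (rule tpow_contraction(1)[OF lin]) (simp_all add: isometry)

lemma tpow_adjoint_fock: "u \<in> fock \<Longrightarrow> tpow (adjoint U) u \<in> fock"
  by (rule tpow_contraction(1)[OF bounded_linear_adjoint[OF lin]]) (simp_all add: norm_adjoint_U)

lemma fnorm_tpow_U:
  assumes u: "u \<in> fock" shows "fnorm (tpow U u) = fnorm u"
proof (rule antisym)
  show "fnorm (tpow U u) \<le> fnorm u" by (rule tpow_contraction(2)[OF lin _ u]) (simp add: isometry)
  have "fnorm (tpow (adjoint U) (tpow U u)) \<le> fnorm (tpow U u)"
    by (rule tpow_contraction(2)[OF bounded_linear_adjoint[OF lin] _ tpow_U_fock[OF u]]) (simp add: norm_adjoint_U)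
  then show "fnorm u \<le> fnorm (tpow U u)" by (simp add: tpow_adjoint_U)
qed

lemma fnorm_tpow_U_diff:
  "u \<in> fock \<Longrightarrow> v \<in> fock \<Longrightarrow> fnorm (\<lambda>xs. tpow U u xs - tpow U v xs) = fnorm (\<lambda>xs. u xs - v xs)"
  using fnorm_tpow_U[OF fock_diff] by (simp add: tpow_diff)

lemma fip_tpow_U: "u \<in> fock_n n \<Longrightarrow> v \<in> fock_n n \<Longrightarrow> fip (tpow U u) (tpow U v) = fip u v"
  by (simp add: fip_tpow[OF lin _ tpow_fock_n[OF lin]] tpow_adjoint_U)

text \<open>Conjugation by a unitary commutes with taking adjoints: test pairs of
  \<open>pull U A\<close> and of \<open>A\<close> correspond under \<open>tpow U\<close>, which
  preserves \<open>fip\<close> in each degree. It is needed because the lower diagonal of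
  \<open>J_K\<close> is the adjoint of a conjugated operator, while the hypotheses concern the
  adjoint of the original one.\<close>

lemma adj_op_pull:
  assumes A: "A \<subseteq> fock_n n \<times> fock_n m" and u: "u \<in> fock_n m" and z: "z \<in> fock_n n"
  shows "(u, z) \<in> adj_op (fock_n n) (fock_n m) (pull U A)
    \<longleftrightarrow> (tpow U u, tpow U z) \<in> adj_op (fock_n n) (fock_n m) A"
proof
  have tU: "tpow U w \<in> fock_n k" if "w \<in> fock_n k" for w k using that by (rule tpow_fock_n[OF lin])
  have tA: "tpow (adjoint U) w \<in> fock_n k" if "w \<in> fock_n k" for w k
    using that by (rule tpow_fock_n[OF bounded_linear_adjoint[OF lin]])
  assume L: "(u, z) \<in> adj_op (fock_n n) (fock_n m) (pull U A)"
  have "fip y (tpow U u) = fip x (tpow U z)" if "(x, y) \<in> A" for x y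
  proof -
    have x: "x \<in> fock_n n" and y: "y \<in> fock_n m" using A that by auto
    let ?x = "tpow (adjoint U) x" and ?y = "tpow (adjoint U) y"
    have "(?x, ?y) \<in> pull U A"
      using that tA[OF x] tA[OF y] by (simp add: pull_def tpow_U_adjoint fock_n_iff)
    then have "fip ?y u = fip ?x z" using L unfolding adj_op_def by blast
    then show ?thesis
      using fip_tpow_U[OF tA[OF x] z] fip_tpow_U[OF tA[OF y] u] by (simp add: tpow_U_adjoint)
  qed
  then show "(tpow U u, tpow U z) \<in> adj_op (fock_n n) (fock_n m) A"
    using tU[OF u] tU[OF z] unfolding adj_op_def by blast
next
  assume R: "(tpow U u, tpow U z) \<in> adj_op (fock_n n) (fock_n m) A"
  have "fip y u = fip x z" if "(x, y) \<in> pull U A" for x y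
  proof -
    have xy: "(tpow U x, tpow U y) \<in> A" "x \<in> fock" "y \<in> fock" using that by (auto simp: pull_def)
    then have "tpow U x \<in> fock_n n" "tpow U y \<in> fock_n m" using A by auto
    then have x: "x \<in> fock_n n" and y: "y \<in> fock_n m"
      using tpow_fock_n[OF bounded_linear_adjoint[OF lin]] tpow_adjoint_U by metis+
    show ?thesis
      using R xy(1) fip_tpow_U[OF x z] fip_tpow_U[OF y u] unfolding adj_op_def by auto
  qed
  then show "(u, z) \<in> adj_op (fock_n n) (fock_n m) (pull U A)"
    using u z unfolding adj_op_def by blast
qed

end

text \<open>Images of the single components, all taken in the positive space, add up to a finite
  vector there with an explicit norm bound. With e = c this shows that the transformed matrix is
  defined on every finite vector; with e = i it yields the continuity estimate.\<close>

lemma jacobi_assemble: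
  fixes e :: "'p::{real_inner, complete_space} \<Rightarrow> 'x::{real_inner, complete_space}"
  assumes e: "bounded_linear e" and F: "F \<in> fock" "supp_le N F"
    and x: "\<And>n. x n \<in> fock_n (Suc n)" "\<And>n. (tpow e (level n F), tpow e (x n)) \<in> A n" "\<And>n. n > N \<Longrightarrow> x n = (\<lambda>_. 0)"
    and y: "\<And>n. y n \<in> fock_n n" "\<And>n. (tpow e (level n F), tpow e (y n)) \<in> B n" "\<And>n. n > N \<Longrightarrow> y n = (\<lambda>_. 0)"
    and z: "\<And>n. z n \<in> fock_n n"
      "\<And>n. (tpow e (level (Suc n) F), tpow e (z n)) \<in> adj_op (fock_n n) (fock_n (Suc n)) (A n)"
      "\<And>n. n > N \<Longrightarrow> z n = (\<lambda>_. 0)"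
  obtains G where "G \<in> fock_fin" "(tpow e F, tpow e G) \<in> jacobi_op e A B"
    "fnorm G \<le> (\<Sum>n\<le>Suc N. (case n of 0 \<Rightarrow> 0 | Suc m \<Rightarrow> fnorm (x m)) + fnorm (y n) + fnorm (z n))"
proof -
  \<comment> \<open>Shifted by one, since the image of the degree m component under
    \<open>A m\<close> has degree m + 1.\<close>
  define x' where "x' n = (case n of 0 \<Rightarrow> (\<lambda>_. 0) | Suc m \<Rightarrow> x m)" for n
  have x': "x' n \<in> fock_n n" for n by (auto simp: x'_def zero_fock_n x split: nat.split)
  have nx': "fnorm (x' n) = (case n of 0 \<Rightarrow> 0 | Suc m \<Rightarrow> fnorm (x m))" for n
    by (auto simp: x'_def fnorm_def split: nat.split)
  define W where "W n = (\<lambda>xs. x' n xs + y n xs + z n xs)" for n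
  have f: "x' n \<in> fock" "y n \<in> fock" "z n \<in> fock" for n using x' y(1) z(1) by (auto simp: fock_n_iff)
  have W: "W n \<in> fock" for n unfolding W_def by (intro fock_add f)
  have W0: "W n xs = 0" if "length xs \<noteq> n" for n xs
    using that x' y(1) z(1) by (auto simp: W_def fock_n_iff)
  \<comment> \<open>The raising part can still fill degree N + 1; beyond it everything
    vanishes.\<close>
  have WN: "W n = (\<lambda>_. 0)" if "n > Suc N" for n
    using that x(3) y(3) z(3) by (cases n) (auto simp: W_def x'_def)
  define G where "G = (\<lambda>xs. \<Sum>n\<le>Suc N. W n xs)"
  have G_W: "G xs = W (length xs) xs" for xs
  proof (cases "length xs \<le> Suc N")
    case True
    have "G xs = (\<Sum>n\<in>{length xs}. W n xs)"
      unfolding G_def by (rule sum.mono_neutral_right) (use True W0 in auto)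
    then show ?thesis by simp
  next
    case False
    then have "G xs = 0" unfolding G_def by (intro sum.neutral) (auto intro: W0)
    then show ?thesis using WN False by simp
  qed
  have lG: "level n G = W n" for n
    by (rule ext) (auto simp: level_def G_W W0)
  have "G \<in> fock" unfolding G_def by (rule fock_sum) (rule W)
  then have Gf: "G \<in> fock_fin" by (auto simp: fock_fin_def G_W WN intro!: exI[of _ "Suc N"])
  have "fnorm G \<le> (\<Sum>n\<le>Suc N. fnorm (W n))" unfolding G_def by (rule fock_sum) (rule W)
  also have "\<dots> \<le> (\<Sum>n\<le>Suc N. (case n of 0 \<Rightarrow> 0 | Suc m \<Rightarrow> fnorm (x m)) + fnorm (y n) + fnorm (z n))"
  proof (rule sum_mono)
    fix n
    have "fnorm (W n) \<le> fnorm (x' n) + fnorm (y n) + fnorm (z n)"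
      unfolding W_def using fnorm_add_le(2)[OF fock_add[OF f(1,2)] f(3)] fnorm_add_le(2)[OF f(1,2)]
      by (rule order_trans[OF _ add_right_mono])
    then show "fnorm (W n) \<le> (case n of 0 \<Rightarrow> 0 | Suc m \<Rightarrow> fnorm (x m)) + fnorm (y n) + fnorm (z n)"
      by (simp only: nx')
  qed
  finally have nG: "fnorm G \<le> (\<Sum>n\<le>Suc N. (case n of 0 \<Rightarrow> 0 | Suc m \<Rightarrow> fnorm (x m)) + fnorm (y n) + fnorm (z n))" .
  have "(tpow e F, tpow e G) \<in> jacobi_op e A B"
    unfolding jacobi_op_def
  proof (intro CollectI case_prodI conjI allI)
    show "tpow e F \<in> tpow e ` fock_fin" using F by (intro imageI) (auto simp: fock_fin_iff)
    show "tpow e G \<in> fock" using tpow_fock_fin[OF e Gf] by (simp add: fock_fin_iff)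
    fix n
    have "case n of 0 \<Rightarrow> tpow e (x' n) = (\<lambda>_. 0) | Suc m \<Rightarrow> (level m (tpow e F), tpow e (x' n)) \<in> A m"
      by (cases n) (simp_all add: x'_def tpow_0 level_tpow x(2))
    moreover have "level n (tpow e G) = (\<lambda>xs. tpow e (x' n) xs + tpow e (y n) xs + tpow e (z n) xs)"
      unfolding level_tpow lG W_def by (simp add: tpow_def)
    ultimately show "\<exists>x y z. (case n of 0 \<Rightarrow> x = (\<lambda>_. 0) | Suc m \<Rightarrow> (level m (tpow e F), x) \<in> A m) \<and>
        (level n (tpow e F), y) \<in> B n \<and>
        (level (Suc n) (tpow e F), z) \<in> adj_op (fock_n n) (fock_n (Suc n)) (A n) \<and>
        level n (tpow e G) = (\<lambda>xs. x xs + y xs + z xs)"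
      by (intro exI[of _ "tpow e (x' n)"] exI[of _ "tpow e (y n)"] exI[of _ "tpow e (z n)"])
        (simp add: level_tpow y(2) z(2))
  qed
  from that[OF Gf this nG] show thesis .
qed

section \<open>Differences in operator graphs, and closures\<close>

lemma fip_diff_right:
  assumes "u \<in> fock" "v \<in> fock" "w \<in> fock"
  shows "fip u (\<lambda>xs. v xs - w xs) = fip u v - fip u w"
proof -
  have s: "(\<lambda>xs. u xs * cnj (v xs)) summable_on lists onb" if "v \<in> fock" for v
    using assms(1) that by (intro summable_mult_cnj) (auto simp: fock_def)
  have "(\<Sum>\<^sub>\<infinity>xs\<in>lists onb. u xs * cnj (v xs) + - (u xs * cnj (w xs)))
      = (\<Sum>\<^sub>\<infinity>xs\<in>lists onb. u xs * cnj (v xs)) + (\<Sum>\<^sub>\<infinity>xs\<in>lists onb. - (u xs * cnj (w xs)))"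
    by (intro infsum_add s assms summable_on_uminus[THEN iffD2])
  then show ?thesis unfolding fip_def by (simp add: algebra_simps infsum_uminus)
qed

lemma adj_op_diff:
  assumes A: "A \<subseteq> fock_n n \<times> fock_n m"
    and 1: "(u, z) \<in> adj_op (fock_n n) (fock_n m) A" and 2: "(u', z') \<in> adj_op (fock_n n) (fock_n m) A"
  shows "((\<lambda>xs. u xs - u' xs), (\<lambda>xs. z xs - z' xs)) \<in> adj_op (fock_n n) (fock_n m) A"
proof -
  have d: "(\<lambda>xs. u xs - u' xs) \<in> fock_n k" if "u \<in> fock_n k" "u' \<in> fock_n k" for u u' :: "'a fvec" and k
    using that by (auto simp: fock_n_iff fock_diff)
  have m: "u \<in> fock_n m" "u' \<in> fock_n m" "z \<in> fock_n n" "z' \<in> fock_n n"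
    using 1 2 by (auto simp: adj_op_def)
  have "fip y (\<lambda>xs. u xs - u' xs) = fip x (\<lambda>xs. z xs - z' xs)" if xy: "(x, y) \<in> A" for x y
  proof -
    have f: "x \<in> fock" "y \<in> fock" using A xy by (auto simp: fock_n_iff)
    have "fip y u = fip x z" "fip y u' = fip x z'" using 1 2 xy by (auto simp: adj_op_def)
    then show ?thesis using f m by (simp add: fip_diff_right fock_n_iff)
  qed
  then show ?thesis using d m unfolding adj_op_def by blast
qed

lemma lin_op_diff:
  assumes A: "lin_op V W A" and "(u, v) \<in> A" "(u', v') \<in> A"
  shows "((\<lambda>xs. u xs - u' xs), (\<lambda>xs. v xs - v' xs)) \<in> A"
proof -
  have "\<forall>(u, v)\<in>A. \<forall>(u', v')\<in>A. \<forall>c. (\<lambda>xs. u xs + c * u' xs, \<lambda>xs. v xs + c * v' xs) \<in> A"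
    using A unfolding lin_op_def by blast
  then have "(\<lambda>xs. u xs + (-1) * u' xs, \<lambda>xs. v xs + (-1) * v' xs) \<in> A" using assms(2,3) by blast
  then show ?thesis by simp
qed

lemma jacobi_opD:
  assumes "(u, v) \<in> jacobi_op e A B"
  shows "u \<in> tpow e ` fock_fin" "v \<in> fock"
    "\<exists>x y z. (case n of 0 \<Rightarrow> x = (\<lambda>_. 0) | Suc m \<Rightarrow> (level m u, x) \<in> A m) \<and>
       (level n u, y) \<in> B n \<and> (level (Suc n) u, z) \<in> adj_op (fock_n n) (fock_n (Suc n)) (A n) \<and>
       level n v = (\<lambda>xs. x xs + y xs + z xs)"
proof -
  note d = assms[unfolded jacobi_op_def mem_Collect_eq prod.case]
  show "u \<in> tpow e ` fock_fin" by (rule d[THEN conjunct1])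
  show "v \<in> fock" by (rule d[THEN conjunct2, THEN conjunct1])
  show "\<exists>x y z. (case n of 0 \<Rightarrow> x = (\<lambda>_. 0) | Suc m \<Rightarrow> (level m u, x) \<in> A m) \<and>
       (level n u, y) \<in> B n \<and> (level (Suc n) u, z) \<in> adj_op (fock_n n) (fock_n (Suc n)) (A n) \<and>
       level n v = (\<lambda>xs. x xs + y xs + z xs)"
    by (rule d[THEN conjunct2, THEN conjunct2, THEN spec])
qed

text \<open>This allows the images of a vector and of its approximant to be compared by applying a
  continuity estimate to their difference.\<close>

lemma jacobi_op_diff:
  fixes e :: "'p::{real_inner, complete_space} \<Rightarrow> 'x::{real_inner, complete_space}"
  assumes A: "\<And>n. lin_op (fock_n n) (fock_n (Suc n)) (A n)" and B: "\<And>n. lin_op (fock_n n) (fock_n n) (B n)"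
    and 1: "(u, v) \<in> jacobi_op e A B" and 2: "(u', v') \<in> jacobi_op e A B"
  shows "((\<lambda>xs. u xs - u' xs), (\<lambda>xs. v xs - v' xs)) \<in> jacobi_op e A B"
  unfolding jacobi_op_def
proof (intro CollectI case_prodI conjI allI)
  note d1 = jacobi_opD[OF 1] and d2 = jacobi_opD[OF 2]
  obtain F F' where F: "F \<in> fock_fin" "u = tpow e F" "F' \<in> fock_fin" "u' = tpow e F'" using d1(1) d2(1) by blast
  obtain N N' where N: "supp_le N F" "supp_le N' F'" using F by (auto simp: fock_fin_iff)
  have "supp_le (max N N') F" "supp_le (max N N') F'" using N by (auto intro: supp_le_mono)
  then have "supp_le (max N N') (\<lambda>xs. F xs - F' xs)" by (simp add: supp_le_def)
  then have "(\<lambda>xs. F xs - F' xs) \<in> fock_fin" using F by (auto simp: fock_fin_iff fock_diff)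
  then show "(\<lambda>xs. u xs - u' xs) \<in> tpow e ` fock_fin" unfolding F(2,4) tpow_diff[symmetric] by (rule imageI)
  show "(\<lambda>xs. v xs - v' xs) \<in> fock" by (rule fock_diff[OF d1(2) d2(2)])
  fix n
  have lev: "level k (\<lambda>xs. w xs - w' xs) = (\<lambda>xs. level k w xs - level k w' xs)" for k and w w' :: "'x fvec"
    by (auto simp: level_def)
  obtain x y z where xyz: "case n of 0 \<Rightarrow> x = (\<lambda>_. 0) | Suc m \<Rightarrow> (level m u, x) \<in> A m"
      "(level n u, y) \<in> B n" "(level (Suc n) u, z) \<in> adj_op (fock_n n) (fock_n (Suc n)) (A n)"
      "level n v = (\<lambda>xs. x xs + y xs + z xs)" using d1(3)[of n] by blast
  obtain x' y' z' where xyz': "case n of 0 \<Rightarrow> x' = (\<lambda>_. 0) | Suc m \<Rightarrow> (level m u', x') \<in> A m"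
      "(level n u', y') \<in> B n" "(level (Suc n) u', z') \<in> adj_op (fock_n n) (fock_n (Suc n)) (A n)"
      "level n v' = (\<lambda>xs. x' xs + y' xs + z' xs)" using d2(3)[of n] by blast
  have AA: "A n \<subseteq> fock_n n \<times> fock_n (Suc n)" using A unfolding lin_op_def by blast
  have "case n of 0 \<Rightarrow> (\<lambda>xs. x xs - x' xs) = (\<lambda>_. 0)
      | Suc m \<Rightarrow> (level m (\<lambda>xs. u xs - u' xs), (\<lambda>xs. x xs - x' xs)) \<in> A m"
  proof (cases n)
    case (Suc m)
    with xyz(1) xyz'(1) have "(level m u, x) \<in> A m" "(level m u', x') \<in> A m" by simp_all
    from lin_op_diff[OF A this] show ?thesis by (simp add: Suc lev)
  qed (use xyz(1) xyz'(1) in simp)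
  moreover have "(level n (\<lambda>xs. u xs - u' xs), (\<lambda>xs. y xs - y' xs)) \<in> B n"
    unfolding lev by (rule lin_op_diff[OF B xyz(2) xyz'(2)])
  moreover have "(level (Suc n) (\<lambda>xs. u xs - u' xs), (\<lambda>xs. z xs - z' xs)) \<in> adj_op (fock_n n) (fock_n (Suc n)) (A n)"
    unfolding lev by (rule adj_op_diff[OF AA xyz(3) xyz'(3)])
  moreover have "level n (\<lambda>xs. v xs - v' xs) = (\<lambda>xs. (x xs - x' xs) + (y xs - y' xs) + (z xs - z' xs))"
    unfolding lev xyz(4) xyz'(4) by (simp add: algebra_simps)
  ultimately show "\<exists>x y z. (case n of 0 \<Rightarrow> x = (\<lambda>_. 0) | Suc m \<Rightarrow> (level m (\<lambda>xs. u xs - u' xs), x) \<in> A m) \<and>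
        (level n (\<lambda>xs. u xs - u' xs), y) \<in> B n \<and>
        (level (Suc n) (\<lambda>xs. u xs - u' xs), z) \<in> adj_op (fock_n n) (fock_n (Suc n)) (A n) \<and>
        level n (\<lambda>xs. v xs - v' xs) = (\<lambda>xs. x xs + y xs + z xs)" by blast
qed

lemma cl_opI:
  assumes "u \<in> fock" "v \<in> fock" "\<And>k::nat. (s k, t k) \<in> A"
    "(\<lambda>k. fnorm (\<lambda>xs. s k xs - u xs)) \<longlonglongrightarrow> 0" "(\<lambda>k. fnorm (\<lambda>xs. t k xs - v xs)) \<longlonglongrightarrow> 0"
  shows "(u, v) \<in> cl_op A"
  unfolding cl_op_def using assms by blast

lemma cl_op_subset: "A \<subseteq> fock \<times> fock \<Longrightarrow> A \<subseteq> cl_op A"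
proof
  fix p assume A: "A \<subseteq> fock \<times> fock" and p: "p \<in> A"
  obtain u v where uv: "p = (u, v)" by (cases p)
  show "p \<in> cl_op A" unfolding uv
    by (rule cl_opI[of _ _ "\<lambda>_. u" "\<lambda>_. v"]) (use A p uv in \<open>auto simp: fnorm_def\<close>)
qed

text \<open>Approximating the k-th term of a sequence in A within 1 / (k + 1) gives a sequence in A'
  with the same limits. Hence the closure of A lies in that of A' although A itself need not be
  contained in A'.\<close>

lemma cl_op_approx:
  assumes uv: "(u, v) \<in> cl_op A" and A: "A \<subseteq> fock \<times> fock" and A': "A' \<subseteq> fock \<times> fock"
    and ap: "\<And>s t e. (s, t) \<in> A \<Longrightarrow> e > 0 \<Longrightarrow>
      \<exists>s' t'. (s', t') \<in> A' \<and> fnorm (\<lambda>xs. s' xs - s xs) < e \<and> fnorm (\<lambda>xs. t' xs - t xs) < e"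
  shows "(u, v) \<in> cl_op A'"
proof -
  obtain s t where st: "\<And>k::nat. (s k, t k) \<in> A" "(\<lambda>k. fnorm (\<lambda>xs. s k xs - u xs)) \<longlonglongrightarrow> 0"
    "(\<lambda>k. fnorm (\<lambda>xs. t k xs - v xs)) \<longlonglongrightarrow> 0" and uf: "u \<in> fock" "v \<in> fock"
    using uv unfolding cl_op_def by blast
  have "\<exists>p. p \<in> A' \<and> fnorm (\<lambda>xs. fst p xs - s k xs) < 1 / Suc k \<and> fnorm (\<lambda>xs. snd p xs - t k xs) < 1 / Suc k" for k
    using ap[OF st(1), of "1 / Suc k"] by auto
  then obtain p where p: "\<And>k. p k \<in> A'" "\<And>k. fnorm (\<lambda>xs. fst (p k) xs - s k xs) < 1 / Suc k"
    "\<And>k. fnorm (\<lambda>xs. snd (p k) xs - t k xs) < 1 / Suc k" by metis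
  have f: "s k \<in> fock" "t k \<in> fock" "fst (p k) \<in> fock" "snd (p k) \<in> fock" for k
    using A st(1)[of k] A' p(1)[of k] by auto
  have inv: "(\<lambda>k. 1 / real (Suc k)) \<longlonglongrightarrow> 0" using LIMSEQ_inverse_real_of_nat by (simp add: inverse_eq_divide)
  have "(\<lambda>k. fnorm (\<lambda>xs. fst (p k) xs - u xs)) \<longlonglongrightarrow> 0"
  proof (rule Lim_null_comparison[OF always_eventually])
    show "(\<lambda>k. 1 / real (Suc k) + fnorm (\<lambda>xs. s k xs - u xs)) \<longlonglongrightarrow> 0" using tendsto_add[OF inv st(2)] by simp
    show "\<forall>k. norm (fnorm (\<lambda>xs. fst (p k) xs - u xs)) \<le> 1 / real (Suc k) + fnorm (\<lambda>xs. s k xs - u xs)"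
    proof
      fix k
      show "norm (fnorm (\<lambda>xs. fst (p k) xs - u xs)) \<le> 1 / real (Suc k) + fnorm (\<lambda>xs. s k xs - u xs)"
        using fnorm_diff_triangle[OF f(3)[of k] f(1)[of k] uf(1)] p(2)[of k] fnorm_nonneg[of "\<lambda>xs. fst (p k) xs - u xs"] by simp
    qed
  qed
  moreover have "(\<lambda>k. fnorm (\<lambda>xs. snd (p k) xs - v xs)) \<longlonglongrightarrow> 0"
  proof (rule Lim_null_comparison[OF always_eventually])
    show "(\<lambda>k. 1 / real (Suc k) + fnorm (\<lambda>xs. t k xs - v xs)) \<longlonglongrightarrow> 0" using tendsto_add[OF inv st(3)] by simp
    show "\<forall>k. norm (fnorm (\<lambda>xs. snd (p k) xs - v xs)) \<le> 1 / real (Suc k) + fnorm (\<lambda>xs. t k xs - v xs)"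
    proof
      fix k
      show "norm (fnorm (\<lambda>xs. snd (p k) xs - v xs)) \<le> 1 / real (Suc k) + fnorm (\<lambda>xs. t k xs - v xs)"
        using fnorm_diff_triangle[OF f(4)[of k] f(2)[of k] uf(2)] p(3)[of k] fnorm_nonneg[of "\<lambda>xs. snd (p k) xs - v xs"] by simp
    qed
  qed
  ultimately show ?thesis
    by (intro cl_opI[of _ _ "\<lambda>k. fst (p k)" "\<lambda>k. snd (p k)"] uf) (simp_all add: p(1))
qed

section \<open>Transport of the Jacobi operators\<close>

text \<open>The parameter f is fixed, and A, B stand for the entries at \<open>K f\<close>.
  Single-valuedness of the matrix is an assumption because \<open>adj_op\<close> is a relation,
  which is a function only for an operator with dense domain.\<close>

locale jacobi_transport = unitary U
  for U :: "'t::{real_inner, complete_space} \<Rightarrow> 'h::{real_inner, complete_space}" +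
  fixes i :: "'hp::{real_inner, complete_space} \<Rightarrow> 'h"
    and K :: "'tp::{real_inner, complete_space} \<Rightarrow> 'hp"
    and c :: "'tp \<Rightarrow> 't"
    and A B :: "nat \<Rightarrow> 'h fop"
  assumes i: "bounded_linear i" "\<And>\<phi>. norm (i \<phi>) \<le> norm \<phi>"
    and K: "bounded_linear K" "closure (range K) = UNIV"
    and c: "bounded_linear c" and Uc: "U \<circ> c = i \<circ> K"
    and countable: "countable (onb :: 'hp set)"
    and lin_A: "\<And>n. lin_op (fock_n n) (fock_n (Suc n)) (A n)"
    and lin_B: "\<And>n. lin_op (fock_n n) (fock_n n) (B n)"
    and acts_A: "\<And>n. acts_continuously i n (Suc n) (A n)"
    and acts_B: "\<And>n. acts_continuously i n n (B n)"
    and acts_adj: "\<And>n. acts_continuously i (Suc n) n (adj_op (fock_n n) (fock_n (Suc n)) (A n))"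
    and maps_A: "\<And>n. maps_into i (A n) (tpow K ` fock_n n) (tpow K ` fock_n (Suc n))"
    and maps_B: "\<And>n. maps_into i (B n) (tpow K ` fock_n n) (tpow K ` fock_n n)"
    and maps_adj: "\<And>n. maps_into i (adj_op (fock_n n) (fock_n (Suc n)) (A n)) (tpow K ` fock_n (Suc n)) (tpow K ` fock_n n)"
    and single_valued: "single_valued (jacobi_op i A B)"
begin

definition J where "J = jacobi_op i A B"
definition JK where "JK = jacobi_op c (\<lambda>n. pull U (A n)) (\<lambda>n. pull U (B n))"

lemma tpow_Uc: "tpow U (tpow c u) = tpow i (tpow K u)"
  by (simp add: tpow_compose[OF c lin] tpow_compose[OF K(1) i(1)] Uc)

lemma A_subset: "A n \<subseteq> fock_n n \<times> fock_n (Suc n)"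
  using lin_A unfolding lin_op_def by blast

lemma zero_A: "((\<lambda>_. 0), (\<lambda>_. 0)) \<in> A n"
  using lin_A unfolding lin_op_def by blast

lemma zero_B: "((\<lambda>_. 0), (\<lambda>_. 0)) \<in> B n"
  using lin_B unfolding lin_op_def by blast

lemma zero_adj: "((\<lambda>_. 0), (\<lambda>_. 0)) \<in> adj_op (fock_n n) (fock_n m) C"
  by (auto simp: adj_op_def zero_fock_n fip_def)

lemma J_fock: "J \<subseteq> fock \<times> fock"
proof
  fix p assume p: "p \<in> J"
  obtain u v where uv: "p = (u, v)" by (cases p)
  note d = jacobi_opD[OF p[unfolded J_def uv]]
  obtain F where "F \<in> fock_fin" "u = tpow i F" using d(1) by blast
  then have "u \<in> fock_fin" using tpow_fock_fin[OF i(1)] by blast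
  then show "p \<in> fock \<times> fock" using d(2) by (simp add: uv fock_fin_iff)
qed

lemma JK_fock: "JK \<subseteq> fock \<times> fock"
proof
  fix p assume p: "p \<in> JK"
  obtain u v where uv: "p = (u, v)" by (cases p)
  note d = jacobi_opD[OF p[unfolded JK_def uv]]
  obtain F where "F \<in> fock_fin" "u = tpow c F" using d(1) by blast
  then have "u \<in> fock_fin" using tpow_fock_fin[OF c] by blast
  then show "p \<in> fock \<times> fock" using d(2) by (simp add: uv fock_fin_iff)
qed

text \<open>Entrywise conjugation. The images have the form \<open>tpow i (tpow K F)\<close>, so
  they may form a proper part of the domain of J; only the closures can be expected to
  correspond.\<close>

lemma JK_J:
  assumes uv: "(u, v) \<in> JK" shows "(tpow U u, tpow U v) \<in> J"
  unfolding J_def jacobi_op_def mem_Collect_eq prod.case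
proof (intro conjI allI)
  note d = jacobi_opD[OF uv[unfolded JK_def]]
  obtain F where F: "F \<in> fock_fin" "u = tpow c F" using d(1) by blast
  show "tpow U u \<in> tpow i ` fock_fin"
    unfolding F(2) tpow_Uc by (intro imageI tpow_fock_fin K F)
  show "tpow U v \<in> fock" by (rule tpow_U_fock[OF d(2)])
  fix n
  obtain x y z where xyz: "case n of 0 \<Rightarrow> x = (\<lambda>_. 0) | Suc m \<Rightarrow> (level m u, x) \<in> pull U (A m)"
    "(level n u, y) \<in> pull U (B n)" "(level (Suc n) u, z) \<in> adj_op (fock_n n) (fock_n (Suc n)) (pull U (A n))"
    "level n v = (\<lambda>xs. x xs + y xs + z xs)" using d(3)[of n] by blast
  have 1: "case n of 0 \<Rightarrow> tpow U x = (\<lambda>_. 0) | Suc m \<Rightarrow> (level m (tpow U u), tpow U x) \<in> A m"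
    using xyz(1) by (cases n) (simp_all add: tpow_0 level_tpow pull_def)
  have 2: "(level n (tpow U u), tpow U y) \<in> B n" using xyz(2) by (simp add: level_tpow pull_def)
  have m: "level (Suc n) u \<in> fock_n (Suc n)" "z \<in> fock_n n" using xyz(3) by (auto simp: adj_op_def)
  have 3: "(level (Suc n) (tpow U u), tpow U z) \<in> adj_op (fock_n n) (fock_n (Suc n)) (A n)"
    using adj_op_pull[OF A_subset m] xyz(3) by (simp add: level_tpow)
  have 4: "level n (tpow U v) = (\<lambda>xs. tpow U x xs + tpow U y xs + tpow U z xs)"
    unfolding level_tpow xyz(4) by (simp add: tpow_def)
  show "\<exists>x y z. (case n of 0 \<Rightarrow> x = (\<lambda>_. 0) | Suc m \<Rightarrow> (level m (tpow U u), x) \<in> A m) \<and>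
      (level n (tpow U u), y) \<in> B n \<and>
      (level (Suc n) (tpow U u), z) \<in> adj_op (fock_n n) (fock_n (Suc n)) (A n) \<and>
      level n (tpow U v) = (\<lambda>xs. x xs + y xs + z xs)"
    using 1 2 3 4 by blast
qed

text \<open>For the zero vector the image is chosen to be zero, so that the families of images
  vanish beyond the degree bound as \<open>jacobi_assemble\<close> demands.\<close>

lemma maps_intoD:
  assumes "maps_into i C (tpow K ` fock_n n) (tpow K ` fock_n m)" and g: "g \<in> fock_n n"
    and "((\<lambda>_. 0), (\<lambda>_. 0)) \<in> C"
  obtains x where "x \<in> fock_n m" "(tpow U (tpow c g), tpow U (tpow c x)) \<in> C" "g = (\<lambda>_. 0) \<Longrightarrow> x = (\<lambda>_. 0)"
proof (cases "g = (\<lambda>_. 0)")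
  case True
  show thesis by (rule that[of "\<lambda>_. 0"]) (simp_all add: True tpow_0 zero_fock_n assms(3))
next
  case False
  from assms(1,2) obtain x where "x \<in> fock_n m" "(tpow K g, tpow K x) \<in> pull i C"
    unfolding maps_into_def by blast
  then show thesis using that False by (simp add: tpow_Uc pull_def)
qed

lemma level_eq_0: "supp_le N F \<Longrightarrow> n > N \<Longrightarrow> level n F = (\<lambda>_. 0)"
  by (auto simp: level_def supp_le_def)

text \<open>The invariance hypotheses supply the images of the components inside the tensor powers
  of the range of \<open>K\<close>. The same G therefore describes the image under the transformed
  matrix and, after \<open>tpow K\<close>, under the original one.\<close>

lemma JK_total:
  assumes F: "F \<in> fock_fin"
  obtains G where "G \<in> fock_fin" "(tpow c F, tpow c G) \<in> JK" "(tpow i (tpow K F), tpow i (tpow K G)) \<in> J"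
proof -
  obtain N where N: "supp_le N F" and Ff: "F \<in> fock" using F by (auto simp: fock_fin_iff)
  note lev = level_fock_n(1)[OF Ff]
  have cf: "tpow c g \<in> fock" if "g \<in> fock_n n" for g n
    using tpow_fock_n[OF c that] by (simp add: fock_n_iff)
  have "\<exists>x. x \<in> fock_n (Suc n) \<and> (tpow c (level n F), tpow c x) \<in> pull U (A n) \<and> (n > N \<longrightarrow> x = (\<lambda>_. 0))" for n
    by (rule maps_intoD[OF maps_A lev zero_A, of n]) (auto simp: pull_def cf[OF lev] cf level_eq_0[OF N])
  then obtain x where x: "\<And>n. x n \<in> fock_n (Suc n)" "\<And>n. (tpow c (level n F), tpow c (x n)) \<in> pull U (A n)"
    "\<And>n. n > N \<Longrightarrow> x n = (\<lambda>_. 0)" by metis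
  have "\<exists>y. y \<in> fock_n n \<and> (tpow c (level n F), tpow c y) \<in> pull U (B n) \<and> (n > N \<longrightarrow> y = (\<lambda>_. 0))" for n
    by (rule maps_intoD[OF maps_B lev zero_B, of n]) (auto simp: pull_def cf[OF lev] cf level_eq_0[OF N])
  then obtain y where y: "\<And>n. y n \<in> fock_n n" "\<And>n. (tpow c (level n F), tpow c (y n)) \<in> pull U (B n)"
    "\<And>n. n > N \<Longrightarrow> y n = (\<lambda>_. 0)" by metis
  have "\<exists>z. z \<in> fock_n n \<and> (tpow c (level (Suc n) F), tpow c z) \<in> adj_op (fock_n n) (fock_n (Suc n)) (pull U (A n))
      \<and> (n > N \<longrightarrow> z = (\<lambda>_. 0))" for n
  proof (rule maps_intoD[OF maps_adj lev zero_adj, of n])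
    fix z assume z: "z \<in> fock_n n"
      "(tpow U (tpow c (level (Suc n) F)), tpow U (tpow c z)) \<in> adj_op (fock_n n) (fock_n (Suc n)) (A n)"
      "level (Suc n) F = (\<lambda>_. 0) \<Longrightarrow> z = (\<lambda>_. 0)"
    have "(tpow c (level (Suc n) F), tpow c z) \<in> adj_op (fock_n n) (fock_n (Suc n)) (pull U (A n))"
      using adj_op_pull[OF A_subset tpow_fock_n[OF c lev] tpow_fock_n[OF c z(1)]] z(2) by blast
    \<comment> \<open>The lowering part in degree n comes from degree n + 1, which also exceeds
      N.\<close>
    moreover have "n > N \<longrightarrow> z = (\<lambda>_. 0)" using z(3) level_eq_0[OF N, of "Suc n"] by simp
    ultimately show ?thesis using z(1) by blast
  qed
  then obtain z where z: "\<And>n. z n \<in> fock_n n"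
    "\<And>n. (tpow c (level (Suc n) F), tpow c (z n)) \<in> adj_op (fock_n n) (fock_n (Suc n)) (pull U (A n))"
    "\<And>n. n > N \<Longrightarrow> z n = (\<lambda>_. 0)" by metis
  obtain G where G: "G \<in> fock_fin" "(tpow c F, tpow c G) \<in> JK"
    unfolding JK_def by (rule jacobi_assemble[OF c Ff N x y z])
  from JK_J[OF G(2)] have "(tpow i (tpow K F), tpow i (tpow K G)) \<in> J" by (simp add: tpow_Uc)
  with G that show thesis by blast
qed

lemma acts_continuouslyD:
  assumes "\<And>n. acts_continuously i (d n) (e n) (C n)"
  obtains D where "\<And>n. D n \<ge> 0"
    "\<And>n g. g \<in> fock_n (d n) \<Longrightarrow> \<exists>x\<in>fock_n (e n). (tpow i g, tpow i x) \<in> C n \<and> fnorm x \<le> D n * fnorm g"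
proof -
  have "\<exists>D. \<forall>g\<in>fock_n (d n). \<exists>x\<in>fock_n (e n). (g, x) \<in> pull i (C n) \<and> fnorm x \<le> D * fnorm g" for n
    using assms[of n] unfolding acts_continuously_def by blast
  then have "\<forall>n. \<exists>D. \<forall>g\<in>fock_n (d n). \<exists>x\<in>fock_n (e n). (g, x) \<in> pull i (C n) \<and> fnorm x \<le> D * fnorm g" by blast
  from choice[OF this] obtain D where
    D: "\<And>n g. g \<in> fock_n (d n) \<Longrightarrow> \<exists>x\<in>fock_n (e n). (g, x) \<in> pull i (C n) \<and> fnorm x \<le> D n * fnorm g" by blast
  show thesis
  proof (rule that[of "\<lambda>n. \<bar>D n\<bar>"])
    fix n and g :: "'hp fvec" assume "g \<in> fock_n (d n)"
    from D[OF this] obtain x where x: "x \<in> fock_n (e n)" "(g, x) \<in> pull i (C n)" "fnorm x \<le> D n * fnorm g" by blast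
    have "D n * fnorm g \<le> \<bar>D n\<bar> * fnorm g" by (intro mult_right_mono fnorm_nonneg) simp
    with x show "\<exists>x\<in>fock_n (e n). (tpow i g, tpow i x) \<in> C n \<and> fnorm x \<le> \<bar>D n\<bar> * fnorm g"
      by (intro bexI[of _ x]) (auto simp: pull_def)
  qed simp
qed

text \<open>The image is measured in the Fock space over H, the argument in that over the positive
  space. For vectors of degree at most N only entries up to degree N + 1 enter, so their continuity
  constants can be summed.\<close>

lemma J_continuous:
  obtains C where "C \<ge> 0"
    "\<And>F. F \<in> fock \<Longrightarrow> supp_le N F \<Longrightarrow> \<exists>w\<in>fock. (tpow i F, w) \<in> J \<and> fnorm w \<le> C * fnorm F"
proof -
  obtain CA where CA: "\<And>n. CA n \<ge> 0"
    "\<And>n g. g \<in> fock_n n \<Longrightarrow> \<exists>x\<in>fock_n (Suc n). (tpow i g, tpow i x) \<in> A n \<and> fnorm x \<le> CA n * fnorm g"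
    using acts_continuouslyD[of "\<lambda>n. n" Suc A, OF acts_A] by blast
  obtain CB where CB: "\<And>n. CB n \<ge> 0"
    "\<And>n g. g \<in> fock_n n \<Longrightarrow> \<exists>x\<in>fock_n n. (tpow i g, tpow i x) \<in> B n \<and> fnorm x \<le> CB n * fnorm g"
    using acts_continuouslyD[of "\<lambda>n. n" "\<lambda>n. n" B, OF acts_B] by blast
  obtain CZ where CZ: "\<And>n. CZ n \<ge> 0"
    "\<And>n g. g \<in> fock_n (Suc n) \<Longrightarrow> \<exists>x\<in>fock_n n. (tpow i g, tpow i x) \<in> adj_op (fock_n n) (fock_n (Suc n)) (A n)
      \<and> fnorm x \<le> CZ n * fnorm g"
    using acts_continuouslyD[of Suc "\<lambda>n. n" "\<lambda>n. adj_op (fock_n n) (fock_n (Suc n)) (A n)", OF acts_adj] by blast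
  define C where "C = (\<Sum>n\<le>Suc N. (case n of 0 \<Rightarrow> 0 | Suc m \<Rightarrow> CA m) + CB n + CZ n)"
  have C0: "C \<ge> 0" unfolding C_def by (intro sum_nonneg) (auto simp: CA(1) CB(1) CZ(1) split: nat.split)
  have "\<exists>w\<in>fock. (tpow i F, w) \<in> J \<and> fnorm w \<le> C * fnorm F" if F: "F \<in> fock" and N: "supp_le N F" for F
  proof -
    note lev = level_fock_n[OF F]
    \<comment> \<open>The estimate also forces vanishing: beyond degree N the component of F is
      zero, so the bound is zero and definiteness of \<open>fnorm\<close> gives x = 0.\<close>
    have bound: "fnorm x \<le> D * fnorm F \<and> (n > N \<longrightarrow> x = (\<lambda>_. 0))"
      if "x \<in> fock_n m" "fnorm x \<le> D * fnorm (level k F)" "D \<ge> 0" "k \<ge> n" for x :: "'hp fvec" and D n m k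
    proof
      show "fnorm x \<le> D * fnorm F"
        using that(2) mult_left_mono[OF lev(2)[of k] that(3)] by (rule order_trans)
      show "n > N \<longrightarrow> x = (\<lambda>_. 0)"
      proof
        assume "n > N"
        then have "level k F = (\<lambda>_. 0)" using that(4) by (intro level_eq_0[OF N]) simp
        then have "fnorm x \<le> 0" using that(2) by (simp add: fnorm_def)
        then have "fnorm x = 0" using fnorm_nonneg[of x] by simp
        then show "x = (\<lambda>_. 0)" using that(1) by (intro fock_eq_0) (auto simp: fock_n_iff)
      qed
    qed
    have "\<exists>x. x \<in> fock_n (Suc n) \<and> (tpow i (level n F), tpow i x) \<in> A n \<and> fnorm x \<le> CA n * fnorm F
        \<and> (n > N \<longrightarrow> x = (\<lambda>_. 0))" for n
      using CA(2)[OF lev(1)[of n]] bound[OF _ _ CA(1) order_refl] by meson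
    then obtain x where x: "\<And>n. x n \<in> fock_n (Suc n)" "\<And>n. (tpow i (level n F), tpow i (x n)) \<in> A n"
      "\<And>n. n > N \<Longrightarrow> x n = (\<lambda>_. 0)" and nx: "\<And>n. fnorm (x n) \<le> CA n * fnorm F" by metis
    have "\<exists>x. x \<in> fock_n n \<and> (tpow i (level n F), tpow i x) \<in> B n \<and> fnorm x \<le> CB n * fnorm F
        \<and> (n > N \<longrightarrow> x = (\<lambda>_. 0))" for n
      using CB(2)[OF lev(1)[of n]] bound[OF _ _ CB(1) order_refl] by meson
    then obtain y where y: "\<And>n. y n \<in> fock_n n" "\<And>n. (tpow i (level n F), tpow i (y n)) \<in> B n"
      "\<And>n. n > N \<Longrightarrow> y n = (\<lambda>_. 0)" and ny: "\<And>n. fnorm (y n) \<le> CB n * fnorm F" by metis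
    have "\<exists>x. x \<in> fock_n n \<and> (tpow i (level (Suc n) F), tpow i x) \<in> adj_op (fock_n n) (fock_n (Suc n)) (A n)
        \<and> fnorm x \<le> CZ n * fnorm F \<and> (n > N \<longrightarrow> x = (\<lambda>_. 0))" for n
      using CZ(2)[OF lev(1)[of "Suc n"]] bound[OF _ _ CZ(1) le_SucI[OF order_refl]] by meson
    then obtain z where z: "\<And>n. z n \<in> fock_n n"
      "\<And>n. (tpow i (level (Suc n) F), tpow i (z n)) \<in> adj_op (fock_n n) (fock_n (Suc n)) (A n)"
      "\<And>n. n > N \<Longrightarrow> z n = (\<lambda>_. 0)" and nz: "\<And>n. fnorm (z n) \<le> CZ n * fnorm F" by metis
    obtain G where G: "G \<in> fock_fin" "(tpow i F, tpow i G) \<in> J"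
      "fnorm G \<le> (\<Sum>n\<le>Suc N. (case n of 0 \<Rightarrow> 0 | Suc m \<Rightarrow> fnorm (x m)) + fnorm (y n) + fnorm (z n))"
      unfolding J_def by (rule jacobi_assemble[OF i(1) F N x y z])
    have Gf: "G \<in> fock" using G(1) by (simp add: fock_fin_iff)
    note G(3)
    also have "(\<Sum>n\<le>Suc N. (case n of 0 \<Rightarrow> 0 | Suc m \<Rightarrow> fnorm (x m)) + fnorm (y n) + fnorm (z n))
        \<le> (\<Sum>n\<le>Suc N. ((case n of 0 \<Rightarrow> 0 | Suc m \<Rightarrow> CA m) + CB n + CZ n) * fnorm F)"
      unfolding distrib_right by (intro sum_mono add_mono ny nz) (simp add: nx split: nat.split)
    also have "\<dots> = C * fnorm F" unfolding C_def by (rule sum_distrib_right[symmetric])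
    \<comment> \<open>Here the contractive embedding passes from the norm over the positive space to
      the norm over H.\<close>
    finally have "fnorm (tpow i G) \<le> C * fnorm F"
      using tpow_contraction(2)[OF i Gf] by (rule order_trans[rotated])
    then show ?thesis using G(2) tpow_contraction(1)[OF i Gf] by blast
  qed
  with C0 that show thesis by blast
qed

text \<open>\<open>J\<close> is continuous in the norm of the positive space on vectors of bounded degree, where the
  image of \<open>tpow K\<close> is dense; hence restricting \<open>J\<close> to this image does not change the closure.\<close>
lemma J_approx:
  assumes uv: "(u, v) \<in> J" and e: "e > 0"
  obtains s t where "(s, t) \<in> JK" "fnorm (\<lambda>xs. tpow U s xs - u xs) < e" "fnorm (\<lambda>xs. tpow U t xs - v xs) < e"
proof -
  obtain F where F: "F \<in> fock_fin" "u = tpow i F" using jacobi_opD(1)[OF uv[unfolded J_def]] by blast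
  obtain N where N: "supp_le N F" and Ff: "F \<in> fock" using F(1) by (auto simp: fock_fin_iff)
  obtain C where C: "C \<ge> 0"
    "\<And>F. F \<in> fock \<Longrightarrow> supp_le N F \<Longrightarrow> \<exists>w\<in>fock. (tpow i F, w) \<in> J \<and> fnorm w \<le> C * fnorm F"
    using J_continuous by blast
  obtain s where s: "\<And>k::nat. s k \<in> fock_fin" "\<And>k. supp_le N (s k)"
    "(\<lambda>k. fnorm (\<lambda>xs. tpow K (s k) xs - F xs)) \<longlonglongrightarrow> 0"
    using tpow_dense[OF K countable Ff N] by blast
  \<comment> \<open>This bound makes both |R| and C |R| smaller than e, which controls the arguments
    and the images at once.\<close>
  have "e / (C + 1) > 0" using e C(1) by simp
  from order_tendstoD(2)[OF s(3) this] obtain k where k: "fnorm (\<lambda>xs. tpow K (s k) xs - F xs) < e / (C + 1)"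
    using eventually_happens trivial_limit_sequentially by blast
  let ?R = "\<lambda>xs. tpow K (s k) xs - F xs"
  have Ks: "tpow K (s k) \<in> fock" using tpow_fock_fin[OF K(1) s(1)] by (simp add: fock_fin_iff)
  have R: "?R \<in> fock" by (rule fock_diff[OF Ks Ff])
  have RN: "supp_le N ?R" using supp_le_tpow[OF s(2), where A = K] N by (simp add: supp_le_def)
  obtain w where w: "(tpow i ?R, w) \<in> J" "fnorm w \<le> C * fnorm ?R" using C(2)[OF R RN] by blast
  obtain G where G: "(tpow c (s k), tpow c G) \<in> JK" "(tpow i (tpow K (s k)), tpow i (tpow K G)) \<in> J"
    using JK_total[OF s(1)] by blast
  have "((\<lambda>xs. tpow i (tpow K (s k)) xs - u xs), (\<lambda>xs. tpow i (tpow K G) xs - v xs)) \<in> J"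
    unfolding J_def by (rule jacobi_op_diff[OF lin_A lin_B G(2)[unfolded J_def] uv[unfolded J_def]])
  then have "(tpow i ?R, (\<lambda>xs. tpow i (tpow K G) xs - v xs)) \<in> J" by (simp add: F(2) tpow_diff)
  \<comment> \<open>Continuity yields some image w of the difference, linearity another one;
    single-valuedness identifies them, so the norm bound holds for the latter.\<close>
  with w(1) have weq: "w = (\<lambda>xs. tpow i (tpow K G) xs - v xs)"
    using single_valued unfolding single_valued_def J_def by blast
  have small: "x < e" if "x \<le> C * fnorm ?R \<or> x \<le> fnorm ?R" for x
  proof -
    have "C * fnorm ?R \<le> (C + 1) * fnorm ?R" "fnorm ?R \<le> (C + 1) * fnorm ?R"
      using C(1) fnorm_nonneg[of ?R] by (simp_all add: distrib_right)
    moreover have "(C + 1) * fnorm ?R < e" using k C(1) by (simp add: pos_less_divide_eq mult.commute)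
    ultimately show ?thesis using that by linarith
  qed
  show thesis
  proof (rule that[OF G(1)])
    have "fnorm (tpow i ?R) \<le> fnorm ?R" by (rule tpow_contraction(2)[OF i R])
    then show "fnorm (\<lambda>xs. tpow U (tpow c (s k)) xs - u xs) < e"
      by (intro small) (simp add: tpow_Uc F(2) tpow_diff)
    show "fnorm (\<lambda>xs. tpow U (tpow c G) xs - v xs) < e"
      using w(2) by (intro small) (simp add: tpow_Uc weq)
  qed
qed

text \<open>From left to right the isometry carries an approximating sequence over. The converse
  depends on \<open>J_approx\<close>: points of J must be reached from conjugated points of
  \<open>JK\<close>.\<close>

lemma cl_JK_iff:
  assumes u: "u \<in> fock" and v: "v \<in> fock"
  shows "(u, v) \<in> cl_op JK \<longleftrightarrow> (tpow U u, tpow U v) \<in> cl_op J"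
proof
  assume "(u, v) \<in> cl_op JK"
  then obtain s t where st: "\<And>k::nat. (s k, t k) \<in> JK" "(\<lambda>k. fnorm (\<lambda>xs. s k xs - u xs)) \<longlonglongrightarrow> 0"
    "(\<lambda>k. fnorm (\<lambda>xs. t k xs - v xs)) \<longlonglongrightarrow> 0" unfolding cl_op_def by blast
  have f: "s k \<in> fock" "t k \<in> fock" for k using st(1)[of k] JK_fock by auto
  show "(tpow U u, tpow U v) \<in> cl_op J"
    by (rule cl_opI[of _ _ "\<lambda>k. tpow U (s k)" "\<lambda>k. tpow U (t k)"])
      (simp_all add: tpow_U_fock u v JK_J st fnorm_tpow_U_diff f)
next
  assume uv: "(tpow U u, tpow U v) \<in> cl_op J"
  \<comment> \<open>The copy of \<open>JK\<close> inside the graph of J. Its closure contains that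
    of J, and the isometry pulls its approximating sequences back.\<close>
  define J' where "J' = (\<lambda>(s, t). (tpow U s, tpow U t)) ` JK"
  have "(tpow U u, tpow U v) \<in> cl_op J'"
  proof (rule cl_op_approx[OF uv J_fock])
    show "J' \<subseteq> fock \<times> fock" using JK_fock by (auto simp: J'_def tpow_U_fock)
    fix s t and e :: real assume "(s, t) \<in> J" "e > 0"
    then obtain s' t' where "(s', t') \<in> JK" "fnorm (\<lambda>xs. tpow U s' xs - s xs) < e" "fnorm (\<lambda>xs. tpow U t' xs - t xs) < e"
      by (rule J_approx)
    then show "\<exists>s' t'. (s', t') \<in> J' \<and> fnorm (\<lambda>xs. s' xs - s xs) < e \<and> fnorm (\<lambda>xs. t' xs - t xs) < e"
      unfolding J'_def by (intro exI[of _ "tpow U s'"] exI[of _ "tpow U t'"]) force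
  qed
  then obtain s t where st: "\<And>k::nat. (s k, t k) \<in> J'" "(\<lambda>k. fnorm (\<lambda>xs. s k xs - tpow U u xs)) \<longlonglongrightarrow> 0"
    "(\<lambda>k. fnorm (\<lambda>xs. t k xs - tpow U v xs)) \<longlonglongrightarrow> 0" unfolding cl_op_def by blast
  have "\<forall>k. \<exists>p. p \<in> JK \<and> s k = tpow U (fst p) \<and> t k = tpow U (snd p)"
    using st(1) unfolding J'_def by force
  from choice[OF this] obtain p where p: "\<And>k. p k \<in> JK" "\<And>k. s k = tpow U (fst (p k))" "\<And>k. t k = tpow U (snd (p k))"
    by blast
  have f: "fst (p k) \<in> fock" "snd (p k) \<in> fock" for k using p(1)[of k] JK_fock by auto
  show "(u, v) \<in> cl_op JK"
    by (rule cl_opI[of _ _ "\<lambda>k. fst (p k)" "\<lambda>k. snd (p k)"])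
      (use st(2,3) in \<open>simp_all add: u v p fnorm_tpow_U_diff f\<close>)
qed

end

theorem theorem3p1:
  fixes iH :: "'hp::{real_inner, complete_space} \<Rightarrow> 'h::{real_inner, polish_space}"
    and jH :: "'h \<Rightarrow> 'hm::{real_inner, complete_space}"
    and prH :: "'hm \<Rightarrow> 'hp \<Rightarrow> real"
    and iT :: "'tp::{real_inner, polish_space} \<Rightarrow> 't0::{real_inner, complete_space}"
    and jT :: "'t0 \<Rightarrow> 'tm::{real_inner, complete_space}"
    and prT :: "'tm \<Rightarrow> 'tp \<Rightarrow> real"
    and a b :: "nat \<Rightarrow> 'hp \<Rightarrow> 'h fop"
    and \<rho> :: "'hm measure"
    and P :: "'hm \<Rightarrow> 'hm fvec"
    and K :: "'tp \<Rightarrow> 'hp"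
    and c :: "'tp \<Rightarrow> 't::{real_inner, complete_space}"
  assumes "rigging iH jH prH" and "\<And>\<phi>. norm (iH \<phi>) \<le> norm \<phi>" and "quasinuclear iH"
    and "rigging iT jT prT"
    and "jacobi_field iH a b"
    and "spectral_data iH prH (\<lambda>\<phi>. cl_op (jacobi_op iH (\<lambda>n. a n \<phi>) (\<lambda>n. b n \<phi>))) \<rho> P"
    and "bounded_linear K" and "{f. K f = 0} = {0}" and "closure (range K) = UNIV"
    and "completion_map (iH \<circ> K) c"
    and "\<And>f n. maps_into iH (a n (K f)) (tpow K ` fock_n n) (tpow K ` fock_n (Suc n))"
    and "\<And>f n. maps_into iH (b n (K f)) (tpow K ` fock_n n) (tpow K ` fock_n n)"
    and "\<And>f n. maps_into iH (adj_op (fock_n n) (fock_n (Suc n)) (a n (K f)))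
           (tpow K ` fock_n (Suc n)) (tpow K ` fock_n n)"
  shows "\<exists>Q :: 'tm \<Rightarrow> 'tm fvec.
    (\<forall>\<omega>. Q \<omega> \<in> fock_prod) \<and>
    (AE \<omega> in image_measure \<rho> (dual_op prH prT K).
       \<forall>f. gen_eigenvector c prT (cl_op (J_K iH a b K c f)) (prT \<omega> f) (Q \<omega>)) \<and>
    (\<exists>I_K. fourier_extension c prT (image_measure \<rho> (dual_op prH prT K)) Q I_K \<and>
       (\<forall>f. takes_to_multiplication (image_measure \<rho> (dual_op prH prT K)) I_K
              (cl_op (J_K iH a b K c f)) (\<lambda>\<omega>. prT \<omega> f)))"
proof -
  note RH = assms(1) and RT = assms(4) and field = assms(5) and spec = assms(6) and lK = assms(7,9) and c = assms(10)
  define U where "U = extension (iH \<circ> K) c"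
  define M where "M = image_measure \<rho> (dual_op prH prT K)"
  define J where "J \<phi> = jacobi_op iH (\<lambda>n. a n \<phi>) (\<lambda>n. b n \<phi>)" for \<phi>
  interpret dual_operator iH jH prH iT jT prT K
    by (rule dual_operator.intro[OF RH RT lK])
  have iH: "bounded_linear iH" "inj iH" using riggingD(1,2)[OF RH] .
  have iHK: "bounded_linear (iH \<circ> K)" using bounded_linear_compose[OF iH(1) lK(1)] by (simp add: comp_def)
  have dense: "closure (range (iH \<circ> K)) = UNIV"
  proof -
    have "iH ` closure (range K) \<subseteq> closure (iH ` range K)"
      by (rule image_closure_subset[OF linear_continuous_on[OF iH(1)] closed_closure closure_subset])
    then have "range iH \<subseteq> closure (range (iH \<circ> K))" by (simp add: lK(2) image_comp)
    from closure_minimal[OF this closed_closure] show ?thesis using riggingD(3)[OF RH] by auto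
  qed
  note ext = extension_isometry[OF c bounded_linear.linear[OF iHK], folded U_def]
  interpret unitary U
    by (rule unitary.intro)
      (use ext extension_surj[OF c bounded_linear.linear[OF iHK] dense, folded U_def] in auto)
  \<comment> \<open>The isometry U turns c into iH o K, so c inherits the bound of the
    latter.\<close>
  have c_lin: "bounded_linear c"
  proof -
    obtain C where C: "\<And>x. norm ((iH \<circ> K) x) \<le> norm x * C" using bounded_linear.bounded[OF iHK] by blast
    show ?thesis
    proof (rule bounded_linear_intro)
      show "norm (c x) \<le> norm x * C" for x
        using C[of x] isometry[of "c x"] ext(2)[of x] by simp
    qed (use c in \<open>auto simp: completion_map_def linear_add linear_scale\<close>)
  qed
  have Uc: "U \<circ> c = iH \<circ> K" using ext(2) by (simp add: fun_eq_iff)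
  have tUc: "tpow U (tpow c u) = tpow iH (tpow K u)" for u
    by (simp add: tpow_compose[OF c_lin lin] tpow_compose[OF lK(1) iH(1)] Uc)

  have \<rho>: "sets \<rho> = sets borel" and P: "\<And>\<xi>. P \<xi> \<in> fock_prod"
    and eigen: "\<And>\<xi> \<phi>. gen_eigenvector iH prH (cl_op (J \<phi>)) (prH \<xi> \<phi>) (P \<xi>)"
    using spec unfolding spectral_data_def J_def by blast+
  obtain I where I: "fourier_extension iH prH \<rho> P I"
    "\<And>\<phi>. takes_to_multiplication \<rho> I (cl_op (J \<phi>)) (\<lambda>\<xi>. prH \<xi> \<phi>)"
    using spec unfolding spectral_data_def J_def by blast
  have I_uni: "unitary_onto_L2 \<rho> I" and I_P: "\<And>F. F \<in> fock_fin \<Longrightarrow> (\<lambda>\<xi>. cnj (fpair prH (P \<xi>) F)) \<in> L2 \<rho>"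
    "\<And>F. F \<in> fock_fin \<Longrightarrow> AE \<xi> in \<rho>. I (tpow iH F) \<xi> = cnj (fpair prH (P \<xi>) F)"
    using I(1) unfolding fourier_extension_def by blast+
  have I_L2: "\<And>u. u \<in> fock \<Longrightarrow> I u \<in> L2 \<rho>"
    and I_norm: "\<And>u. u \<in> fock \<Longrightarrow> (\<integral>\<xi>. (cmod (I u \<xi>))\<^sup>2 \<partial>\<rho>) = (fnorm u)\<^sup>2"
    and I_lin: "\<And>u v r. u \<in> fock \<Longrightarrow> v \<in> fock \<Longrightarrow> AE \<xi> in \<rho>. I (\<lambda>xs. u xs + r * v xs) \<xi> = I u \<xi> + r * I v \<xi>"
    and I_surj: "\<And>g. g \<in> L2 \<rho> \<Longrightarrow> \<exists>u\<in>fock. AE \<xi> in \<rho>. I u \<xi> = g \<xi>"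
    using I_uni unfolding unitary_onto_L2_def by blast+
  \<comment> \<open>Two images of u have the same transform under \<open>I\<close> almost
    everywhere, and \<open>I\<close> preserves norms.\<close>
  have sv: "v = v'" if v: "(u, v) \<in> cl_op (J \<phi>)" and v': "(u, v') \<in> cl_op (J \<phi>)" for u v v' \<phi>
  proof -
    have f: "u \<in> fock" "v \<in> fock" "v' \<in> fock" using v v' by (auto simp: cl_op_def)
    have "AE \<xi> in \<rho>. I v \<xi> = of_real (prH \<xi> \<phi>) * I u \<xi>" "AE \<xi> in \<rho>. I v' \<xi> = of_real (prH \<xi> \<phi>) * I u \<xi>"
      using I(2)[of \<phi>] f v v' unfolding takes_to_multiplication_def by blast+
    moreover have "AE \<xi> in \<rho>. I (\<lambda>xs. v xs + (-1) * v' xs) \<xi> = I v \<xi> + (-1) * I v' \<xi>"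
      by (rule I_lin[OF f(2,3)])
    ultimately have "AE \<xi> in \<rho>. (cmod (I (\<lambda>xs. v xs + (-1) * v' xs) \<xi>))\<^sup>2 = 0"
      by eventually_elim simp
    then have "(\<integral>\<xi>. (cmod (I (\<lambda>xs. v xs + (-1) * v' xs) \<xi>))\<^sup>2 \<partial>\<rho>) = 0"
      by (rule integral_eq_zero_AE)
    then have "fnorm (\<lambda>xs. v xs - v' xs) = 0"
      using I_norm[OF fock_add_scale[OF f(2,3), of "-1"]] by simp
    from fock_eq_0[OF fock_diff[OF f(2,3)] this] show ?thesis by (simp add: fun_eq_iff)
  qed
  have field':
    "\<And>n \<phi>. lin_op (fock_n n) (fock_n (Suc n)) (a n \<phi>)" "\<And>n \<phi>. lin_op (fock_n n) (fock_n n) (b n \<phi>)"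
    "\<And>n \<phi>. acts_continuously iH n (Suc n) (a n \<phi>)" "\<And>n \<phi>. acts_continuously iH n n (b n \<phi>)"
    "\<And>n \<phi>. acts_continuously iH (Suc n) n (adj_op (fock_n n) (fock_n (Suc n)) (a n \<phi>))"
  proof -
    note d = field[unfolded jacobi_field_def Let_def]
    note d1 = d[THEN conjunct1, rule_format] and d3 = d[THEN conjunct2, THEN conjunct2, THEN conjunct1, rule_format]
    show "lin_op (fock_n n) (fock_n (Suc n)) (a n \<phi>)" for n \<phi> using d1[of n \<phi>] by (elim conjE)
    show "lin_op (fock_n n) (fock_n n) (b n \<phi>)" for n \<phi> using d1[of n \<phi>] by (elim conjE)
    show "acts_continuously iH n (Suc n) (a n \<phi>)" for n \<phi> using d3[of n \<phi>] by (elim conjE)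
    show "acts_continuously iH n n (b n \<phi>)" for n \<phi> using d3[of n \<phi>] by (elim conjE)
    show "acts_continuously iH (Suc n) n (adj_op (fock_n n) (fock_n (Suc n)) (a n \<phi>))" for n \<phi>
      using d3[of n \<phi>] by (elim conjE)
  qed
  have J_sub: "J \<phi> \<subseteq> cl_op (J \<phi>)" for \<phi>
  proof (rule cl_op_subset, rule subsetI)
    fix p assume p: "p \<in> J \<phi>"
    obtain u v where uv: "p = (u, v)" by (cases p)
    note d = jacobi_opD[OF p[unfolded J_def uv]]
    obtain F where "F \<in> fock_fin" "u = tpow iH F" using d(1) by blast
    then have "u \<in> fock_fin" using tpow_fock_fin[OF iH(1)] by blast
    then show "p \<in> fock \<times> fock" using d(2) by (simp add: uv fock_fin_iff)
  qed
  have transport: "jacobi_transport U iH K c (\<lambda>n. a n (K f)) (\<lambda>n. b n (K f))" for f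
  proof (intro jacobi_transport.intro jacobi_transport_axioms.intro)
    show "unitary U" by (rule unitary_axioms)
    show "single_valued (jacobi_op iH (\<lambda>n. a n (K f)) (\<lambda>n. b n (K f)))"
      by (rule single_valuedI) (use sv[of _ _ "K f"] J_sub[of "K f"] in \<open>auto simp: J_def\<close>)
    show "countable (onb :: 'hp set)" by (rule countable_onb[OF assms(3) iH(2)])
  qed (rule iH(1) assms(2) lK c_lin Uc field' assms(11-13))+
  have JK_eq: "J_K iH a b K c f = jacobi_transport.JK U c (\<lambda>n. a n (K f)) (\<lambda>n. b n (K f))" for f
    by (simp add: J_K_def Let_def U_def[symmetric] jacobi_transport.JK_def[OF transport])
  have J_eq: "J (K f) = jacobi_transport.J iH (\<lambda>n. a n (K f)) (\<lambda>n. b n (K f))" for f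
    by (simp add: J_def jacobi_transport.J_def[OF transport])
  \<comment> \<open>Both directions are required, since \<open>takes_to_multiplication\<close>
    characterises the graph by an equivalence with maximal domain.\<close>
  have cl_iff: "(u, v) \<in> cl_op (J_K iH a b K c f) \<longleftrightarrow> (tpow U u, tpow U v) \<in> cl_op (J (K f))"
    if "u \<in> fock" "v \<in> fock" for u v f
    unfolding JK_eq J_eq by (rule jacobi_transport.cl_JK_iff[OF transport that])

  \<comment> \<open>Off the range of D the inverse takes arbitrary values. \<open>Q\<close> still
    lies in \<open>fock_prod\<close> there, and every other property is asserted only almost
    everywhere or up to null sets.\<close>
  define Q where "Q \<omega> = tpow D (P (inv D \<omega>))" for \<omega>
  define I_K where "I_K u \<omega> = I (tpow U u) (inv D \<omega>)" for u \<omega>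
  have Q_D: "Q (D \<xi>) = tpow D (P \<xi>)" and I_K_D: "I_K u (D \<xi>) = I (tpow U u) \<xi>" for u \<xi>
    by (simp_all add: Q_def I_K_def inv_f_f[OF inj_D])
  have pair: "fpair prT (Q (D \<xi>)) F = fpair prH (P \<xi>) (tpow K F)" if "F \<in> fock_fin" for \<xi> F
    unfolding Q_D by (rule fpair_D[OF P that])
  note AE_M = AE_image_measure[OF \<rho> inj_D, folded M_def]
  note L2_M = L2_image_measure[OF \<rho>, of _ D, folded M_def]

  have 1: "Q \<omega> \<in> fock_prod" for \<omega> unfolding Q_def by (rule fock_prod_D[OF P])
  \<comment> \<open>Proved at every point of the range of D and for every f, so one exceptional null
    set serves all f simultaneously.\<close>
  have "gen_eigenvector c prT (cl_op (J_K iH a b K c f)) (prT (D \<xi>) f) (Q (D \<xi>))" for \<xi> f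
    unfolding gen_eigenvector_def
  proof
    fix F :: "'tp fvec" assume F: "F \<in> fock_fin"
    obtain G where G: "G \<in> fock_fin" "(tpow c F, tpow c G) \<in> J_K iH a b K c f"
      "(tpow iH (tpow K F), tpow iH (tpow K G)) \<in> J (K f)"
      using jacobi_transport.JK_total[OF transport F, folded JK_eq J_eq] by blast
    have KF: "tpow K F \<in> fock_fin" "tpow K G \<in> fock_fin" using F G(1) by (simp_all add: tpow_fock_fin[OF lK(1)])
    \<comment> \<open>The eigenvector property of P yields some image G' over the positive space of
      H. Single-valuedness and injectivity of \<open>tpow iH\<close> show that it is
      \<open>tpow K G\<close>, hence comes from the positive space of T.\<close>
    obtain G' where G': "G' \<in> fock_fin" "(tpow iH (tpow K F), tpow iH G') \<in> cl_op (J (K f))"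
      "fpair prH (P \<xi>) G' = of_real (prH \<xi> (K f)) * fpair prH (P \<xi>) (tpow K F)"
      using eigen[of "K f" \<xi>] KF(1) unfolding gen_eigenvector_def by blast
    have "tpow iH G' = tpow iH (tpow K G)" using sv[OF G'(2)] G(3) J_sub by blast
    then have "G' = tpow K G"
      using G'(1) KF(2) by (intro tpow_inj[OF iH]) (auto simp: fock_fin_iff)
    with G'(3) have "fpair prT (Q (D \<xi>)) G = of_real (prT (D \<xi>) f) * fpair prT (Q (D \<xi>)) F"
      by (simp add: pair F G(1) prT_D)
    moreover have "(tpow c F, tpow c G) \<in> cl_op (J_K iH a b K c f)"
      using G(2) cl_op_subset[OF jacobi_transport.JK_fock[OF transport]] unfolding JK_eq by blast
    ultimately show "\<exists>G\<in>fock_fin. (tpow c F, tpow c G) \<in> cl_op (J_K iH a b K c f) \<and>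
        fpair prT (Q (D \<xi>)) G = of_real (prT (D \<xi>) f) * fpair prT (Q (D \<xi>)) F"
      using G(1) by blast
  qed
  then have 2: "AE \<omega> in M. \<forall>f. gen_eigenvector c prT (cl_op (J_K iH a b K c f)) (prT \<omega> f) (Q \<omega>)"
    unfolding AE_M by simp
  have uni: "unitary_onto_L2 M I_K"
    unfolding unitary_onto_L2_def
  proof (intro conjI ballI allI)
    fix u :: "'t fvec" assume u: "u \<in> fock"
    show L2: "I_K u \<in> L2 M" unfolding L2_M(1) I_K_D by (rule I_L2[OF tpow_U_fock[OF u]])
    show "(\<integral>\<omega>. (cmod (I_K u \<omega>))\<^sup>2 \<partial>M) = (fnorm u)\<^sup>2"
      unfolding L2_M(2)[OF L2] I_K_D by (simp add: I_norm tpow_U_fock u fnorm_tpow_U)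
    fix v :: "'t fvec" and r assume v: "v \<in> fock"
    show "AE \<omega> in M. I_K (\<lambda>xs. u xs + r * v xs) \<omega> = I_K u \<omega> + r * I_K v \<omega>"
      unfolding AE_M I_K_D tpow_add_scale by (rule I_lin[OF tpow_U_fock[OF u] tpow_U_fock[OF v]])
  next
    \<comment> \<open>Surjectivity: g o D is the transform of some u under \<open>I\<close>, and the
      inverse tensor power of U carries u back.\<close>
    fix g assume "g \<in> L2 M"
    then have "(\<lambda>\<xi>. g (D \<xi>)) \<in> L2 \<rho>" by (simp add: L2_M(1))
    then obtain u where u: "u \<in> fock" "AE \<xi> in \<rho>. I u \<xi> = g (D \<xi>)" using I_surj by blast
    show "\<exists>u\<in>fock. AE \<omega> in M. I_K u \<omega> = g \<omega>"
      by (rule bexI[of _ "tpow (adjoint U) u"])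
        (simp_all add: AE_M I_K_D tpow_U_adjoint u tpow_adjoint_fock)
  qed
  have 3: "fourier_extension c prT M Q I_K"
    unfolding fourier_extension_def
  proof (intro conjI ballI uni)
    fix F :: "'tp fvec" assume F: "F \<in> fock_fin"
    have KF: "tpow K F \<in> fock_fin" by (rule tpow_fock_fin[OF lK(1) F])
    show "(\<lambda>\<omega>. cnj (fpair prT (Q \<omega>) F)) \<in> L2 M"
      unfolding L2_M(1) pair[OF F] by (rule I_P(1)[OF KF])
    show "AE \<omega> in M. I_K (tpow c F) \<omega> = cnj (fpair prT (Q \<omega>) F)"
      unfolding AE_M I_K_D pair[OF F] tUc by (rule I_P(2)[OF KF])
  qed
  have 4: "takes_to_multiplication M I_K (cl_op (J_K iH a b K c f)) (\<lambda>\<omega>. prT \<omega> f)" for f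
    unfolding takes_to_multiplication_def
  proof (intro ballI)
    fix u v :: "'t fvec" assume uv: "u \<in> fock" "v \<in> fock"
    show "(u, v) \<in> cl_op (J_K iH a b K c f) \<longleftrightarrow> (AE \<omega> in M. I_K v \<omega> = of_real (prT \<omega> f) * I_K u \<omega>)"
      using I(2)[of "K f"] tpow_U_fock[OF uv(1)] tpow_U_fock[OF uv(2)]
      unfolding cl_iff[OF uv] AE_M I_K_D prT_D takes_to_multiplication_def by blast
  qed
  show ?thesis
    unfolding M_def[symmetric] using 1 2 3 4 by blast
qed

end
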